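(* Let $\mathcal S\subset\mathbb H^1$ be a strict graphical strip. Then $\mathcal S$ is unstable. In fact, there exists a continuum of functions $h\in C^2_0(\mathcal S)$ for which $\mathcal V^H_{II}(\mathcal S;h\,\boldsymbol\nu^H)<0$.
   Context: $\mathbb H^1$ is $\mathbb R^3$ with the group law $(x,y,t)\circ(x',y',t')=(x+x',y+y',t+t'+\tfrac12(xy'-x'y))$. Left-invariant vector fields: $X_1=\partial_x-\tfrac y2\partial_t$, $X_2=\partial_y+\tfrac x2\partial_t$, $T=\partial_t$, declared orthonormal. The characteristic locus of a $C^2$ surface $\mathcal S$ is $\Sigma(\mathcal S)=\{g\in\mathcal S\mid T_g\mathcal S=\mathrm{span}\{X_1(g),X_2(g)\}\}$. If $\Sigma(\mathcal S)=\varnothing$ and $\mathcal S$ is oriented by a local $C^2$ defining function $\phi$, put $p=X_1\phi$, $q=X_2\phi$, $W=\sqrt{p^2+q^2}$, $\bar p=p/W$, $\bar q=q/W$; the horizontal Gauss map is $\boldsymbol\nu^H=\bar pX_1+\bar qX_2$ and the $H$-mean curvature is $\mathcal H=X_1\bar p+X_2\bar q$ restricted to $\mathcal S$. $\mathcal S$ is $H$-minimal if $\mathcal H\equiv0$. The $H$-perimeter measure on $\mathcal S$ is $d\sigma_H=\frac{W}{|\nabla_{e}\phi|}\,d\mathcal H^2$, with $\nabla_e$ the Euclidean gradient and $\mathcal H^2$ the Euclidean surface measure, and $P_H(\mathcal S)=\sigma_H(\mathcal S)$. Variations: for $\mathcal X=aX_1+bX_2+kT$ with $a,b,k\in C^2_0(\mathcal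 S)$ (compactly supported $C^2$ functions on $\mathcal S$), let $\mathcal S^\lambda=\mathcal S+\lambda\mathcal X$, i.e. each $g\in\mathcal S$ is moved to $g+\lambda\mathcal X(g)$ ($\lambda$ small). The second variation is $\mathcal V^H_{II}(\mathcal S;\mathcal X)=\frac{d^2}{d\lambda^2}P_H(\mathcal S^\lambda)|_{\lambda=0}$ (only the perimeter of a compact portion containing the support of $\mathcal X$ matters). An $H$-minimal $\mathcal S$ with empty characteristic locus is stable if $\mathcal V^H_{II}(\mathcal S;\mathcal X)\ge0$ for every such $\mathcal X$, and unstable if there is $\mathcal X$ with $\mathcal V^H_{II}(\mathcal S;\mathcal X)<0$. Graphical strip: a $C^2$ surface $\mathcal S\subset\mathbb H^1$ for which there exist an (open) interval $I\subset\mathbb R$ and $G\in C^2(I)$ with $G'\ge0$ on $I$ such that, after possibly a left-translation and a rotation about the $t$-axis, either $\mathcal S=\{(x,y,t)\mid (y,t)\in\mathbb R\times I,\ x=yG(t)\}$ or $\mathcal S=\{(x,y,t)\mid (x,t)\in\mathbb R\times I,\ y=-xG(t)\}$. It is a strict graphical strip if moreover there is a (nonempty open) subinterval $J\subset I$ with $G'>0$ on $J$. (Graphical strips are $H$-minimal with empty characteristic locus, so $\boldsymbol\nu^H$ is globally defined.) *)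

theory Defs
  imports "HOL-Analysis.Analysis" "HOL-Library.Equipollence"
begin

definition C2_on :: "'a::real_normed_vector set \<Rightarrow> ('a \<Rightarrow> 'b::real_normed_vector) \<Rightarrow> bool" where
  "C2_on U f \<longleftrightarrow> open U \<and>
     (\<exists>(f' :: 'a \<Rightarrow> 'a \<Rightarrow>\<^sub>L 'b) (f'' :: 'a \<Rightarrow> 'a \<Rightarrow>\<^sub>L ('a \<Rightarrow>\<^sub>L 'b)).
        (\<forall>x\<in>U. (f has_derivative blinfun_apply (f' x)) (at x)) \<and>
        (\<forall>x\<in>U. (f' has_derivative blinfun_apply (f'' x)) (at x)) \<and>
        continuous_on U f'')"

definition gradient :: "(real^3 \<Rightarrow> real) \<Rightarrow> real^3 \<Rightarrow> real^3" where
  "gradient \<phi> g = (\<chi> i. frechet_derivative \<phi> (at g) (axis i 1))"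

definition heis_mult :: "real^3 \<Rightarrow> real^3 \<Rightarrow> real^3" where
  "heis_mult g g' = vector [g$1 + g'$1, g$2 + g'$2, g$3 + g'$3 + (g$1 * g'$2 - g'$1 * g$2) / 2]"

definition rotation_t :: "real \<Rightarrow> real^3 \<Rightarrow> real^3" where
  "rotation_t \<theta> g = vector [cos \<theta> * g$1 - sin \<theta> * g$2, sin \<theta> * g$1 + cos \<theta> * g$2, g$3]"

definition X1 :: "real^3 \<Rightarrow> real^3" where "X1 g = vector [1, 0, - (g$2 / 2)]"

definition X2 :: "real^3 \<Rightarrow> real^3" where "X2 g = vector [0, 1, g$1 / 2]"

definition T :: "real^3 \<Rightarrow> real^3" where "T g = vector [0, 0, 1]"

definition lie :: "(real^3 \<Rightarrow> real^3) \<Rightarrow> (real^3 \<Rightarrow> real) \<Rightarrow> real^3 \<Rightarrow> real" where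
  "lie Y \<phi> g = frechet_derivative \<phi> (at g) (Y g)"

definition local_defining :: "(real^3) set \<Rightarrow> (real^3) set \<Rightarrow> (real^3 \<Rightarrow> real) \<Rightarrow> bool" where
  "local_defining S U \<phi> \<longleftrightarrow>
     open U \<and> C2_on U \<phi> \<and> (\<forall>x\<in>U. gradient \<phi> x \<noteq> 0) \<and> S \<inter> U = {x\<in>U. \<phi> x = 0}"

definition C2_surface :: "(real^3) set \<Rightarrow> bool" where
  "C2_surface S \<longleftrightarrow> (\<forall>g\<in>S. \<exists>U \<phi>. g \<in> U \<and> local_defining S U \<phi>)"

definition tangent_space :: "(real^3) set \<Rightarrow> real^3 \<Rightarrow> (real^3) set" where
  "tangent_space S g = {v. \<exists>(\<gamma> :: real \<Rightarrow> real^3) \<epsilon>. \<epsilon> > 0 \<and> \<gamma> ` {-\<epsilon><..<\<epsilon>} \<subseteq> S \<and> \<gamma> 0 = g \<and>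
      (\<gamma> has_vector_derivative v) (at 0)}"

definition char_locus :: "(real^3) set \<Rightarrow> (real^3) set" where
  "char_locus S = {g\<in>S. tangent_space S g = span {X1 g, X2 g}}"

text \<open>Functions on \<open>S\<close> are represented by functions on the whole space vanishing off \<open>S\<close>,
  so that distinct representatives are distinct functions on \<open>S\<close>.\<close>

definition C2_0 :: "(real^3) set \<Rightarrow> (real^3 \<Rightarrow> real) set" where
  "C2_0 S = {f. (\<forall>g. g \<notin> S \<longrightarrow> f g = 0) \<and>
     (\<forall>g\<in>S. \<exists>U F. g \<in> U \<and> C2_on U F \<and> (\<forall>x \<in> S \<inter> U. f x = F x)) \<and>
     (\<exists>K. compact K \<and> K \<subseteq> S \<and> (\<forall>g \<in> S - K. f g = 0))}"

definition W :: "(real^3 \<Rightarrow> real) \<Rightarrow> real^3 \<Rightarrow> real" where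
  "W \<phi> g = sqrt ((lie X1 \<phi> g)\<^sup>2 + (lie X2 \<phi> g)\<^sup>2)"

definition pbar :: "(real^3 \<Rightarrow> real) \<Rightarrow> real^3 \<Rightarrow> real" where
  "pbar \<phi> g = lie X1 \<phi> g / W \<phi> g"

definition qbar :: "(real^3 \<Rightarrow> real) \<Rightarrow> real^3 \<Rightarrow> real" where
  "qbar \<phi> g = lie X2 \<phi> g / W \<phi> g"

text \<open>The horizontal Gauss map depends on the orientation, hence a predicate: \<open>\<nu>\<close> is everywhere
  locally the normal field induced by some local defining function.\<close>

definition horizontal_gauss_map :: "(real^3) set \<Rightarrow> (real^3 \<Rightarrow> real^3) \<Rightarrow> bool" where
  "horizontal_gauss_map S \<nu> \<longleftrightarrow> char_locus S = {} \<and>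
     (\<forall>g\<in>S. \<exists>U \<phi>. g \<in> U \<and> local_defining S U \<phi> \<and>
        (\<forall>x \<in> S \<inter> U. \<nu> x = pbar \<phi> x *\<^sub>R X1 x + qbar \<phi> x *\<^sub>R X2 x))"

definition H_mean_curvature :: "(real^3 \<Rightarrow> real) \<Rightarrow> real^3 \<Rightarrow> real" where
  "H_mean_curvature \<phi> g = lie X1 (pbar \<phi>) g + lie X2 (qbar \<phi>) g"

definition H_minimal :: "(real^3) set \<Rightarrow> bool" where
  "H_minimal S \<longleftrightarrow> C2_surface S \<and> char_locus S = {} \<and>
     (\<forall>U \<phi>. local_defining S U \<phi> \<longrightarrow> (\<forall>g \<in> S \<inter> U. H_mean_curvature \<phi> g = 0))"

definition area_element :: "(real^2 \<Rightarrow> real^3) \<Rightarrow> real^2 \<Rightarrow> real" where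
  "area_element \<Psi> u = norm (cross3 (frechet_derivative \<Psi> (at u) (axis 1 1))
                                   (frechet_derivative \<Psi> (at u) (axis 2 1)))"

definition local_param :: "(real^3) set \<Rightarrow> (real^2) set \<Rightarrow> (real^2 \<Rightarrow> real^3) \<Rightarrow> bool" where
  "local_param S D \<Psi> \<longleftrightarrow> open D \<and> C2_on D \<Psi> \<and> (\<forall>u\<in>D. area_element \<Psi> u \<noteq> 0) \<and>
     openin (top_of_set S) (\<Psi> ` D) \<and> (\<exists>\<Theta>. homeomorphism D (\<Psi> ` D) \<Psi> \<Theta>)"

text \<open>The Euclidean surface measure of a \<open>C\<^sup>2\<close> surface (the restriction to it of the
  two-dimensional Hausdorff measure) is the unique Borel measure on \<open>S\<close> given by the classical
  area formula in every local parametrization.\<close>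

definition surface_measure :: "(real^3) set \<Rightarrow> (real^3) measure" where
  "surface_measure S = (THE \<mu>. sets \<mu> = sets (restrict_space borel S) \<and>
     (\<forall>D \<Psi> A. local_param S D \<Psi> \<longrightarrow> A \<in> sets borel \<longrightarrow> A \<subseteq> D \<longrightarrow>
        emeasure \<mu> (\<Psi> ` A) = (\<integral>\<^sup>+u\<in>A. ennreal (area_element \<Psi> u) \<partial>lborel)))"

text \<open>The quotient \<open>W \<phi> g / norm (gradient \<phi> g)\<close> does not depend on the defining function.\<close>

definition perimeter_density :: "(real^3) set \<Rightarrow> real^3 \<Rightarrow> real" where
  "perimeter_density S g =
     (THE d. \<exists>U \<phi>. g \<in> U \<and> local_defining S U \<phi> \<and> d = W \<phi> g / norm (gradient \<phi> g))"

definition H_perimeter_measure :: "(real^3) set \<Rightarrow> (real^3) measure" where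
  "H_perimeter_measure S = density (surface_measure S) (\<lambda>g. ennreal (perimeter_density S g))"

definition variation_fields :: "(real^3) set \<Rightarrow> (real^3 \<Rightarrow> real^3) set" where
  "variation_fields S =
     {\<lambda>g. a g *\<^sub>R X1 g + b g *\<^sub>R X2 g + k g *\<^sub>R T g | a b k. a \<in> C2_0 S \<and> b \<in> C2_0 S \<and> k \<in> C2_0 S}"

definition displace :: "(real^3 \<Rightarrow> real^3) \<Rightarrow> real \<Rightarrow> real^3 \<Rightarrow> real^3" where
  "displace Y s g = g + s *\<^sub>R Y g"

text \<open>Here \<open>K\<close> is the compact portion of \<open>S\<close> containing the support of \<open>Y\<close> whose perimeter is
  followed along the variation. Twice differentiability at 0 is part of the predicate.\<close>

definition has_second_variation :: "(real^3) set \<Rightarrow> (real^3 \<Rightarrow> real^3) \<Rightarrow> real \<Rightarrow> bool" where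
  "has_second_variation S Y v \<longleftrightarrow> Y \<in> variation_fields S \<and>
     (\<forall>K. compact K \<longrightarrow> K \<subseteq> S \<longrightarrow> (\<forall>g \<in> S - K. Y g = 0) \<longrightarrow>
       (let P = (\<lambda>s. measure (H_perimeter_measure (displace Y s ` S)) (displace Y s ` K)) in
        \<exists>P'. (\<forall>\<^sub>F s in nhds 0. (P has_real_derivative P' s) (at s)) \<and>
             (P' has_real_derivative v) (at 0)))"

definition unstable :: "(real^3) set \<Rightarrow> bool" where
  "unstable S \<longleftrightarrow> H_minimal S \<and> (\<exists>Y v. has_second_variation S Y v \<and> v < 0)"

definition graphical_strip_with :: "real set \<Rightarrow> (real \<Rightarrow> real) \<Rightarrow> (real^3) set \<Rightarrow> bool" where
  "graphical_strip_with I G S \<longleftrightarrow> C2_surface S \<and> open I \<and> is_interval I \<and>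
     C2_on I G \<and> (\<forall>t\<in>I. deriv G t \<ge> 0) \<and>
     (\<exists>g \<theta>. (\<lambda>p. heis_mult g (rotation_t \<theta> p)) ` S = {p. p$3 \<in> I \<and> p$1 = p$2 * G (p$3)} \<or>
            (\<lambda>p. heis_mult g (rotation_t \<theta> p)) ` S = {p. p$3 \<in> I \<and> p$2 = - p$1 * G (p$3)})"

definition graphical_strip :: "(real^3) set \<Rightarrow> bool" where
  "graphical_strip S \<longleftrightarrow> (\<exists>I G. graphical_strip_with I G S)"

definition strict_graphical_strip :: "(real^3) set \<Rightarrow> bool" where
  "strict_graphical_strip S \<longleftrightarrow> (\<exists>I G. graphical_strip_with I G S \<and>
     (\<exists>J. J \<noteq> {} \<and> open J \<and> is_interval J \<and> J \<subseteq> I \<and> (\<forall>t\<in>J. deriv G t > 0)))"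

end

theory Submission
  imports Defs
begin

text \<open>
  A strip is the isometric image of \<open>x = y G(t)\<close>. In the coordinates \<open>(y, t)\<close> a direct computation gives
  the horizontal area of the surface moved by \<open>s a (X1 - G X2)\<close> in closed form: it is
  \<open>w sqrt ((c - s\<^sup>2 a\<^sup>2 G' / 2)\<^sup>2 + s\<^sup>2 (\<partial>\<^sub>y (a c) + O(s))\<^sup>2)\<close> with \<open>w = sqrt (1 + G\<^sup>2)\<close> and \<open>c = 1 + G' y\<^sup>2 / 2\<close>.
  Hence the second variation is \<open>\<integral> w ((\<partial>\<^sub>y (a c))\<^sup>2 / c - G' a\<^sup>2) dy dt\<close>. Near a point with \<open>G' > 0\<close> take
  \<open>a\<close> close to \<open>\<chi>(y / R) \<psi>(t) / (c w)\<close>: the first term costs only \<open>O(R\<^sup>-\<^sup>3)\<close>, while the second stays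
  bounded away from zero, so the second variation is negative for large \<open>R\<close>. As \<open>c\<close> is only of class
  \<open>C1\<close>, it is frozen at the given value of \<open>t\<close>.
\<close>

section \<open>Functions of class C1 and C2\<close>

text \<open>Two obstacles shape the proof. The perimeter is defined by descriptions over all charts
  and all defining functions, so nothing can be computed before one chart is shown to settle it. A
  displaced strip has such a chart over the unchanged domain \<open>D\<close>: followed by
  \<open>proj\<close>, it is a small Lipschitz perturbation of the identity. Likewise minimality and
  the Gauss map quantify over every defining function; its gradient is a multiple of the chart's
  normal, which leaves only a sign open. The rate R^-3 rests on the shape of the cutoff: its slope
  at y is at most 6|y| / R^2, and c grows like y^2, so the squared slope over c is O(R^-4) uniformly
  on a box of width 2R. The negative term is needed only on the fixed range |y| <= 1. One test
  function yields a continuum by scaling, since the second variation is quadratic in the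
  field.\<close>

definition C1_on :: "'a::real_normed_vector set \<Rightarrow> ('a \<Rightarrow> 'b::real_normed_vector) \<Rightarrow> bool" where
  "C1_on U f \<longleftrightarrow> open U \<and>
     (\<exists>f' :: 'a \<Rightarrow> 'a \<Rightarrow>\<^sub>L 'b.
        (\<forall>x\<in>U. (f has_derivative blinfun_apply (f' x)) (at x)) \<and> continuous_on U f')"

lemma C1_onI:
  assumes "open U" "\<And>x. x \<in> U \<Longrightarrow> (f has_derivative blinfun_apply (f' x)) (at x)" "continuous_on U f'"
  shows "C1_on U f"
  using assms unfolding C1_on_def by blast

lemma C2_onI:
  assumes "\<And>x. x \<in> U \<Longrightarrow> (f has_derivative blinfun_apply (f' x)) (at x)" "C1_on U f'"
  shows "C2_on U f"
  using assms unfolding C2_on_def C1_on_def by blast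

text \<open>Class C2 becomes class C1 of the derivative, so the calculus rules are proved for C1 and
  then applied to derivatives.\<close>

lemma C2_on_iff:
  "C2_on U f \<longleftrightarrow> open U \<and>
     (\<exists>f'. (\<forall>x\<in>U. (f has_derivative blinfun_apply (f' x)) (at x)) \<and> C1_on U f')"
  unfolding C2_on_def C1_on_def by blast

lemma C1_on_open: "C1_on U f \<Longrightarrow> open U"
  by (simp add: C1_on_def)

lemma C2_on_open: "C2_on U f \<Longrightarrow> open U"
  by (simp add: C2_on_def)

lemma C1_on_differentiable: "C1_on U f \<Longrightarrow> x \<in> U \<Longrightarrow> f differentiable (at x)"
  unfolding C1_on_def differentiable_def by blast

lemma C1_on_continuous: "C1_on U f \<Longrightarrow> continuous_on U f"
  by (meson C1_on_differentiable continuous_at_imp_continuous_on differentiable_imp_continuous_within)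

lemma C2_on_imp_C1_on: "C2_on U f \<Longrightarrow> C1_on U f"
  unfolding C2_on_iff C1_on_def[of U f] by (auto intro: C1_on_continuous)

lemma C2_on_differentiable: "C2_on U f \<Longrightarrow> x \<in> U \<Longrightarrow> f differentiable (at x)"
  by (meson C1_on_differentiable C2_on_imp_C1_on)

lemma C2_on_continuous: "C2_on U f \<Longrightarrow> continuous_on U f"
  by (simp add: C1_on_continuous C2_on_imp_C1_on)

lemma C1_on_subset: "C1_on U f \<Longrightarrow> open V \<Longrightarrow> V \<subseteq> U \<Longrightarrow> C1_on V f"
  unfolding C1_on_def by (auto intro: continuous_on_subset)

lemma C2_on_subset: "C2_on U f \<Longrightarrow> open V \<Longrightarrow> V \<subseteq> U \<Longrightarrow> C2_on V f"
  unfolding C2_on_iff by (auto intro: C1_on_subset)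

lemma C1_on_cong:
  assumes "C1_on U f" "\<And>x. x \<in> U \<Longrightarrow> f x = g x"
  shows "C1_on U g"
proof -
  obtain f' where d: "open U" "\<And>x. x \<in> U \<Longrightarrow> (f has_derivative blinfun_apply (f' x)) (at x)"
    "continuous_on U f'"
    using assms(1) unfolding C1_on_def by blast
  show ?thesis
    by (rule C1_onI[OF d(1) has_derivative_transform_within_open[OF d(2) d(1)] d(3)]) (use assms in auto)
qed

lemma C1_on_bounded_linear:
  assumes "bounded_linear f" "open U"
  shows "C1_on U f"
proof (rule C1_onI[where f' = "\<lambda>_. Blinfun f"])
  show "(f has_derivative blinfun_apply (Blinfun f)) (at x)" for x
    using assms by (simp add: bounded_linear_Blinfun_apply bounded_linear_imp_has_derivative)
qed (use assms in auto)

lemma C1_on_const: "open U \<Longrightarrow> C1_on U (\<lambda>_. c)"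
  by (rule C1_onI[where f' = "\<lambda>_. 0"]) (auto simp: zero_blinfun.rep_eq)

lemma C2_on_const: "open U \<Longrightarrow> C2_on U (\<lambda>_. c)"
  by (rule C2_onI[where f' = "\<lambda>_. 0"]) (auto intro: C1_on_const simp: zero_blinfun.rep_eq)

lemma C2_on_bounded_linear:
  assumes "bounded_linear f" "open U"
  shows "C2_on U f"
proof (rule C2_onI[where f' = "\<lambda>_. Blinfun f"])
  show "(f has_derivative blinfun_apply (Blinfun f)) (at x)" for x
    using assms by (simp add: bounded_linear_Blinfun_apply bounded_linear_imp_has_derivative)
qed (use assms in \<open>auto intro: C1_on_const\<close>)

lemma C1_on_add:
  assumes "C1_on U f" "C1_on U g"
  shows "C1_on U (\<lambda>x. f x + g x)"
proof -
  obtain f' where d1: "open U" "\<And>x. x \<in> U \<Longrightarrow> (f has_derivative blinfun_apply (f' x)) (at x)"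
    "continuous_on U f'"
    using assms(1) unfolding C1_on_def by blast
  obtain g' where d2: "\<And>x. x \<in> U \<Longrightarrow> (g has_derivative blinfun_apply (g' x)) (at x)"
    "continuous_on U g'"
    using assms(2) unfolding C1_on_def by blast
  note d = d1 d2
  show ?thesis
  proof (rule C1_onI[where f' = "\<lambda>x. f' x + g' x"])
    show "((\<lambda>x. f x + g x) has_derivative blinfun_apply (f' x + g' x)) (at x)" if "x \<in> U" for x
      using has_derivative_add[OF d(2)[OF that] d(4)[OF that]]
      by (simp add: plus_blinfun.rep_eq)
  qed (use d in \<open>auto intro!: continuous_intros\<close>)
qed

lemma C2_on_add:
  assumes "C2_on U f" "C2_on U g"
  shows "C2_on U (\<lambda>x. f x + g x)"
proof -
  obtain f' where d1: "open U" "\<And>x. x \<in> U \<Longrightarrow> (f has_derivative blinfun_apply (f' x)) (at x)"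
    "C1_on U f'"
    using assms(1) unfolding C2_on_iff by blast
  obtain g' where d2: "\<And>x. x \<in> U \<Longrightarrow> (g has_derivative blinfun_apply (g' x)) (at x)"
    "C1_on U g'"
    using assms(2) unfolding C2_on_iff by blast
  note d = d1 d2
  show ?thesis
  proof (rule C2_onI[where f' = "\<lambda>x. f' x + g' x"])
    show "((\<lambda>x. f x + g x) has_derivative blinfun_apply (f' x + g' x)) (at x)" if "x \<in> U" for x
      using has_derivative_add[OF d(2)[OF that] d(4)[OF that]]
      by (simp add: plus_blinfun.rep_eq)
  qed (use d in \<open>auto intro!: C1_on_add\<close>)
qed

lemma C1_on_compose:
  assumes "C1_on V g" "C1_on U f" "f ` U \<subseteq> V"
  shows "C1_on U (\<lambda>x. g (f x))"
proof -
  obtain f' where d1: "open U" "\<And>x. x \<in> U \<Longrightarrow> (f has_derivative blinfun_apply (f' x)) (at x)"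
    "continuous_on U f'"
    using assms(2) unfolding C1_on_def by blast
  obtain g' where d2: "\<And>x. x \<in> V \<Longrightarrow> (g has_derivative blinfun_apply (g' x)) (at x)"
    "continuous_on V g'"
    using assms(1) unfolding C1_on_def by blast
  note d = d1 d2
  show ?thesis
  proof (rule C1_onI[where f' = "\<lambda>x. g' (f x) o\<^sub>L f' x"])
    show "((\<lambda>x. g (f x)) has_derivative blinfun_apply (g' (f x) o\<^sub>L f' x)) (at x)" if "x \<in> U" for x
      using has_derivative_compose[OF d(2)[OF that] d(4)[of "f x"]] assms(3) that
      by (auto simp: blinfun_compose.rep_eq o_def)
    show "continuous_on U (\<lambda>x. g' (f x) o\<^sub>L f' x)"
      using assms(3) d C1_on_continuous[OF assms(2)]
      by (intro continuous_intros continuous_on_compose2[OF d(5)]) auto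
  qed (use d in auto)
qed

lemma C1_on_bilinear:
  fixes f :: "'a::euclidean_space \<Rightarrow> 'b::real_normed_vector"
  assumes B: "bounded_bilinear B" and "C1_on U f" "C1_on U g"
  shows "C1_on U (\<lambda>x. B (f x) (g x))"
proof -
  interpret bounded_bilinear B by fact
  obtain f' where d1: "open U" "\<And>x. x \<in> U \<Longrightarrow> (f has_derivative blinfun_apply (f' x)) (at x)"
    "continuous_on U f'"
    using assms(2) unfolding C1_on_def by blast
  obtain g' where d2: "\<And>x. x \<in> U \<Longrightarrow> (g has_derivative blinfun_apply (g' x)) (at x)"
    "continuous_on U g'"
    using assms(3) unfolding C1_on_def by blast
  note d = d1 d2
  define D where "D = (\<lambda>x h. B (f x) (g' x h) + B (f' x h) (g x))"
  have bl: "bounded_linear (D x)" for x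
    unfolding D_def
    by (intro bounded_linear_add bounded_linear_compose[OF bounded_linear_right]
        bounded_linear_compose[OF bounded_linear_left] blinfun.bounded_linear_right)
  show ?thesis
  proof (rule C1_onI[where f' = "\<lambda>x. Blinfun (D x)"])
    show "((\<lambda>x. B (f x) (g x)) has_derivative blinfun_apply (Blinfun (D x))) (at x)" if "x \<in> U" for x
      unfolding bounded_linear_Blinfun_apply[OF bl] unfolding D_def
      by (rule FDERIV[OF d(2)[OF that] d(4)[OF that]])
    \<comment> \<open>On a Euclidean domain, continuity in operator norm can be tested on basis
      vectors.\<close>
    show "continuous_on U (\<lambda>x. Blinfun (D x))"
    proof (rule continuous_on_blinfun_componentwise)
      show "continuous_on U (\<lambda>x. blinfun_apply (Blinfun (D x)) i)" for i
        unfolding bounded_linear_Blinfun_apply[OF bl] unfolding D_def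
        using C1_on_continuous[OF assms(2)] C1_on_continuous[OF assms(3)] d
        by (intro continuous_on continuous_intros) auto
    qed
  qed (use d in auto)
qed

lemma C1_on_linear_compose:
  assumes "bounded_linear L" "C1_on U f"
  shows "C1_on U (\<lambda>x. L (f x))"
  by (rule C1_on_compose[OF C1_on_bounded_linear[OF assms(1) open_UNIV] assms(2)]) auto

lemma C1_on_sum:
  assumes "finite I" "open U" "\<And>i. i \<in> I \<Longrightarrow> C1_on U (f i)"
  shows "C1_on U (\<lambda>x. \<Sum>i\<in>I. f i x)"
  using assms by (induction I) (auto intro: C1_on_const C1_on_add)

lemma C2_on_compose:
  fixes f :: "'a::euclidean_space \<Rightarrow> 'b::real_normed_vector"
  assumes "C2_on V g" "C2_on U f" "f ` U \<subseteq> V"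
  shows "C2_on U (\<lambda>x. g (f x))"
proof -
  obtain f' where d1: "open U" "\<And>x. x \<in> U \<Longrightarrow> (f has_derivative blinfun_apply (f' x)) (at x)"
    "C1_on U f'"
    using assms(2) unfolding C2_on_iff by blast
  obtain g' where d2: "\<And>x. x \<in> V \<Longrightarrow> (g has_derivative blinfun_apply (g' x)) (at x)"
    "C1_on V g'"
    using assms(1) unfolding C2_on_iff by blast
  note d = d1 d2
  show ?thesis
  proof (rule C2_onI[where f' = "\<lambda>x. g' (f x) o\<^sub>L f' x"])
    show "((\<lambda>x. g (f x)) has_derivative blinfun_apply (g' (f x) o\<^sub>L f' x)) (at x)" if "x \<in> U" for x
      using has_derivative_compose[OF d(2)[OF that] d(4)[of "f x"]] assms(3) that
      by (auto simp: blinfun_compose.rep_eq o_def)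
    show "C1_on U (\<lambda>x. g' (f x) o\<^sub>L f' x)"
      by (intro C1_on_bilinear[OF bounded_bilinear_blinfun_compose] d
          C1_on_compose[OF d(5) C2_on_imp_C1_on[OF assms(2)] assms(3)])
  qed
qed

lemma C2_on_linear_compose:
  fixes f :: "'a::euclidean_space \<Rightarrow> 'b::real_normed_vector"
  assumes "bounded_linear L" "C2_on U f"
  shows "C2_on U (\<lambda>x. L (f x))"
  by (rule C2_on_compose[OF C2_on_bounded_linear[OF assms(1) open_UNIV] assms(2)]) auto

text \<open>The derivative is a finite sum of its values on basis vectors composed with coordinate
  functionals, and each summand depends on the value through a bounded linear map. Later C2 proofs
  thus need no operator-valued functions.\<close>

lemma C2_on_directional:
  fixes f :: "'a::euclidean_space \<Rightarrow> 'b::real_normed_vector"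
  assumes U: "open U" and D: "\<And>x. x \<in> U \<Longrightarrow> (f has_derivative D x) (at x)"
    and C1: "\<And>i. i \<in> Basis \<Longrightarrow> C1_on U (\<lambda>x. D x i)"
  shows "C2_on U f"
proof -
  define f' where "f' = (\<lambda>x. \<Sum>i\<in>Basis. blinfun_scaleR_left (D x i) o\<^sub>L blinfun_inner_right i)"
  have eq: "blinfun_apply (f' x) h = D x h" if "x \<in> U" for x h
  proof -
    have "linear (D x)"
      using D[OF that] by (rule has_derivative_linear)
    have "D x h = D x (\<Sum>i\<in>Basis. (h \<bullet> i) *\<^sub>R i)"
      by (simp add: euclidean_representation)
    also have "\<dots> = (\<Sum>i\<in>Basis. (h \<bullet> i) *\<^sub>R D x i)"
      using \<open>linear (D x)\<close> by (simp add: linear_sum linear_scale)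
    finally show ?thesis
      by (simp add: f'_def blinfun.sum_left inner_commute)
  qed
  then have 1: "(f has_derivative blinfun_apply (f' x)) (at x)" if "x \<in> U" for x
    using D[OF that] ext[of "blinfun_apply (f' x)" "D x", OF eq[OF that]] by simp
  show ?thesis
  proof (rule C2_onI[OF 1])
    show "C1_on U f'"
      unfolding f'_def
    proof (rule C1_on_sum[OF finite_Basis U])
      fix i :: 'a assume "i \<in> Basis"
      have "bounded_linear (\<lambda>z :: 'b. blinfun_scaleR_left z o\<^sub>L blinfun_inner_right i)"
        by (rule bounded_linear_compose[OF bounded_bilinear.bounded_linear_left[OF
              bounded_bilinear_blinfun_compose] bounded_linear_blinfun_scaleR_left])
      then show "C1_on U (\<lambda>x. blinfun_scaleR_left (D x i) o\<^sub>L blinfun_inner_right i)"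
        by (rule C1_on_linear_compose) (rule C1[OF \<open>i \<in> Basis\<close>])
    qed
  qed
qed

lemma C2_on_bilinear:
  fixes f :: "'a::euclidean_space \<Rightarrow> 'b::real_normed_vector"
  assumes B: "bounded_bilinear B" and "C2_on U f" "C2_on U g"
  shows "C2_on U (\<lambda>x. B (f x) (g x))"
proof -
  obtain f' where d1: "open U" "\<And>x. x \<in> U \<Longrightarrow> (f has_derivative blinfun_apply (f' x)) (at x)"
    "C1_on U f'"
    using assms(2) unfolding C2_on_iff by blast
  obtain g' where d2: "\<And>x. x \<in> U \<Longrightarrow> (g has_derivative blinfun_apply (g' x)) (at x)"
    "C1_on U g'"
    using assms(3) unfolding C2_on_iff by blast
  note d = d1 d2
  show ?thesis
    by (rule C2_on_directional[OF d(1) bounded_bilinear.FDERIV[OF B d(2) d(4)]], assumption, assumption)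
      (intro C1_on_add C1_on_bilinear[OF B] C2_on_imp_C1_on[OF assms(2)] C2_on_imp_C1_on[OF assms(3)]
        C1_on_linear_compose[OF blinfun.bounded_linear_left] d)+
qed

lemmas C1_on_mult = C1_on_bilinear[OF bounded_bilinear_mult]
lemmas C2_on_mult = C2_on_bilinear[OF bounded_bilinear_mult]

lemma C1_on_minus: "C1_on U f \<Longrightarrow> C1_on U (\<lambda>x. - f x)"
  by (rule C1_on_linear_compose[OF bounded_linear_minus[OF bounded_linear_ident]])

lemma C2_on_minus:
  fixes f :: "'a::euclidean_space \<Rightarrow> 'b::real_normed_vector"
  shows "C2_on U f \<Longrightarrow> C2_on U (\<lambda>x. - f x)"
  by (rule C2_on_linear_compose[OF bounded_linear_minus[OF bounded_linear_ident]])

lemma C2_on_diff: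
  fixes f :: "'a::euclidean_space \<Rightarrow> 'b::real_normed_vector"
  shows "C2_on U f \<Longrightarrow> C2_on U g \<Longrightarrow> C2_on U (\<lambda>x. f x - g x)"
  using C2_on_add[OF _ C2_on_minus, of U f g] by simp

lemma C2_on_nth: "open U \<Longrightarrow> C2_on U (\<lambda>x::real^'n. x $ i)"
  by (rule C2_on_bounded_linear[OF bounded_linear_vec_nth])

lemma C2_on_nth_compose:
  fixes f :: "'a::euclidean_space \<Rightarrow> real^'n"
  shows "C2_on U f \<Longrightarrow> C2_on U (\<lambda>x. f x $ i)"
  by (rule C2_on_linear_compose[OF bounded_linear_vec_nth])

lemma C1_on_nth_compose: "C1_on U f \<Longrightarrow> C1_on U (\<lambda>x. (f x :: real^'n) $ i)"
  by (rule C1_on_linear_compose[OF bounded_linear_vec_nth])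

lemma C1_on_real:
  assumes "open U" "\<And>x. x \<in> U \<Longrightarrow> (f has_real_derivative f' x) (at x)" "continuous_on U f'"
  shows "C1_on U f"
proof (rule C1_onI[where f' = "\<lambda>x. blinfun_mult_right (f' x)"])
  show "(f has_derivative blinfun_apply (blinfun_mult_right (f' x))) (at x)" if "x \<in> U" for x
    using assms(2)[OF that] by (simp add: has_field_derivative_def blinfun_mult_right.rep_eq)
qed (use assms in \<open>auto intro!: continuous_intros bounded_linear.continuous_on[OF bounded_linear_blinfun_mult_right]\<close>)

lemma C2_on_real:
  assumes "open U" "\<And>x. x \<in> U \<Longrightarrow> (f has_real_derivative f' x) (at x)"
    "\<And>x. x \<in> U \<Longrightarrow> (f' has_real_derivative f'' x) (at x)" "continuous_on U f''"
  shows "C2_on U f"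
proof (rule C2_on_directional[OF assms(1)])
  show "(f has_derivative (\<lambda>h. f' x * h)) (at x)" if "x \<in> U" for x
    using assms(2)[OF that] by (simp add: has_field_derivative_def)
  show "C1_on U (\<lambda>x. f' x * i)" if "i \<in> Basis" for i :: real
    using that C1_on_real[OF assms(1,3,4)] by simp
qed

lemma C2_on_inverse:
  fixes f :: "'a::euclidean_space \<Rightarrow> real"
  assumes "C2_on U f" "\<And>x. x \<in> U \<Longrightarrow> f x \<noteq> 0"
  shows "C2_on U (\<lambda>x. inverse (f x))"
proof (rule C2_on_compose[OF _ assms(1)])
  show "C2_on (- {0::real}) inverse"
    by (rule C2_on_real[where f' = "\<lambda>x. - (inverse x * inverse x)" and f'' = "\<lambda>x. 2 * inverse x ^ 3"])
      (auto intro!: derivative_eq_intros continuous_intros simp: field_simps power3_eq_cube)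
qed (use assms in auto)

lemma C1_on_inverse:
  fixes f :: "'a::euclidean_space \<Rightarrow> real"
  assumes "C1_on U f" "\<And>x. x \<in> U \<Longrightarrow> f x \<noteq> 0"
  shows "C1_on U (\<lambda>x. inverse (f x))"
proof (rule C1_on_compose[OF _ assms(1)])
  show "C1_on (- {0::real}) inverse"
    by (rule C1_on_real[where f' = "\<lambda>x. - (inverse x * inverse x)"])
      (auto intro!: derivative_eq_intros continuous_intros)
qed (use assms in auto)

lemma C2_on_divide:
  fixes f :: "'a::euclidean_space \<Rightarrow> real"
  assumes "C2_on U f" "C2_on U g" "\<And>x. x \<in> U \<Longrightarrow> g x \<noteq> 0"
  shows "C2_on U (\<lambda>x. f x / g x)"
  unfolding divide_inverse by (intro C2_on_mult C2_on_inverse assms)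

lemma C1_on_divide:
  fixes f :: "'a::euclidean_space \<Rightarrow> real"
  assumes "C1_on U f" "C1_on U g" "\<And>x. x \<in> U \<Longrightarrow> g x \<noteq> 0"
  shows "C1_on U (\<lambda>x. f x / g x)"
  unfolding divide_inverse by (intro C1_on_mult C1_on_inverse assms)

lemma C2_on_sqrt:
  fixes f :: "'a::euclidean_space \<Rightarrow> real"
  assumes "C2_on U f" "\<And>x. x \<in> U \<Longrightarrow> f x > 0"
  shows "C2_on U (\<lambda>x. sqrt (f x))"
proof (rule C2_on_compose[OF _ assms(1)])
  show "C2_on {0<..} sqrt"
  proof (rule C2_on_real[where f' = "\<lambda>x. inverse (sqrt x) / 2"
        and f'' = "\<lambda>x. - (inverse (sqrt x) * (inverse (sqrt x) / 2) * inverse (sqrt x)) / 2"])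
    fix x :: real assume "x \<in> {0<..}"
    then have x: "0 < x" by simp
    show d: "DERIV sqrt x :> inverse (sqrt x) / 2"
      by (rule DERIV_real_sqrt[OF x])
    show "DERIV (\<lambda>x. inverse (sqrt x) / 2) x
        :> - (inverse (sqrt x) * (inverse (sqrt x) / 2) * inverse (sqrt x)) / 2"
      using x by (intro DERIV_cdivide DERIV_inverse'[OF d]) simp
  next
    show "continuous_on {0<..}
        (\<lambda>x::real. - (inverse (sqrt x) * (inverse (sqrt x) / 2) * inverse (sqrt x)) / 2)"
      by (intro continuous_intros) auto
  qed simp
qed (use assms in auto)

lemma vector_3_expand: "(vector [a, b, c] :: real^3) = a *\<^sub>R axis 1 1 + b *\<^sub>R axis 2 1 + c *\<^sub>R axis 3 1"
  by (simp add: vec_eq_iff forall_3 axis_def)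

lemma vector_2_expand: "(vector [a, b] :: real^2) = a *\<^sub>R axis 1 1 + b *\<^sub>R axis 2 1"
  by (simp add: vec_eq_iff forall_2 axis_def)

lemma C2_on_vector_3:
  fixes f1 f2 f3 :: "'a::euclidean_space \<Rightarrow> real"
  assumes "C2_on U f1" "C2_on U f2" "C2_on U f3"
  shows "C2_on U (\<lambda>x. vector [f1 x, f2 x, f3 x] :: real^3)"
  unfolding vector_3_expand
  by (intro C2_on_add C2_on_linear_compose[OF bounded_linear_scaleR_left] assms)

lemma C2_on_vector_2:
  fixes f1 f2 :: "'a::euclidean_space \<Rightarrow> real"
  assumes "C2_on U f1" "C2_on U f2"
  shows "C2_on U (\<lambda>x. vector [f1 x, f2 x] :: real^2)"
  unfolding vector_2_expand
  by (intro C2_on_add C2_on_linear_compose[OF bounded_linear_scaleR_left] assms)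

lemma C1_on_vector_3:
  assumes "C1_on U f1" "C1_on U f2" "C1_on U f3"
  shows "C1_on U (\<lambda>x. vector [f1 x, f2 x, f3 x] :: real^3)"
  unfolding vector_3_expand
  by (intro C1_on_add C1_on_linear_compose[OF bounded_linear_scaleR_left] assms)

abbreviation dif :: "('a::real_normed_vector \<Rightarrow> 'b::real_normed_vector) \<Rightarrow> 'a \<Rightarrow> 'a \<Rightarrow> 'b" where
  "dif f x \<equiv> frechet_derivative f (at x)"

lemma C1_on_frechet:
  assumes "C2_on U f"
  shows "C1_on U (\<lambda>x. dif f x v)"
proof -
  obtain f' where d: "open U" "\<And>x. x \<in> U \<Longrightarrow> (f has_derivative blinfun_apply (f' x)) (at x)" "C1_on U f'"
    using assms unfolding C2_on_iff by blast
  show ?thesis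
    by (rule C1_on_cong[OF C1_on_linear_compose[OF blinfun.bounded_linear_left d(3)]])
      (simp add: frechet_derivative_at[OF d(2), symmetric])
qed

lemma C2_on_frechet_works:
  assumes "C2_on U f" "x \<in> U"
  shows "(f has_derivative dif f x) (at x)"
  using C2_on_differentiable[OF assms] frechet_derivative_works by blast

lemma C1_on_directional:
  fixes f :: "'a::euclidean_space \<Rightarrow> 'b::real_normed_vector"
  assumes U: "open U" and D: "\<And>x. x \<in> U \<Longrightarrow> (f has_derivative D x) (at x)"
    and c: "\<And>i. i \<in> Basis \<Longrightarrow> continuous_on U (\<lambda>x. D x i)"
  shows "C1_on U f"
proof (rule C1_onI[OF U, where f' = "\<lambda>x. Blinfun (D x)"])
  have eq: "blinfun_apply (Blinfun (D x)) = D x" if "x \<in> U" for x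
    by (rule bounded_linear_Blinfun_apply[OF has_derivative_bounded_linear[OF D[OF that]]])
  show "(f has_derivative blinfun_apply (Blinfun (D x))) (at x)" if "x \<in> U" for x
    unfolding eq[OF that] by (rule D[OF that])
  show "continuous_on U (\<lambda>x. Blinfun (D x))"
  proof (rule continuous_on_blinfun_componentwise)
    fix i :: 'a assume i: "i \<in> Basis"
    show "continuous_on U (\<lambda>x. blinfun_apply (Blinfun (D x)) i)"
      by (rule continuous_on_eq[OF c[OF i]]) (simp add: eq)
  qed
qed

section \<open>Parametrizations and defining functions\<close>

lemma bounded_bilinear_cross3: "bounded_bilinear cross3"
  using bilinear_cross by (simp add: bilinear_conv_bounded_bilinear)

definition normal :: "(real^2 \<Rightarrow> real^3) \<Rightarrow> real^2 \<Rightarrow> real^3" where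
  "normal \<Psi> u = cross3 (dif \<Psi> u (axis 1 1)) (dif \<Psi> u (axis 2 1))"

text \<open>The density of the horizontal perimeter measure in the parameters of \<open>\<Psi>\<close>: the quotient
  \<open>W \<phi> / norm (gradient \<phi>)\<close> cancels against the area element, and no defining function is left.\<close>

definition hnorm :: "(real^2 \<Rightarrow> real^3) \<Rightarrow> real^2 \<Rightarrow> real" where
  "hnorm \<Psi> u = sqrt ((normal \<Psi> u \<bullet> X1 (\<Psi> u))\<^sup>2 + (normal \<Psi> u \<bullet> X2 (\<Psi> u))\<^sup>2)"

lemma area_element_eq_norm: "area_element \<Psi> u = norm (normal \<Psi> u)"
  by (simp add: area_element_def normal_def)

lemma C1_on_normal:
  assumes "C2_on D \<Psi>"
  shows "C1_on D (normal \<Psi>)"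
  unfolding normal_def[abs_def]
  by (intro C1_on_bilinear[OF bounded_bilinear_cross3] C1_on_frechet[OF assms])

lemma gradient_inner:
  assumes "\<phi> differentiable (at g)"
  shows "dif \<phi> g v = gradient \<phi> g \<bullet> v"
proof -
  have lin: "linear (dif \<phi> g)"
    by (rule linear_frechet_derivative[OF assms])
  have "v = (\<Sum>i\<in>UNIV. (v $ i) *\<^sub>R axis i 1)"
    by (metis basis_expansion scalar_mult_eq_scaleR)
  then have "dif \<phi> g v
      = (\<Sum>i\<in>UNIV. (v $ i) * dif \<phi> g (axis i 1))"
    using linear_sum[OF lin] linear_scale[OF lin] by (metis (mono_tags, lifting) real_scaleR_def sum.cong)
  then show ?thesis
    by (simp add: gradient_def inner_vec_def mult.commute)
qed

lemma lie_eq_gradient: "\<phi> differentiable (at g) \<Longrightarrow> lie Y \<phi> g = gradient \<phi> g \<bullet> Y g"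
  by (simp add: lie_def gradient_inner)

lemma local_defining_differentiable: "local_defining S U \<phi> \<Longrightarrow> g \<in> U \<Longrightarrow> \<phi> differentiable (at g)"
  unfolding local_defining_def using C2_on_differentiable by blast

text \<open>The triple product expansion is used twice: it gives \<open>cross3 v n = 0\<close> for
  \<open>n = cross3 a b\<close>, and then, applied to \<open>cross3 n (cross3 n v)\<close>, it
  solves for \<open>v\<close>.\<close>

lemma cross3_orthogonal_parallel:
  assumes "v \<bullet> a = 0" "v \<bullet> b = 0" "cross3 a b \<noteq> 0"
  shows "v = ((v \<bullet> cross3 a b) / (cross3 a b \<bullet> cross3 a b)) *\<^sub>R cross3 a b"
proof -
  let ?n = "cross3 a b"
  have "cross3 v ?n = 0"
    using assms by (simp add: Lagrange)
  then have "cross3 ?n v = 0"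
    using cross_skew[of ?n v] by simp
  then have "(?n \<bullet> v) *\<^sub>R ?n - (?n \<bullet> ?n) *\<^sub>R v = 0"
    using Lagrange[of ?n ?n v] by simp
  then have "(?n \<bullet> ?n) *\<^sub>R v = (v \<bullet> ?n) *\<^sub>R ?n"
    by (simp add: inner_commute)
  then have "v = inverse (?n \<bullet> ?n) *\<^sub>R ((v \<bullet> ?n) *\<^sub>R ?n)"
    using assms(3) by (metis inner_eq_zero_iff left_inverse scaleR_one scaleR_scaleR)
  then show ?thesis
    by (simp add: divide_inverse mult.commute)
qed

text \<open>On the open set of parameters sent into \<open>U\<close> the composite of
  \<open>\<phi>\<close> with \<open>\<Psi>\<close> is identically zero; the chain rule does the
  rest.\<close>

lemma gradient_tangent:
  assumes \<phi>: "local_defining S U \<phi>" and D: "C2_on D \<Psi>" "\<Psi> ` D \<subseteq> S" and u: "u \<in> D" "\<Psi> u \<in> U"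
  shows "gradient \<phi> (\<Psi> u) \<bullet> dif \<Psi> u v = 0"
proof -
  have "open U" and zero: "S \<inter> U = {x \<in> U. \<phi> x = 0}"
    using \<phi> by (auto simp: local_defining_def)
  have "open D" "continuous_on D \<Psi>"
    using D C2_on_open C2_on_continuous by blast+
  then have op: "open (D \<inter> \<Psi> -` U)"
    using continuous_open_preimage[of D \<Psi> U] \<open>open U\<close> by blast
  have d\<phi>: "\<phi> differentiable (at (\<Psi> u))"
    by (rule local_defining_differentiable[OF \<phi> u(2)])
  have "((\<lambda>w. \<phi> (\<Psi> w)) has_derivative (\<lambda>h. dif \<phi> (\<Psi> u) (dif \<Psi> u h))) (at u)"
    using has_derivative_compose[OF C2_on_frechet_works[OF D(1) u(1)], of \<phi>] d\<phi>
    by (simp add: frechet_derivative_works[symmetric])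
  moreover have "((\<lambda>w. \<phi> (\<Psi> w)) has_derivative (\<lambda>h. 0)) (at u)"
    by (rule has_derivative_transform_within_open[OF has_derivative_const[of 0] op])
      (use u zero D(2) in auto)
  ultimately have "(\<lambda>h. dif \<phi> (\<Psi> u) (dif \<Psi> u h)) = (\<lambda>h. 0)"
    by (rule has_derivative_unique)
  then show ?thesis
    using gradient_inner[OF d\<phi>] by metis
qed

text \<open>The bridge from arbitrary defining functions to a single chart: whatever is homogeneous
  of degree zero in the gradient can be computed from \<open>normal \<Psi>\<close>, up to a sign if
  it is odd.\<close>

lemma gradient_parallel_normal:
  assumes \<phi>: "local_defining S U \<phi>" and D: "C2_on D \<Psi>" "\<Psi> ` D \<subseteq> S" and u: "u \<in> D" "\<Psi> u \<in> U"
    and n: "normal \<Psi> u \<noteq> 0"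
  obtains \<kappa> where "\<kappa> \<noteq> 0" "gradient \<phi> (\<Psi> u) = \<kappa> *\<^sub>R normal \<Psi> u"
proof -
  have "gradient \<phi> (\<Psi> u) \<noteq> 0"
    using \<phi> u by (simp add: local_defining_def)
  moreover have "\<exists>\<kappa>. gradient \<phi> (\<Psi> u) = \<kappa> *\<^sub>R normal \<Psi> u"
    using cross3_orthogonal_parallel[OF gradient_tangent[OF assms(1-5)] gradient_tangent[OF assms(1-5)]] n
    unfolding normal_def by blast
  ultimately show ?thesis
    using that by force
qed

text \<open>The pairings with \<open>X1\<close> and \<open>X2\<close> are linear in the gradient, so
  rescaling it multiplies \<open>W\<close> by \<open>\<bar>\<kappa>\<bar>\<close> and leaves in
  \<open>pbar\<close> and \<open>qbar\<close> only the sign of \<open>\<kappa>\<close>, that is, the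
  orientation.\<close>

lemma gradient_scaled:
  assumes \<phi>: "\<phi> differentiable (at g)" and eq: "gradient \<phi> g = \<kappa> *\<^sub>R n"
  shows "W \<phi> g = \<bar>\<kappa>\<bar> * sqrt ((n \<bullet> X1 g)\<^sup>2 + (n \<bullet> X2 g)\<^sup>2)"
    and "\<kappa> \<noteq> 0 \<Longrightarrow> pbar \<phi> g = sgn \<kappa> * ((n \<bullet> X1 g) / sqrt ((n \<bullet> X1 g)\<^sup>2 + (n \<bullet> X2 g)\<^sup>2))"
    and "\<kappa> \<noteq> 0 \<Longrightarrow> qbar \<phi> g = sgn \<kappa> * ((n \<bullet> X2 g) / sqrt ((n \<bullet> X1 g)\<^sup>2 + (n \<bullet> X2 g)\<^sup>2))"
proof -
  have l: "lie X1 \<phi> g = \<kappa> * (n \<bullet> X1 g)" "lie X2 \<phi> g = \<kappa> * (n \<bullet> X2 g)"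
    by (simp_all add: lie_eq_gradient[OF \<phi>] eq)
  show W: "W \<phi> g = \<bar>\<kappa>\<bar> * sqrt ((n \<bullet> X1 g)\<^sup>2 + (n \<bullet> X2 g)\<^sup>2)"
    by (simp add: W_def l power_mult_distrib flip: distrib_left) (simp add: real_sqrt_mult)
  have s: "\<kappa> / \<bar>\<kappa>\<bar> = sgn \<kappa>"
    by (simp add: sgn_if)
  show "\<kappa> \<noteq> 0 \<Longrightarrow> pbar \<phi> g = sgn \<kappa> * ((n \<bullet> X1 g) / sqrt ((n \<bullet> X1 g)\<^sup>2 + (n \<bullet> X2 g)\<^sup>2))"
    unfolding pbar_def W l times_divide_times_eq[symmetric] s by simp
  show "\<kappa> \<noteq> 0 \<Longrightarrow> qbar \<phi> g = sgn \<kappa> * ((n \<bullet> X2 g) / sqrt ((n \<bullet> X1 g)\<^sup>2 + (n \<bullet> X2 g)\<^sup>2))"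
    unfolding qbar_def W l times_divide_times_eq[symmetric] s by simp
qed

text \<open>\<open>\<Psi>\<close> extends to the local diffeomorphism \<open>(u, r) \<mapsto> \<Psi> u + r n\<close>, where \<open>n\<close> is the normal at
  the given point; the last coordinate of its inverse is a defining function. Its gradient is
  \<open>N / (N \<bullet> n)\<close> with \<open>N\<close> the normal field of \<open>\<Psi>\<close>, which gives the second order regularity.\<close>

lemma local_param_local_inverse:
  assumes P: "local_param S D \<Psi>" and u0: "u0 \<in> D"
  obtains U \<phi> \<rho> where "\<Psi> u0 \<in> U" "local_defining S U \<phi>" "C1_on U \<rho>"
    "\<And>x. x \<in> S \<inter> U \<Longrightarrow> \<rho> x \<in> D \<and> \<Psi> (\<rho> x) = x"
proof -
  have D: "open D" "C2_on D \<Psi>" and n: "\<And>u. u \<in> D \<Longrightarrow> normal \<Psi> u \<noteq> 0"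
    and op: "openin (top_of_set S) (\<Psi> ` D)"
    using P by (auto simp: local_param_def area_element_eq_norm)
  obtain H where H: "homeomorphism D (\<Psi> ` D) \<Psi> H"
    using P by (auto simp: local_param_def)
  obtain N where N: "open N" "\<Psi> ` D = S \<inter> N"
    using op by (auto simp: openin_open)
  let ?n = "normal \<Psi> u0"
  define pr :: "real^3 \<Rightarrow> real^2" where "pr p = vector [p $ 1, p $ 2]" for p
  define up :: "real^2 \<Rightarrow> real^3" where "up u = vector [u $ 1, u $ 2, 0]" for u
  have prC: "C2_on UNIV pr"
    unfolding pr_def[abs_def] by (intro C2_on_vector_2 C2_on_nth) simp_all
  have prbl: "bounded_linear pr"
    unfolding pr_def[abs_def] vector_2_expand
    by (intro bounded_linear_add bounded_linear_compose[OF bounded_linear_scaleR_left] bounded_linear_vec_nth)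
  have pr_up[simp]: "pr (up u) = u" for u
    by (simp add: pr_def up_def vec_eq_iff forall_2)
  have up_pr: "up (pr p) = p" if "p $ 3 = 0" for p
    using that by (simp add: pr_def up_def vec_eq_iff forall_3)
  define E where "E = pr -` D"
  have E: "open E"
    unfolding E_def using C2_on_continuous[OF prC] D(1) by (simp add: continuous_on_open_vimage open_vimage)
  define F where "F p = \<Psi> (pr p) + (p $ 3) *\<^sub>R ?n" for p
  have FC: "C2_on E F"
    unfolding F_def[abs_def]
    by (intro C2_on_add C2_on_compose[OF D(2) C2_on_subset[OF prC E]]
        C2_on_linear_compose[OF bounded_linear_scaleR_left C2_on_nth[OF E]]) (auto simp: E_def)
  obtain f' where f': "\<And>x. x \<in> E \<Longrightarrow> (F has_derivative blinfun_apply (f' x)) (at x)" "C1_on E f'"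
    using FC unfolding C2_on_iff by blast
  let ?a = "\<lambda>p. dif \<Psi> (pr p) (axis 1 1)"
  let ?b = "\<lambda>p. dif \<Psi> (pr p) (axis 2 1)"
  let ?N = "\<lambda>p. normal \<Psi> (pr p)"
  have f'_eq: "f' p h = h $ 1 *\<^sub>R ?a p + h $ 2 *\<^sub>R ?b p + h $ 3 *\<^sub>R ?n" if "p \<in> E" for p h
  proof -
    have pD: "pr p \<in> D" using that by (simp add: E_def)
    have lin: "linear (dif \<Psi> (pr p))"
      by (rule linear_frechet_derivative[OF C2_on_differentiable[OF D(2) pD]])
    have "(F has_derivative (\<lambda>h. dif \<Psi> (pr p) (pr h) + (h $ 3) *\<^sub>R ?n)) (at p)"
      unfolding F_def[abs_def]
      by (intro has_derivative_add has_derivative_compose[OF bounded_linear_imp_has_derivative[OF prbl]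
            C2_on_frechet_works[OF D(2) pD]] has_derivative_scaleR_left
            bounded_linear_imp_has_derivative bounded_linear_vec_nth)
    then have "blinfun_apply (f' p) = (\<lambda>h. dif \<Psi> (pr p) (pr h) + (h $ 3) *\<^sub>R ?n)"
      by (rule has_derivative_unique[OF f'(1)[OF that]])
    moreover have "pr h = h $ 1 *\<^sub>R axis 1 1 + h $ 2 *\<^sub>R axis 2 1"
      by (simp add: pr_def vector_2_expand)
    ultimately show ?thesis
      by (simp add: linear_add[OF lin] linear_scale[OF lin])
  qed
  \<comment> \<open>Cramer's rule for the matrix with columns \<open>?a p\<close>,
    \<open>?b p\<close>, \<open>?n\<close>: the cross products are its cofactor vectors and
    \<open>?N p \<bullet> ?n\<close> is its determinant.\<close>
  have det: "cross3 (?b p) ?n \<bullet> f' p h = h $ 1 * (?N p \<bullet> ?n)"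
    "cross3 ?n (?a p) \<bullet> f' p h = h $ 2 * (?N p \<bullet> ?n)"
    "?N p \<bullet> f' p h = h $ 3 * (?N p \<bullet> ?n)" if "p \<in> E" for p h
  proof -
    have tri: "cross3 y z \<bullet> x = cross3 x y \<bullet> z" "cross3 z x \<bullet> y = cross3 x y \<bullet> z" for x y z
      by (simp_all add: cross3_simps)
    show "cross3 (?b p) ?n \<bullet> f' p h = h $ 1 * (?N p \<bullet> ?n)"
      "cross3 ?n (?a p) \<bullet> f' p h = h $ 2 * (?N p \<bullet> ?n)"
      "?N p \<bullet> f' p h = h $ 3 * (?N p \<bullet> ?n)"
      unfolding f'_eq[OF that] inner_add_right inner_scaleR_right normal_def
      by (simp_all add: dot_cross_self tri)
  qed
  have up0: "up u0 \<in> E" using u0 by (simp add: E_def)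
  \<comment> \<open>The inverse of the derivative at \<open>up u0\<close> by Cramer's rule; the
    determinant there is \<open>?n \<bullet> ?n\<close>. The inverse function theorem takes it as an
    input.\<close>
  define iv where "iv v = (vector [(cross3 (?b (up u0)) ?n \<bullet> v) / (?n \<bullet> ?n),
      (cross3 ?n (?a (up u0)) \<bullet> v) / (?n \<bullet> ?n), (?n \<bullet> v) / (?n \<bullet> ?n)] :: real^3)" for v
  have bl: "bounded_linear iv"
    unfolding iv_def[abs_def] vector_3_expand divide_inverse
    by (intro bounded_linear_add bounded_linear_compose[OF bounded_linear_scaleR_left]
        bounded_linear_mult_const bounded_linear_inner_right)
  have inv: "Blinfun iv o\<^sub>L f' (up u0) = id_blinfun"
  proof (rule blinfun_eqI)
    fix h :: "real^3"
    have nn: "?n \<bullet> ?n \<noteq> 0" using n[OF u0] by simp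
    have "iv (f' (up u0) h) = h"
      using det[OF up0, of h] nn unfolding iv_def pr_up
      by (simp only: vec_eq_iff forall_3 vector_3) simp
    then show "blinfun_apply (Blinfun iv o\<^sub>L f' (up u0)) h = blinfun_apply id_blinfun h"
      by (simp add: bounded_linear_Blinfun_apply[OF bl])
  qed
  obtain U' V G G' where IFT: "open U'" "U' \<subseteq> E" "up u0 \<in> U'" "open V" "F (up u0) \<in> V"
    "homeomorphism U' V F G" "\<And>y. y \<in> V \<Longrightarrow> (G has_derivative (G' y)) (at y)"
    "\<And>y. y \<in> V \<Longrightarrow> G' y = inv (blinfun_apply (f'(G y)))"
    "\<And>y. y \<in> V \<Longrightarrow> bij (blinfun_apply (f'(G y)))"
    by (rule inverse_function_theorem[OF E f'(1) C1_on_continuous[OF f'(2)] up0 inv]) (assumption, rule that)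
  have GE: "G y \<in> E" if "y \<in> V" for y
    using that IFT(2,6) by (auto simp: homeomorphism_def)
  have fG: "f' (G y) (G' y h) = h" if "y \<in> V" for y h
    using IFT(8,9)[OF that] by (simp add: bij_is_surj surj_f_inv_f)
  \<comment> \<open>At a zero of the determinant the third Cramer identity, taken at the vector that
    \<open>f' (G y)\<close> sends to \<open>?N (G y)\<close>, would make the normal vanish.\<close>
  have Nn: "?N (G y) \<bullet> ?n \<noteq> 0" if "y \<in> V" for y
  proof
    assume "?N (G y) \<bullet> ?n = 0"
    then have "?N (G y) \<bullet> ?N (G y) = 0"
      using det(3)[OF GE[OF that], of "G' y (?N (G y))"] fG[OF that] by simp
    then show False
      using n[of "pr (G y)"] GE[OF that] by (simp add: E_def)
  qed
  have G'_eq: "G' y h $ 1 = (cross3 (?b (G y)) ?n \<bullet> h) / (?N (G y) \<bullet> ?n)"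
    "G' y h $ 2 = (cross3 ?n (?a (G y)) \<bullet> h) / (?N (G y) \<bullet> ?n)"
    "G' y h $ 3 = (?N (G y) \<bullet> h) / (?N (G y) \<bullet> ?n)" if "y \<in> V" for y h
    using det[OF GE[OF that], of "G' y h"] Nn[OF that] by (simp_all add: fG[OF that])
  have Gc: "continuous_on V G"
    using IFT(6) by (simp add: homeomorphism_def)
  have prGc: "continuous_on V (\<lambda>y. pr (G y))"
    by (rule continuous_on_compose2[OF C2_on_continuous[OF prC] Gc]) simp
  have comp: "continuous_on V (\<lambda>y. f (pr (G y)))" if "C1_on D f" for f :: "real^2 \<Rightarrow> real^3"
    by (rule continuous_on_compose2[OF C1_on_continuous[OF that] prGc]) (use GE in \<open>auto simp: E_def\<close>)
  have GC1: "C1_on V G"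
  proof (rule C1_on_directional[OF IFT(4) IFT(7)], assumption)
    fix i :: "real^3"
    have "continuous_on V (\<lambda>y. vector [(cross3 (?b (G y)) ?n \<bullet> i) / (?N (G y) \<bullet> ?n),
      (cross3 ?n (?a (G y)) \<bullet> i) / (?N (G y) \<bullet> ?n), (?N (G y) \<bullet> i) / (?N (G y) \<bullet> ?n)] :: real^3)"
      unfolding vector_3_expand
      by (intro continuous_intros continuous_on_cross comp C1_on_frechet C1_on_normal D ballI Nn)
    then show "continuous_on V (\<lambda>y. G' y i)"
      by (rule continuous_on_eq) (simp add: vec_eq_iff forall_3 G'_eq)
  qed
  have NC1: "C1_on V (\<lambda>y. ?N (G y))"
    by (rule C1_on_compose[OF C1_on_normal[OF D(2)]], rule C1_on_compose[OF C2_on_imp_C1_on[OF prC] GC1])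
      (use GE in \<open>auto simp: E_def\<close>)
  define \<phi> where "\<phi> y = G y $ 3" for y
  have \<phi>': "(\<phi> has_derivative (\<lambda>h. (?N (G y) \<bullet> h) / (?N (G y) \<bullet> ?n))) (at y)" if "y \<in> V" for y
    unfolding \<phi>_def[abs_def]
    using bounded_linear.has_derivative[OF bounded_linear_vec_nth IFT(7)[OF that], of 3]
    by (simp add: G'_eq[OF that])
  have \<phi>C: "C2_on V \<phi>"
  proof (rule C2_on_directional[OF IFT(4) \<phi>'], assumption)
    fix i :: "real^3"
    show "C1_on V (\<lambda>y. (?N (G y) \<bullet> i) / (?N (G y) \<bullet> ?n))"
      by (intro C1_on_divide C1_on_linear_compose[OF bounded_linear_inner_left NC1] Nn)
  qed
  \<comment> \<open>Closeness in space must force closeness of parameters. This is where continuity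
    of the inverse chart \<open>H\<close> enters: it makes \<open>G\<close> return the actual
    parameter of every nearby point of the surface.\<close>
  have "openin (top_of_set (\<Psi> ` D)) (\<Psi> ` D \<inter> (\<lambda>x. up (H x)) -` U')"
  proof (rule continuous_openin_preimage_gen[OF _ IFT(1)])
    have "continuous_on UNIV up"
      unfolding up_def[abs_def]
      by (intro C2_on_continuous C2_on_vector_3 C2_on_nth C2_on_const) auto
    moreover have "continuous_on (\<Psi> ` D) H"
      using H by (simp add: homeomorphism_def)
    ultimately show "continuous_on (\<Psi> ` D) (\<lambda>x. up (H x))"
      by (rule continuous_on_compose2) simp
  qed
  then obtain N' where N': "open N'" "\<Psi> ` D \<inter> (\<lambda>x. up (H x)) -` U' = \<Psi> ` D \<inter> N'"
    by (auto simp: openin_open)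
  have H\<Psi>: "H (\<Psi> u) = u" if "u \<in> D" for u
    using H that by (simp add: homeomorphism_def)
  have F_up: "F (up u) = \<Psi> u" for u
    by (simp add: F_def) (simp add: up_def)
  have mem: "\<Psi> u0 \<in> V \<inter> N \<inter> N'"
  proof -
    have "\<Psi> u0 \<in> \<Psi> ` D \<inter> (\<lambda>x. up (H x)) -` U'"
      using IFT(3) u0 H\<Psi>[OF u0] by auto
    then show ?thesis
      using IFT(5) N(2) unfolding N'(2) by (auto simp: F_up)
  qed
  have inverse_on: "pr (G x) \<in> D \<and> \<Psi> (pr (G x)) = x \<and> \<phi> x = 0" if x: "x \<in> S \<inter> (V \<inter> N \<inter> N')" for x
  proof -
    have "x \<in> \<Psi> ` D" using x N(2) by auto
    then obtain u where u: "u \<in> D" "x = \<Psi> u" by blast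
    have "x \<in> \<Psi> ` D \<inter> (\<lambda>x. up (H x)) -` U'"
      unfolding N'(2) using x \<open>x \<in> \<Psi> ` D\<close> by blast
    then have "up u \<in> U'"
      using u H\<Psi>[OF u(1)] by simp
    then have "G (F (up u)) = up u"
      using IFT(6) by (simp add: homeomorphism_def)
    then have "G x = up u"
      by (simp add: F_up u)
    then show ?thesis
      using u by (simp add: \<phi>_def) (simp add: up_def)
  qed
  have "S \<inter> (V \<inter> N \<inter> N') = {x \<in> V \<inter> N \<inter> N'. \<phi> x = 0}"
  proof (intro equalityI subsetI CollectI conjI)
    fix x assume x: "x \<in> S \<inter> (V \<inter> N \<inter> N')"
    then show "\<phi> x = 0" using inverse_on by blast
  next
    fix x assume x: "x \<in> {x \<in> V \<inter> N \<inter> N'. \<phi> x = 0}"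
    then have "F (G x) = x" "G x \<in> E"
      using IFT(6) GE by (auto simp: homeomorphism_def)
    moreover have "up (pr (G x)) = G x"
      using x by (intro up_pr) (simp add: \<phi>_def)
    ultimately have "x = \<Psi> (pr (G x))" "pr (G x) \<in> D"
      using F_up[of "pr (G x)"] by (auto simp: E_def)
    then show "x \<in> S \<inter> (V \<inter> N \<inter> N')"
      using x N(2) by blast
  qed auto
  moreover have "gradient \<phi> y \<noteq> 0" if "y \<in> V" for y
  proof
    assume "gradient \<phi> y = 0"
    moreover have "gradient \<phi> y \<bullet> ?n = 1"
      using gradient_inner[of \<phi> y ?n] \<phi>'[OF that] Nn[OF that]
      by (auto simp: frechet_derivative_at[OF \<phi>'[OF that], symmetric] differentiable_def)
    ultimately show False by simp
  qed
  ultimately have "local_defining S (V \<inter> N \<inter> N') \<phi>"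
    unfolding local_defining_def
    using C2_on_subset[OF \<phi>C, of "V \<inter> N \<inter> N'"] IFT(4) N(1) N'(1) by auto
  \<comment> \<open>This map inverts the chart but lives on an open set of the space, so it can be
    differentiated there; transition maps inherit their derivative from it.\<close>
  moreover have "C1_on (V \<inter> N \<inter> N') (\<lambda>x. pr (G x))"
    by (rule C1_on_subset[OF C1_on_compose[OF C2_on_imp_C1_on[OF prC] GC1]])
      (use IFT(4) N(1) N'(1) in auto)
  ultimately show ?thesis
    using that[OF mem] inverse_on by blast
qed

text \<open>The description is well defined: a defining function exists by
  \<open>local_param_local_inverse\<close>, and the factor relating its gradient to the normal
  cancels in the quotient.\<close>

lemma perimeter_density_param:
  assumes P: "local_param S D \<Psi>" and u: "u \<in> D"
  shows "perimeter_density S (\<Psi> u) = hnorm \<Psi> u / area_element \<Psi> u"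
proof -
  have D: "C2_on D \<Psi>" "\<Psi> ` D \<subseteq> S" and n: "normal \<Psi> u \<noteq> 0"
    using P u by (auto simp: local_param_def area_element_eq_norm dest: openin_imp_subset)
  have *: "W \<phi> (\<Psi> u) / norm (gradient \<phi> (\<Psi> u)) = hnorm \<Psi> u / area_element \<Psi> u"
    if \<phi>: "\<Psi> u \<in> U" "local_defining S U \<phi>" for U \<phi>
  proof -
    obtain \<kappa> where \<kappa>: "\<kappa> \<noteq> 0" "gradient \<phi> (\<Psi> u) = \<kappa> *\<^sub>R normal \<Psi> u"
      by (rule gradient_parallel_normal[OF \<phi>(2) D u \<phi>(1) n])
    show ?thesis
      unfolding gradient_scaled(1)[OF local_defining_differentiable[OF \<phi>(2,1)] \<kappa>(2)]
      using \<kappa> by (simp add: hnorm_def area_element_eq_norm)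
  qed
  obtain U \<phi> where "\<Psi> u \<in> U" "local_defining S U \<phi>"
    by (rule local_param_local_inverse[OF P u])
  with * show ?thesis
    unfolding perimeter_density_def by (intro the_equality) metis+
qed

section \<open>Surface measure and horizontal perimeter\<close>

text \<open>The absolutely integrable version decides integrability of both sides together and
  equates the values. When integrability fails, measurability and nonnegativity make both integrals
  infinite.\<close>

lemma nn_integral_change_of_variables:
  fixes f :: "real^'m::{finite,wellorder} \<Rightarrow> real" and g :: "real^'m::_ \<Rightarrow> real^'m::_"
  assumes S: "S \<in> sets lebesgue"
    and der: "\<And>x. x \<in> S \<Longrightarrow> (g has_derivative g' x) (at x within S)"
    and inj: "inj_on g S"
    and nonneg: "\<And>y. y \<in> g ` S \<Longrightarrow> 0 \<le> f y"
    and meas1: "(\<lambda>y. indicator (g ` S) y * f y) \<in> borel_measurable lebesgue"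
    and meas2: "(\<lambda>x. indicator S x * (\<bar>det (matrix (g' x))\<bar> * f (g x))) \<in> borel_measurable lebesgue"
  shows "(\<integral>\<^sup>+y\<in>g ` S. ennreal (f y) \<partial>lebesgue)
       = (\<integral>\<^sup>+x\<in>S. ennreal (\<bar>det (matrix (g' x))\<bar> * f (g x)) \<partial>lebesgue)"
proof -
  define h where "h x = \<bar>det (matrix (g' x))\<bar> * f (g x)" for x
  have hn: "0 \<le> h x" if "x \<in> S" for x
    using nonneg that by (simp add: h_def)
  \<comment> \<open>Scalar functions are read as maps into \<open>real^1\<close>, since the theorem
    used is about vector-valued functions.\<close>
  have key: "h absolutely_integrable_on S \<and> integral S h = b
      \<longleftrightarrow> f absolutely_integrable_on (g ` S) \<and> integral (g ` S) f = b" for b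
    using has_absolute_integral_change_of_variables[OF S der inj, of "\<lambda>y. vec (f y) :: real^1" "vec b"]
    by (simp add: absolutely_integrable_on_1_iff integral_on_1_eq h_def[abs_def] vec_eq_iff)
  have conv: "(\<integral>\<^sup>+x\<in>X. ennreal (k x) \<partial>lebesgue) = (\<integral>\<^sup>+x. ennreal (indicator X x * k x) \<partial>lebesgue)"
    for X :: "(real^'m::_) set" and k
    by (intro nn_integral_cong) (simp split: split_indicator)
  have fin: "(\<integral>\<^sup>+x\<in>X. ennreal (k x) \<partial>lebesgue) = ennreal (integral X k)"
    if "k absolutely_integrable_on X" "\<And>x. x \<in> X \<Longrightarrow> 0 \<le> k x" for X :: "(real^'m::_) set" and k
  proof -
    have "(\<integral>\<^sup>+x. ennreal (indicator X x * k x) \<partial>lebesgue) = ennreal (LINT x|lebesgue. indicator X x * k x)"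
      using that by (intro nn_integral_eq_integral) (auto simp: set_integrable_def split: split_indicator)
    moreover have "(LINT x|lebesgue. indicator X x * k x) = integral X k"
      using set_lebesgue_integral_eq_integral(2)[OF that(1)] by (simp add: set_lebesgue_integral_def)
    ultimately show ?thesis
      unfolding conv by simp
  qed
  have inf: "(\<integral>\<^sup>+x\<in>X. ennreal (k x) \<partial>lebesgue) = \<infinity>"
    if "\<not> k absolutely_integrable_on X" "\<And>x. x \<in> X \<Longrightarrow> 0 \<le> k x"
      "(\<lambda>x. indicator X x * k x) \<in> borel_measurable lebesgue" for X :: "(real^'m::_) set" and k
  proof (rule ccontr)
    assume "(\<integral>\<^sup>+x\<in>X. ennreal (k x) \<partial>lebesgue) \<noteq> \<infinity>"
    then have "(\<integral>\<^sup>+x. ennreal (indicator X x * k x) \<partial>lebesgue) < \<infinity>"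
      unfolding conv by (simp add: less_top)
    then have "integrable lebesgue (\<lambda>x. indicator X x * k x)"
      using that by (intro integrableI_nonneg) (auto split: split_indicator)
    then show False
      using that(1) by (simp add: set_integrable_def)
  qed
  show ?thesis
  proof (cases "f absolutely_integrable_on (g ` S)")
    case True
    then have "h absolutely_integrable_on S" "integral S h = integral (g ` S) f"
      using key[of "integral (g ` S) f"] by auto
    then show ?thesis
      using fin[OF True nonneg] fin[of S h] hn unfolding h_def by simp
  next
    case False
    then have "\<not> h absolutely_integrable_on S"
      using key[of "integral S h"] by auto
    then show ?thesis
      using inf[OF False nonneg meas1] inf[of S h] hn meas2 unfolding h_def by simp
  qed
qed

lemma local_paramD:
  assumes "local_param S D \<Psi>"
  shows "open D" "C2_on D \<Psi>" "continuous_on D \<Psi>" "\<Psi> ` D \<subseteq> S" "inj_on \<Psi> D"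
    "\<And>u. u \<in> D \<Longrightarrow> normal \<Psi> u \<noteq> 0"
    "continuous_on D (area_element \<Psi>)" "continuous_on D (hnorm \<Psi>)"
proof -
  show 1: "open D" "C2_on D \<Psi>" and 3: "\<Psi> ` D \<subseteq> S" and "inj_on \<Psi> D"
    using assms by (auto simp: local_param_def dest: openin_imp_subset)
      (auto simp: homeomorphism_def inj_on_def; metis)
  show 2: "continuous_on D \<Psi>"
    by (rule C2_on_continuous[OF 1(2)])
  show "normal \<Psi> u \<noteq> 0" if "u \<in> D" for u
    using assms that by (simp add: local_param_def area_element_eq_norm)
  have c: "continuous_on D (normal \<Psi>)"
    by (rule C1_on_continuous[OF C1_on_normal[OF 1(2)]])
  then show "continuous_on D (area_element \<Psi>)"
    unfolding area_element_eq_norm[abs_def] by (intro continuous_intros)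
  show "continuous_on D (hnorm \<Psi>)"
    unfolding hnorm_def[abs_def] X1_def X2_def vector_3_expand
    by (intro continuous_intros c 2) auto
qed

text \<open>\<open>H\<close> is only a homeomorphism, but near \<open>v\<close> it may be replaced
  by the C1 map \<open>\<rho>\<close> defined on an open set of space. Differentiating
  \<open>\<Psi>' = \<Psi> o H o \<Psi>'\<close> then expresses the partials of
  \<open>\<Psi>'\<close> in those of \<open>\<Psi>\<close>, and the alternating cross product turns
  the coefficients into a Jacobian determinant.\<close>

lemma local_param_transition:
  assumes P: "local_param S D \<Psi>" "\<Psi> ` D = S" and P': "local_param S D' \<Psi>'"
    and H: "homeomorphism D S \<Psi> H"
    and v: "v \<in> D'"
  obtains \<tau>' where "((\<lambda>v. H (\<Psi>' v)) has_derivative \<tau>') (at v)"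
    "area_element \<Psi>' v = \<bar>det (matrix \<tau>')\<bar> * area_element \<Psi> (H (\<Psi>' v))"
proof -
  note D = local_paramD[OF P(1)] and D' = local_paramD[OF P']
  define u where "u = H (\<Psi>' v)"
  have HD: "H (\<Psi>' w) \<in> D" "\<Psi> (H (\<Psi>' w)) = \<Psi>' w" if "w \<in> D'" for w
    using H that D'(4) by (auto simp: homeomorphism_def)
  have u: "u \<in> D" "\<Psi> u = \<Psi>' v"
    using HD[OF v] by (auto simp: u_def)
  obtain U \<phi> \<rho> where U: "\<Psi> u \<in> U" "local_defining S U \<phi>" "C1_on U \<rho>"
    "\<And>x. x \<in> S \<inter> U \<Longrightarrow> \<rho> x \<in> D \<and> \<Psi> (\<rho> x) = x"
    by (rule local_param_local_inverse[OF P(1) u(1)]) (rule that)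
  have "open U" by (rule C1_on_open[OF U(3)])
  have op: "open (D' \<inter> \<Psi>' -` U)"
    using continuous_open_preimage[OF D'(3,1) \<open>open U\<close>] by simp
  have v_op: "v \<in> D' \<inter> \<Psi>' -` U"
    using v U(1) u(2) by simp
  have \<rho>: "(\<rho> has_derivative dif \<rho> (\<Psi>' v)) (at (\<Psi>' v))"
    using C1_on_differentiable[OF U(3)] U(1) u(2) by (simp add: frechet_derivative_works[symmetric])
  define \<tau>' where "\<tau>' h = dif \<rho> (\<Psi>' v) (dif \<Psi>' v h)" for h
  have eq: "H (\<Psi>' w) = \<rho> (\<Psi>' w)" if "w \<in> D' \<inter> \<Psi>' -` U" for w
  proof (rule inj_onD[OF D(5)])
    have "\<Psi>' w \<in> S \<inter> U" using that D'(4) by auto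
    from U(4)[OF this] show "\<Psi> (H (\<Psi>' w)) = \<Psi> (\<rho> (\<Psi>' w))" "\<rho> (\<Psi>' w) \<in> D"
      using that HD[of w] by auto
    show "H (\<Psi>' w) \<in> D" using that HD[of w] by simp
  qed
  have "((\<lambda>w. \<rho> (\<Psi>' w)) has_derivative \<tau>') (at v)"
    unfolding \<tau>'_def[abs_def]
    by (rule has_derivative_compose[OF C2_on_frechet_works[OF D'(2) v] \<rho>])
  then have d\<tau>: "((\<lambda>w. H (\<Psi>' w)) has_derivative \<tau>') (at v)"
    by (rule has_derivative_transform_within_open[OF _ op v_op]) (simp add: eq)
  have lin: "linear (dif \<Psi> u)"
    by (rule linear_frechet_derivative[OF C2_on_differentiable[OF D(2) u(1)]])
  have "((\<lambda>w. \<Psi> (H (\<Psi>' w))) has_derivative (\<lambda>h. dif \<Psi> u (\<tau>' h))) (at v)"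
    using has_derivative_compose[OF d\<tau>, of \<Psi> "dif \<Psi> u"] C2_on_frechet_works[OF D(2) u(1)]
    by (simp add: u_def)
  then have "(\<Psi>' has_derivative (\<lambda>h. dif \<Psi> u (\<tau>' h))) (at v)"
    by (rule has_derivative_transform_within_open[OF _ D'(1) v]) (simp add: HD)
  then have e: "dif \<Psi>' v = (\<lambda>h. dif \<Psi> u (\<tau>' h))"
    by (rule frechet_derivative_at[symmetric])
  have expand: "w = w $ 1 *\<^sub>R axis 1 1 + w $ 2 *\<^sub>R axis 2 1" for w :: "real^2"
    by (simp add: vec_eq_iff forall_2 axis_def)
  let ?a = "dif \<Psi> u (axis 1 1)" and ?b = "dif \<Psi> u (axis 2 1)"
  have e': "dif \<Psi>' v h = \<tau>' h $ 1 *\<^sub>R ?a + \<tau>' h $ 2 *\<^sub>R ?b" for h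
    by (subst e, subst expand) (simp add: linear_add[OF lin] linear_scale[OF lin])
  have "normal \<Psi>' v = det (matrix \<tau>') *\<^sub>R normal \<Psi> u"
    unfolding normal_def e'
    by (simp add: det_2 matrix_def cross_add_left cross_add_right cross_mult_left cross_mult_right
        cross_skew[of ?b ?a] scaleR_left_diff_distrib algebra_simps)
  then show ?thesis
    using that[OF d\<tau>] by (simp add: area_element_eq_norm u_def)
qed

text \<open>The candidate for the surface measure when a single chart covers the surface, as is the
  case for every strip and every displaced strip considered here.\<close>

definition param_measure :: "(real^3) set \<Rightarrow> (real^2) set \<Rightarrow> (real^2 \<Rightarrow> real^3) \<Rightarrow> (real^3) measure" where
  "param_measure S D \<Psi> =
     distr (density (restrict_space lborel D) (\<lambda>u. ennreal (area_element \<Psi> u))) (restrict_space borel S) \<Psi>"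

section \<open>Surface measure and perimeter of a surface with a global chart\<close>

context
  fixes S D \<Psi> H
  assumes P: "local_param S D \<Psi>" and surj: "\<Psi> ` D = S" and H: "homeomorphism D S \<Psi> H"
begin

lemma param_measurable: "\<Psi> \<in> measurable (restrict_space lborel D) (restrict_space borel S)"
proof -
  have "\<Psi> \<in> borel_measurable (restrict_space borel D)"
    by (rule borel_measurable_continuous_on_restrict[OF local_paramD(3)[OF P]])
  then have "\<Psi> \<in> measurable (restrict_space lborel D) borel"
    by (simp cong: measurable_cong_sets sets_restrict_space_cong)
  then show ?thesis
    by (intro measurable_restrict_space2) (use surj in \<open>auto simp: space_restrict_space\<close>)
qed

lemma area_measurable: "(\<lambda>u. ennreal (area_element \<Psi> u)) \<in> borel_measurable (restrict_space lborel D)"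
proof -
  have "area_element \<Psi> \<in> borel_measurable (restrict_space borel D)"
    by (rule borel_measurable_continuous_on_restrict[OF local_paramD(7)[OF P]])
  then have "area_element \<Psi> \<in> borel_measurable (restrict_space lborel D)"
    by (simp cong: measurable_cong_sets sets_restrict_space_cong)
  then show ?thesis by measurable
qed

lemma param_image_sets:
  assumes "B \<in> sets borel" "B \<subseteq> D"
  shows "\<Psi> ` B \<in> sets (restrict_space borel S)"
proof -
  have "H \<in> borel_measurable (restrict_space borel S)"
    by (rule borel_measurable_continuous_on_restrict) (use H in \<open>simp add: homeomorphism_def\<close>)
  from measurable_sets[OF this assms(1)] have "H -` B \<inter> S \<in> sets (restrict_space borel S)"
    by (simp add: space_restrict_space)
  moreover have "H -` B \<inter> S = \<Psi> ` B"
    using H assms(2) by (auto simp: homeomorphism_def image_iff)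
  ultimately show ?thesis by simp
qed

lemma nn_integral_param_measure:
  assumes "f \<in> borel_measurable (restrict_space borel S)"
  shows "(\<integral>\<^sup>+x. f x \<partial>param_measure S D \<Psi>) = (\<integral>\<^sup>+u\<in>D. ennreal (area_element \<Psi> u) * f (\<Psi> u) \<partial>lborel)"
proof -
  have D: "D \<in> sets borel"
    using local_paramD(1)[OF P] by simp
  have m: "\<Psi> \<in> measurable (density (restrict_space lborel D) (\<lambda>u. ennreal (area_element \<Psi> u))) (restrict_space borel S)"
    using param_measurable by simp
  have "(\<integral>\<^sup>+x. f x \<partial>param_measure S D \<Psi>)
      = (\<integral>\<^sup>+u. f (\<Psi> u) \<partial>density (restrict_space lborel D) (\<lambda>u. ennreal (area_element \<Psi> u)))"
    unfolding param_measure_def using assms by (intro nn_integral_distr[OF m]) simp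
  also have "\<dots> = (\<integral>\<^sup>+u. ennreal (area_element \<Psi> u) * f (\<Psi> u) \<partial>restrict_space lborel D)"
    by (rule nn_integral_density[OF area_measurable measurable_compose[OF param_measurable assms]])
  also have "\<dots> = (\<integral>\<^sup>+u\<in>D. ennreal (area_element \<Psi> u) * f (\<Psi> u) \<partial>lborel)"
    by (rule nn_integral_restrict_space) (use D in simp)
  finally show ?thesis .
qed

lemma emeasure_param_measure:
  assumes "B \<in> sets borel" "B \<subseteq> D"
  shows "emeasure (param_measure S D \<Psi>) (\<Psi> ` B) = (\<integral>\<^sup>+u\<in>B. ennreal (area_element \<Psi> u) \<partial>lborel)"
proof -
  have X: "\<Psi> ` B \<in> sets (restrict_space borel S)"
    by (rule param_image_sets[OF assms])
  then have "emeasure (param_measure S D \<Psi>) (\<Psi> ` B) = (\<integral>\<^sup>+x. indicator (\<Psi> ` B) x \<partial>param_measure S D \<Psi>)"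
    by (simp add: param_measure_def)
  also have "\<dots> = (\<integral>\<^sup>+u\<in>D. ennreal (area_element \<Psi> u) * indicator (\<Psi> ` B) (\<Psi> u) \<partial>lborel)"
    using X by (intro nn_integral_param_measure) simp
  also have "\<dots> = (\<integral>\<^sup>+u\<in>B. ennreal (area_element \<Psi> u) \<partial>lborel)"
  proof (rule nn_integral_cong)
    fix u
    show "ennreal (area_element \<Psi> u) * indicator (\<Psi> ` B) (\<Psi> u) * indicator D u
        = ennreal (area_element \<Psi> u) * indicator B u"
      using assms(2) inj_on_image_mem_iff[OF local_paramD(5)[OF P], of u B]
      by (auto split: split_indicator)
  qed
  finally show ?thesis .
qed

text \<open>The transition map into the global chart is injective and its absolute Jacobian is the
  ratio of the area elements, so the area formula for any other chart is a change of
  variables.\<close>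

lemma param_measure_local_param:
  assumes P': "local_param S D' \<Psi>'" and A: "A \<in> sets borel" "A \<subseteq> D'"
  shows "emeasure (param_measure S D \<Psi>) (\<Psi>' ` A) = (\<integral>\<^sup>+u\<in>A. ennreal (area_element \<Psi>' u) \<partial>lborel)"
proof -
  note D = local_paramD[OF P] and D' = local_paramD[OF P']
  define \<tau> where "\<tau> v = H (\<Psi>' v)" for v
  have \<tau>D: "\<tau> v \<in> D" "\<Psi> (\<tau> v) = \<Psi>' v" if "v \<in> D'" for v
    using H that D'(4) by (auto simp: homeomorphism_def \<tau>_def)
  have inj: "inj_on \<tau> D'"
    using inj_onD[OF D'(5)] \<tau>D by (intro inj_onI) metis
  have "\<forall>v. \<exists>\<tau>'. v \<in> D' \<longrightarrow> (\<tau> has_derivative \<tau>') (at v) \<and>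
      area_element \<Psi>' v = \<bar>det (matrix \<tau>')\<bar> * area_element \<Psi> (\<tau> v)"
  proof
    fix v
    show "\<exists>\<tau>'. v \<in> D' \<longrightarrow> (\<tau> has_derivative \<tau>') (at v) \<and>
      area_element \<Psi>' v = \<bar>det (matrix \<tau>')\<bar> * area_element \<Psi> (\<tau> v)"
    proof (cases "v \<in> D'")
      case True
      obtain \<tau>' where "((\<lambda>v. H (\<Psi>' v)) has_derivative \<tau>') (at v)"
        "area_element \<Psi>' v = \<bar>det (matrix \<tau>')\<bar> * area_element \<Psi> (H (\<Psi>' v))"
        by (rule local_param_transition[OF P surj P' H True]) (rule that)
      then show ?thesis
        unfolding \<tau>_def[abs_def] by blast
    qed simp
  qed
  from choice[OF this] obtain \<tau>' where "\<forall>v. v \<in> D' \<longrightarrow> (\<tau> has_derivative \<tau>' v) (at v) \<and>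
      area_element \<Psi>' v = \<bar>det (matrix (\<tau>' v))\<bar> * area_element \<Psi> (\<tau> v)"
    by blast
  then have \<tau>': "\<And>v. v \<in> D' \<Longrightarrow> (\<tau> has_derivative \<tau>' v) (at v)"
    "\<And>v. v \<in> D' \<Longrightarrow> area_element \<Psi>' v = \<bar>det (matrix (\<tau>' v))\<bar> * area_element \<Psi> (\<tau> v)"
    by blast+
  have im: "\<Psi> ` (\<tau> ` A) = \<Psi>' ` A"
    using A(2) \<tau>D by (force simp: image_image)
  have \<tau>A: "\<tau> ` A \<subseteq> D" using \<tau>D A(2) by auto
  \<comment> \<open>An injective image is shown to be Borel by rewriting it as the preimage of
    \<open>A\<close> under the inverse transition map, which is continuous on an open subset of
    \<open>D\<close>.\<close>
  have "\<tau> ` A \<in> sets borel"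
  proof -
    obtain H' where H': "homeomorphism D' (\<Psi>' ` D') \<Psi>' H'" and "openin (top_of_set S) (\<Psi>' ` D')"
      using P' by (auto simp: local_param_def)
    then obtain N where N: "open N" "\<Psi>' ` D' = S \<inter> N"
      by (auto simp: openin_open)
    have op: "open (D \<inter> \<Psi> -` N)"
      by (rule continuous_open_preimage[OF D(3,1) N(1)])
    have "continuous_on (D \<inter> \<Psi> -` N) (\<lambda>u. H' (\<Psi> u))"
    proof (rule continuous_on_compose2[where g = H' and f = \<Psi> and t = "\<Psi>' ` D'"])
      show "continuous_on (\<Psi>' ` D') H'"
        using H' by (simp add: homeomorphism_def)
      show "continuous_on (D \<inter> \<Psi> -` N) \<Psi>"
        by (rule continuous_on_subset[OF D(3)]) auto
    qed (use N(2) surj in auto)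
    then have "(\<lambda>u. H' (\<Psi> u)) \<in> borel_measurable (restrict_space borel (D \<inter> \<Psi> -` N))"
      by (rule borel_measurable_continuous_on_restrict)
    from measurable_sets[OF this A(1)]
    have "(\<lambda>u. H' (\<Psi> u)) -` A \<inter> (D \<inter> \<Psi> -` N) \<in> sets borel"
      using op by (simp add: space_restrict_space sets_restrict_space_iff)
    moreover have "(\<lambda>u. H' (\<Psi> u)) -` A \<inter> (D \<inter> \<Psi> -` N) = \<tau> ` A"
    proof (intro equalityI subsetI)
      fix u assume u: "u \<in> (\<lambda>u. H' (\<Psi> u)) -` A \<inter> (D \<inter> \<Psi> -` N)"
      then have "\<Psi> u \<in> \<Psi>' ` D'" using N(2) surj by auto
      then have "\<Psi>' (H' (\<Psi> u)) = \<Psi> u"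
        using H' by (auto simp: homeomorphism_def)
      then have "\<tau> (H' (\<Psi> u)) = u"
        using H u by (simp add: \<tau>_def homeomorphism_def)
      then show "u \<in> \<tau> ` A" using u by force
    next
      fix u assume "u \<in> \<tau> ` A"
      then obtain v where v: "v \<in> A" "u = \<tau> v" by auto
      then have "v \<in> D'" using A(2) by auto
      then show "u \<in> (\<lambda>u. H' (\<Psi> u)) -` A \<inter> (D \<inter> \<Psi> -` N)"
        using v \<tau>D[of v] H' N(2) by (auto simp: homeomorphism_def)
    qed
    ultimately show ?thesis by simp
  qed
  then have "emeasure (param_measure S D \<Psi>) (\<Psi>' ` A) = (\<integral>\<^sup>+u\<in>\<tau> ` A. ennreal (area_element \<Psi> u) \<partial>lborel)"
    using emeasure_param_measure[OF _ \<tau>A] by (simp add: im)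
  also have "\<dots> = (\<integral>\<^sup>+u\<in>\<tau> ` A. ennreal (area_element \<Psi> u) \<partial>lebesgue)"
    by (rule nn_integral_completion[symmetric])
  also have "\<dots> = (\<integral>\<^sup>+u\<in>A. ennreal (\<bar>det (matrix (\<tau>' u))\<bar> * area_element \<Psi> (\<tau> u)) \<partial>lebesgue)"
  proof (rule nn_integral_change_of_variables)
    show "A \<in> sets lebesgue" using A(1) by simp
    show "(\<tau> has_derivative \<tau>' x) (at x within A)" if "x \<in> A" for x
      using \<tau>'(1)[of x] A(2) that by (auto intro: has_derivative_at_withinI)
    show "inj_on \<tau> A" by (rule inj_on_subset[OF inj A(2)])
    show "0 \<le> area_element \<Psi> y" for y by (simp add: area_element_eq_norm)
    have m: "(\<lambda>x. indicator X x * f x) \<in> borel_measurable lebesgue"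
      if "X \<in> sets borel" "continuous_on X f" for X :: "(real^2) set" and f :: "_ \<Rightarrow> real"
      using borel_measurable_continuous_on_indicator[OF that] by (simp add: measurable_completion)
    show "(\<lambda>y. indicator (\<tau> ` A) y * area_element \<Psi> y) \<in> borel_measurable lebesgue"
      by (rule m[OF \<open>\<tau> ` A \<in> sets borel\<close> continuous_on_subset[OF D(7) \<tau>A]])
    have "(\<lambda>x. indicator A x * area_element \<Psi>' x) \<in> borel_measurable lebesgue"
      by (rule m[OF A(1) continuous_on_subset[OF D'(7) A(2)]])
    moreover have "indicator A x * area_element \<Psi>' x
        = indicator A x * (\<bar>det (matrix (\<tau>' x))\<bar> * area_element \<Psi> (\<tau> x))" for x
      using \<tau>'(2)[of x] A(2) by (auto split: split_indicator)
    ultimately show "(\<lambda>x. indicator A x * (\<bar>det (matrix (\<tau>' x))\<bar> * area_element \<Psi> (\<tau> x))) \<in> borel_measurable lebesgue"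
      by simp
  qed
  also have "\<dots> = (\<integral>\<^sup>+u\<in>A. ennreal (area_element \<Psi>' u) \<partial>lebesgue)"
    using \<tau>'(2) A(2) by (intro nn_integral_cong) (auto split: split_indicator)
  also have "\<dots> = (\<integral>\<^sup>+u\<in>A. ennreal (area_element \<Psi>' u) \<partial>lborel)"
    by (rule nn_integral_completion)
  finally show ?thesis .
qed

text \<open>Existence is the preceding lemma. For uniqueness the global chart alone suffices: every
  measurable subset of \<open>S\<close> is the image of a Borel set of parameters, where the area
  formula prescribes the value.\<close>

lemma surface_measure_param: "surface_measure S = param_measure S D \<Psi>"
  unfolding surface_measure_def
proof (rule the_equality)
  show "sets (param_measure S D \<Psi>) = sets (restrict_space borel S) \<and>
    (\<forall>D' \<Psi>' A. local_param S D' \<Psi>' \<longrightarrow> A \<in> sets borel \<longrightarrow> A \<subseteq> D' \<longrightarrow>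
      emeasure (param_measure S D \<Psi>) (\<Psi>' ` A) = (\<integral>\<^sup>+u\<in>A. ennreal (area_element \<Psi>' u) \<partial>lborel))"
    using param_measure_local_param by (auto simp: param_measure_def)
next
  fix \<mu> assume \<mu>: "sets \<mu> = sets (restrict_space borel S) \<and>
    (\<forall>D' \<Psi>' A. local_param S D' \<Psi>' \<longrightarrow> A \<in> sets borel \<longrightarrow> A \<subseteq> D' \<longrightarrow>
      emeasure \<mu> (\<Psi>' ` A) = (\<integral>\<^sup>+u\<in>A. ennreal (area_element \<Psi>' u) \<partial>lborel))"
  show "\<mu> = param_measure S D \<Psi>"
  proof (rule measure_eqI)
    show "sets \<mu> = sets (param_measure S D \<Psi>)"
      using \<mu> by (simp add: param_measure_def)
    fix X assume "X \<in> sets \<mu>"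
    then have X: "X \<in> sets (restrict_space borel S)"
      using \<mu> by simp
    have "\<Psi> -` X \<inter> space (restrict_space lborel D) \<in> sets (restrict_space lborel D)"
      by (rule measurable_sets[OF param_measurable X])
    then have B: "\<Psi> -` X \<inter> D \<in> sets borel"
      using local_paramD(1)[OF P] by (simp add: space_restrict_space sets_restrict_space_iff)
    have "X = \<Psi> ` (\<Psi> -` X \<inter> D)"
      using X surj by (auto simp: sets_restrict_space)
    moreover have "emeasure \<mu> (\<Psi> ` (\<Psi> -` X \<inter> D))
        = (\<integral>\<^sup>+u\<in>\<Psi> -` X \<inter> D. ennreal (area_element \<Psi> u) \<partial>lborel)"
      using \<mu> P B by simp
    ultimately show "emeasure \<mu> X = emeasure (param_measure S D \<Psi>) X"
      using emeasure_param_measure[OF B] by simp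
  qed
qed

text \<open>The area element from the surface measure cancels the denominator of
  \<open>perimeter_density\<close>, leaving an integral over a compact parameter set that no longer
  mentions defining functions.\<close>

lemma H_perimeter_measure_image:
  assumes K: "compact K" "K \<subseteq> D"
  shows "measure (H_perimeter_measure S) (\<Psi> ` K) = integral K (hnorm \<Psi>)"
proof -
  note D = local_paramD[OF P]
  have dens: "perimeter_density S g = hnorm \<Psi> (H g) / area_element \<Psi> (H g)" if "g \<in> S" for g
    using perimeter_density_param[OF P, of "H g"] H that by (auto simp: homeomorphism_def)
  have "continuous_on S (\<lambda>g. hnorm \<Psi> (H g) / area_element \<Psi> (H g))"
    using H D(6) by (intro continuous_on_divide continuous_on_compose2[OF D(7)] continuous_on_compose2[OF D(8)])
      (auto simp: homeomorphism_def area_element_eq_norm)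
  then have "continuous_on S (perimeter_density S)"
    by (rule continuous_on_eq) (simp add: dens)
  then have "perimeter_density S \<in> borel_measurable (restrict_space borel S)"
    by (rule borel_measurable_continuous_on_restrict)
  then have m: "(\<lambda>g. ennreal (perimeter_density S g)) \<in> borel_measurable (restrict_space borel S)"
    by measurable
  have s: "sets (param_measure S D \<Psi>) = sets (restrict_space borel S)"
    by (simp add: param_measure_def)
  have Kb: "K \<in> sets borel" using K(1) by (simp add: compact_imp_closed)
  have X: "\<Psi> ` K \<in> sets (restrict_space borel S)"
    by (rule param_image_sets[OF Kb K(2)])
  have int: "integrable lborel (\<lambda>u. indicator K u *\<^sub>R hnorm \<Psi> u)"
    by (rule borel_integrable_compact[OF K(1) continuous_on_subset[OF D(8) K(2)]])
  have "emeasure (H_perimeter_measure S) (\<Psi> ` K)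
      = (\<integral>\<^sup>+g\<in>\<Psi> ` K. ennreal (perimeter_density S g) \<partial>param_measure S D \<Psi>)"
    unfolding H_perimeter_measure_def surface_measure_param
    by (rule emeasure_density) (use m X s in \<open>simp_all cong: measurable_cong_sets\<close>)
  also have "\<dots> = (\<integral>\<^sup>+u\<in>D. ennreal (area_element \<Psi> u) *
      (ennreal (perimeter_density S (\<Psi> u)) * indicator (\<Psi> ` K) (\<Psi> u)) \<partial>lborel)"
    by (intro nn_integral_param_measure borel_measurable_times_ennreal m borel_measurable_indicator X)
  also have "\<dots> = (\<integral>\<^sup>+u. ennreal (indicator K u *\<^sub>R hnorm \<Psi> u) \<partial>lborel)"
  proof (rule nn_integral_cong)
    fix u
    show "ennreal (area_element \<Psi> u) * (ennreal (perimeter_density S (\<Psi> u)) * indicator (\<Psi> ` K) (\<Psi> u)) * indicator D u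
      = ennreal (indicator K u *\<^sub>R hnorm \<Psi> u)"
    proof (cases "u \<in> D")
      case True
      have "ennreal (area_element \<Psi> u) * ennreal (perimeter_density S (\<Psi> u)) = ennreal (hnorm \<Psi> u)"
        using D(6)[OF True]
        by (simp add: perimeter_density_param[OF P True] ennreal_mult'[symmetric] area_element_eq_norm)
      moreover have "\<Psi> u \<in> \<Psi> ` K \<longleftrightarrow> u \<in> K"
        by (rule inj_on_image_mem_iff[OF D(5) True K(2)])
      ultimately show ?thesis
        using True by (simp split: split_indicator)
    next
      case False
      then show ?thesis using K(2) by (auto split: split_indicator)
    qed
  qed
  also have "\<dots> = ennreal (LINT u|lborel. indicator K u *\<^sub>R hnorm \<Psi> u)"
    using int by (intro nn_integral_eq_integral) (auto simp: hnorm_def split: split_indicator)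
  also have "(LINT u|lborel. indicator K u *\<^sub>R hnorm \<Psi> u) = integral K (hnorm \<Psi>)"
    using set_borel_integral_eq_integral(2)[of K "hnorm \<Psi>"] int
    by (simp add: set_integrable_def set_lebesgue_integral_def)
  finally have "emeasure (H_perimeter_measure S) (\<Psi> ` K) = ennreal (integral K (hnorm \<Psi>))" .
  moreover have "0 \<le> integral K (hnorm \<Psi>)"
    using set_borel_integral_eq_integral(1)[of K "hnorm \<Psi>"] int
    by (intro integral_nonneg) (auto simp: set_integrable_def hnorm_def)
  ultimately show ?thesis
    by (simp add: measure_def)
qed

end

section \<open>Isometries of the Heisenberg group\<close>

lemma has_derivative_vector_3:
  assumes "(f1 has_derivative f1') F" "(f2 has_derivative f2') F" "(f3 has_derivative f3') F"
  shows "((\<lambda>x. vector [f1 x, f2 x, f3 x] :: real^3) has_derivative (\<lambda>h. vector [f1' h, f2' h, f3' h])) F"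
  unfolding vector_3_expand
  by (intro has_derivative_add has_derivative_scaleR_left assms)

definition heis_iso :: "real^3 \<Rightarrow> real \<Rightarrow> real^3 \<Rightarrow> real^3" where
  "heis_iso b \<theta> p = heis_mult b (rotation_t \<theta> p)"

text \<open>Left translation is affine in the moved point. This is the linear part; the last
  component carries the bilinear term of the group law as a shear.\<close>

definition iso_linear :: "real^3 \<Rightarrow> real \<Rightarrow> real^3 \<Rightarrow> real^3" where
  "iso_linear b \<theta> v = vector [cos \<theta> * v $ 1 - sin \<theta> * v $ 2, sin \<theta> * v $ 1 + cos \<theta> * v $ 2,
     v $ 3 + (b $ 1 * (sin \<theta> * v $ 1 + cos \<theta> * v $ 2) - (cos \<theta> * v $ 1 - sin \<theta> * v $ 2) * b $ 2) / 2]"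

lemma iso_eq: "heis_iso b \<theta> p = b + iso_linear b \<theta> p"
  by (simp add: heis_iso_def iso_linear_def heis_mult_def rotation_t_def vec_eq_iff forall_3)

lemma linear_iso_linear: "linear (iso_linear b \<theta>)"
  by (rule linearI) (simp_all add: iso_linear_def vec_eq_iff forall_3 algebra_simps add_divide_distrib diff_divide_distrib)

text \<open>Variations displace points by Euclidean addition, not by the group law; affinity of the
  isometry is what carries a displaced surface to a displaced surface.\<close>

lemma iso_add: "heis_iso b \<theta> (p + v) = heis_iso b \<theta> p + iso_linear b \<theta> v"
  by (simp add: iso_eq linear_add[OF linear_iso_linear])

lemma bounded_linear_iso_linear: "bounded_linear (iso_linear b \<theta>)"
  using linear_iso_linear by (simp add: linear_conv_bounded_linear)

lemma C2_on_iso: "open U \<Longrightarrow> C2_on U (heis_iso b \<theta>)"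
  unfolding iso_eq[abs_def]
  by (intro C2_on_add C2_on_const C2_on_bounded_linear bounded_linear_iso_linear)

lemma has_derivative_iso: "(heis_iso b \<theta> has_derivative iso_linear b \<theta>) (at p within X)"
  unfolding iso_eq[abs_def]
  using has_derivative_add[OF has_derivative_const bounded_linear_imp_has_derivative[OF bounded_linear_iso_linear]]
  by simp

text \<open>The Pythagorean identity in the expanded and scaled form that
  \<open>algebra_simps\<close> leaves behind.\<close>

lemma cos_sin_sum: "x * (cos \<theta> * cos \<theta>) + x * (sin \<theta> * sin \<theta>) = x" for x :: real
proof -
  have "x * (cos \<theta> * cos \<theta>) + x * (sin \<theta> * sin \<theta>) = x * ((sin \<theta>)\<^sup>2 + (cos \<theta>)\<^sup>2)"
    by (simp only: power2_eq_square distrib_left add.commute)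
  then show ?thesis by simp
qed

text \<open>Left translations preserve the horizontal frame, and the rotation turns it by the angle
  \<open>\<theta>\<close>.\<close>

lemma iso_linear_X1: "iso_linear b \<theta> (X1 p) = cos \<theta> *\<^sub>R X1 (heis_iso b \<theta> p) + sin \<theta> *\<^sub>R X2 (heis_iso b \<theta> p)"
  and iso_linear_X2: "iso_linear b \<theta> (X2 p) = - sin \<theta> *\<^sub>R X1 (heis_iso b \<theta> p) + cos \<theta> *\<^sub>R X2 (heis_iso b \<theta> p)"
  using cos_sin_sum[of "p $ 1" \<theta>] cos_sin_sum[of "p $ 2" \<theta>]
  by (simp_all add: iso_eq iso_linear_def X1_def X2_def vec_eq_iff forall_3 algebra_simps diff_divide_distrib add_divide_distrib)

text \<open>The linear part is a plane rotation combined with a shear in the last coordinate, hence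
  of determinant one, and a triple product is a determinant. In the proof \<open>\<mu>\<close> and
  \<open>\<nu>\<close> are the shear coefficients.\<close>

lemma iso_linear_triple: "cross3 (iso_linear b \<theta> u) (iso_linear b \<theta> v) \<bullet> iso_linear b \<theta> z = cross3 u v \<bullet> z"
proof -
  define c s where "c = cos \<theta>" and "s = sin \<theta>"
  define \<tau> where "\<tau> w = (b $ 1 * (s * w $ 1 + c * w $ 2) - (c * w $ 1 - s * w $ 2) * b $ 2) / 2" for w :: "real^3"
  define \<mu> \<nu> where "\<mu> = (b $ 1 * s - c * b $ 2) / 2" and "\<nu> = (b $ 1 * c + s * b $ 2) / 2"
  have \<tau>: "\<tau> w = \<mu> * w $ 1 + \<nu> * w $ 2" for w
    by (simp add: \<tau>_def \<mu>_def \<nu>_def field_simps)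
  have 1: "c * c + s * s = 1"
    using cos_sin_sum[of 1 \<theta>] by (simp add: c_def s_def)
  have rot: "(c * x - s * y) * (s * x' + c * y') - (s * x + c * y) * (c * x' - s * y') = x * y' - y * x'" for x y x' y'
  proof -
    have "(c * x - s * y) * (s * x' + c * y') - (s * x + c * y) * (c * x' - s * y') = (c * c + s * s) * (x * y' - y * x')"
      by (simp add: algebra_simps)
    then show ?thesis by (simp add: 1)
  qed
  have expand: "cross3 a d \<bullet> e = (a $ 1 * d $ 2 - a $ 2 * d $ 1) * e $ 3 + (d $ 1 * e $ 2 - d $ 2 * e $ 1) * a $ 3
      + (e $ 1 * a $ 2 - e $ 2 * a $ 1) * d $ 3" for a d e :: "real^3"
    by (simp add: cross3_def inner_vec_def sum_3 algebra_simps)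
  have comp: "iso_linear b \<theta> w = vector [c * w $ 1 - s * w $ 2, s * w $ 1 + c * w $ 2, w $ 3 + \<tau> w]" for w
    by (simp add: iso_linear_def c_def s_def \<tau>_def)
  show ?thesis
    unfolding expand comp vector_3 rot \<tau> by (simp add: algebra_simps)
qed

lemma heis_mult_minus: "heis_mult (- x) (heis_mult x z) = z" "heis_mult x (heis_mult (- x) z) = z"
  by (simp_all add: heis_mult_def vec_eq_iff forall_3 field_simps)

lemma rotation_t_heis_mult: "rotation_t \<theta> (heis_mult x y) = heis_mult (rotation_t \<theta> x) (rotation_t \<theta> y)"
proof -
  have "(cos \<theta> * x $ 1 - sin \<theta> * x $ 2) * (sin \<theta> * y $ 1 + cos \<theta> * y $ 2)
      - (cos \<theta> * y $ 1 - sin \<theta> * y $ 2) * (sin \<theta> * x $ 1 + cos \<theta> * x $ 2)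
      = (x $ 1 * y $ 2 - y $ 1 * x $ 2) * (cos \<theta> * cos \<theta>) + (x $ 1 * y $ 2 - y $ 1 * x $ 2) * (sin \<theta> * sin \<theta>)"
    by (simp add: algebra_simps)
  then show ?thesis
    unfolding cos_sin_sum by (simp add: rotation_t_def heis_mult_def vec_eq_iff forall_3) (simp add: algebra_simps)
qed

lemma rotation_t_inverse: "rotation_t \<theta> (rotation_t (- \<theta>) p) = p" "rotation_t (- \<theta>) (rotation_t \<theta> p) = p"
  using cos_sin_sum[of "p $ 1" \<theta>] cos_sin_sum[of "p $ 2" \<theta>]
  by (simp_all add: rotation_t_def vec_eq_iff forall_3 algebra_simps)

lemma rotation_t_minus: "rotation_t \<theta> (- p) = - rotation_t \<theta> p"
  by (simp add: rotation_t_def vec_eq_iff forall_3)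

lemma iso_inverse:
  "heis_iso b \<theta> (heis_iso (rotation_t (- \<theta>) (- b)) (- \<theta>) p) = p"
  "heis_iso (rotation_t (- \<theta>) (- b)) (- \<theta>) (heis_iso b \<theta> p) = p"
  by (simp_all add: heis_iso_def rotation_t_heis_mult rotation_t_inverse rotation_t_minus heis_mult_minus)

lemma frechet_iso_compose:
  assumes "\<Psi> differentiable (at u)"
  shows "dif (\<lambda>u. heis_iso b \<theta> (\<Psi> u)) u h = iso_linear b \<theta> (dif \<Psi> u h)"
proof -
  have "((\<lambda>u. heis_iso b \<theta> (\<Psi> u)) has_derivative (\<lambda>h. iso_linear b \<theta> (dif \<Psi> u h))) (at u)"
    by (rule has_derivative_compose[OF _ has_derivative_iso]) (use assms frechet_derivative_works in blast)
  then show ?thesis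
    by (simp add: frechet_derivative_at[symmetric])
qed

text \<open>Because of the shear, \<open>iso_linear\<close> need not carry normals to normals; the
  pairing of a normal with a transported vector is a triple product and does survive.\<close>

lemma normal_iso_inner:
  assumes "\<Psi> differentiable (at u)"
  shows "normal (\<lambda>u. heis_iso b \<theta> (\<Psi> u)) u \<bullet> iso_linear b \<theta> v = normal \<Psi> u \<bullet> v"
  by (simp add: normal_def frechet_iso_compose[OF assms] iso_linear_triple)

text \<open>The two pairings of the normal with the frame are rotated by \<open>\<theta>\<close>, so
  the sum of their squares is unchanged.\<close>

lemma hnorm_iso:
  assumes "\<Psi> differentiable (at u)"
  shows "hnorm (\<lambda>u. heis_iso b \<theta> (\<Psi> u)) u = hnorm \<Psi> u"
proof -
  define P Q where "P = normal (\<lambda>u. heis_iso b \<theta> (\<Psi> u)) u \<bullet> X1 (heis_iso b \<theta> (\<Psi> u))"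
    and "Q = normal (\<lambda>u. heis_iso b \<theta> (\<Psi> u)) u \<bullet> X2 (heis_iso b \<theta> (\<Psi> u))"
  have "normal \<Psi> u \<bullet> X1 (\<Psi> u) = cos \<theta> * P + sin \<theta> * Q"
    using normal_iso_inner[OF assms, of b \<theta> "X1 (\<Psi> u)"]
    by (simp add: iso_linear_X1 inner_add_right P_def Q_def)
  moreover have "normal \<Psi> u \<bullet> X2 (\<Psi> u) = - sin \<theta> * P + cos \<theta> * Q"
    using normal_iso_inner[OF assms, of b \<theta> "X2 (\<Psi> u)"]
    by (simp add: iso_linear_X2 inner_diff_right P_def Q_def)
  moreover have "(cos \<theta> * P + sin \<theta> * Q)\<^sup>2 + (- sin \<theta> * P + cos \<theta> * Q)\<^sup>2 = P\<^sup>2 + Q\<^sup>2"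
    using cos_sin_sum[of "P\<^sup>2" \<theta>] cos_sin_sum[of "Q\<^sup>2" \<theta>] by (simp add: power2_eq_square algebra_simps)
  ultimately show ?thesis
    by (simp only: hnorm_def P_def Q_def)
qed

text \<open>The frame components \<open>P\<close>, \<open>q\<close> of the normal of the varied strip become divisible by \<open>W\<close>
  after rotation to the directions \<open>(1, -G)\<close> and \<open>(G, 1)\<close>.\<close>

lemma strip_normal_identity:
  fixes G g y a a1 a2 s x z W Q :: real
  defines "W \<equiv> 1 + G\<^sup>2" and "x \<equiv> y * G + s * a" and "z \<equiv> y - s * a * G"
    and "Q \<equiv> 1 + y\<^sup>2 * g / 2 - s * a * y * G * g + s\<^sup>2 * a\<^sup>2 * g / 2"
  defines "v1 \<equiv> G + s * a1" and "v2 \<equiv> 1 - s * a1 * G" and "v3 \<equiv> - (s / 2) * (a1 * y * W + a * W)"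
    and "w1 \<equiv> y * g + s * a2" and "w2 \<equiv> - s * (a2 * G + a * g)"
    and "w3 \<equiv> 1 - (s / 2) * (a2 * y * W + 2 * a * y * G * g)"
  defines "P \<equiv> (v2 * w3 - v3 * w2) - z / 2 * (v1 * w2 - v2 * w1)"
    and "q \<equiv> (v3 * w1 - v1 * w3) + x / 2 * (v1 * w2 - v2 * w1)"
  shows "P\<^sup>2 + q\<^sup>2 = W * ((1 + g * y\<^sup>2 / 2 - s\<^sup>2 * (a\<^sup>2 * g / 2))\<^sup>2
        + (s * (a1 * Q + a * y * g + s * a * (W * a2 + a * G * g)))\<^sup>2)"
proof -
  \<comment> \<open>Halved variables let the factors one half cancel, so that both identities become
    polynomial.\<close>
  define m r where "m = y / 2" and "r = s / 2"
  have y: "y = 2 * m" and s: "s = 2 * r"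
    by (simp_all add: m_def r_def)
  define \<alpha> \<beta> where "\<alpha> = 1 + g * y\<^sup>2 / 2 - s\<^sup>2 * (a\<^sup>2 * g / 2)"
    and "\<beta> = s * (a1 * Q + a * y * g + s * a * (W * a2 + a * G * g))"
  have 1: "P - G * q = W * \<alpha>"
    unfolding P_def q_def \<alpha>_def x_def z_def W_def v1_def v2_def v3_def w1_def w2_def w3_def y s
    by (simp add: power2_eq_square) (simp add: algebra_simps add_divide_distrib diff_divide_distrib)
  have 2: "G * P + q = - W * \<beta>"
    unfolding P_def q_def \<beta>_def x_def z_def W_def Q_def v1_def v2_def v3_def w1_def w2_def w3_def y s
    by (simp add: power2_eq_square) (simp add: algebra_simps add_divide_distrib diff_divide_distrib)
  have "W * (P\<^sup>2 + q\<^sup>2) = (P - G * q)\<^sup>2 + (G * P + q)\<^sup>2"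
    unfolding W_def by (simp add: power2_eq_square algebra_simps)
  also have "\<dots> = W * (W * (\<alpha>\<^sup>2 + \<beta>\<^sup>2))"
    unfolding 1 2 by (simp add: power2_eq_square algebra_simps)
  finally have "P\<^sup>2 + q\<^sup>2 = W * (\<alpha>\<^sup>2 + \<beta>\<^sup>2)"
    using sum_power2_gt_zero_iff[of 1 G] by (simp add: W_def)
  then show ?thesis
    by (simp only: \<alpha>_def \<beta>_def)
qed

section \<open>The variation of a strip\<close>

lemma DERIV_sqrt_twice:
  assumes "\<And>x. x \<in> U \<Longrightarrow> DERIV R x :> R1 x" "\<And>x. x \<in> U \<Longrightarrow> DERIV R1 x :> R2 x"
    "\<And>x. x \<in> U \<Longrightarrow> 0 < R x" "x \<in> U"
  shows "DERIV (\<lambda>x. sqrt (R x)) x :> R1 x * inverse (sqrt (R x)) / 2"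
    and "DERIV (\<lambda>x. R1 x * inverse (sqrt (R x)) / 2) x :>
      (R2 x * inverse (sqrt (R x))
        - R1 x * (inverse (sqrt (R x)) * (R1 x * inverse (sqrt (R x)) / 2) * inverse (sqrt (R x)))) / 2"
proof -
  show 1: "DERIV (\<lambda>x. sqrt (R x)) x :> R1 x * inverse (sqrt (R x)) / 2"
    using DERIV_chain2[OF DERIV_real_sqrt[OF assms(3)[OF assms(4)]] assms(1)[OF assms(4)]]
    by (simp add: mult.commute)
  have "sqrt (R x) \<noteq> 0"
    using assms(3)[OF assms(4)] by simp
  then have "DERIV (\<lambda>x. inverse (sqrt (R x))) x :>
      - (inverse (sqrt (R x)) * (R1 x * inverse (sqrt (R x)) / 2) * inverse (sqrt (R x)))"
    by (rule DERIV_inverse'[OF 1])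
  from DERIV_cdivide[OF DERIV_mult[OF assms(2)[OF assms(4)] this], of 2]
  show "DERIV (\<lambda>x. R1 x * inverse (sqrt (R x)) / 2) x :>
      (R2 x * inverse (sqrt (R x))
        - R1 x * (inverse (sqrt (R x)) * (R1 x * inverse (sqrt (R x)) / 2) * inverse (sqrt (R x)))) / 2"
    by (simp add: algebra_simps)
qed

text \<open>The first square keeps the radicand positive, so the Leibniz rule applies twice. At
  \<open>s = 0\<close> the first derivative of the radicand vanishes, and the second derivative of
  the root is that of the radicand divided by twice the root.\<close>

lemma second_derivative_integral:
  fixes W c e b0 b1 b2 :: "'a::euclidean_space \<Rightarrow> real"
  assumes cont: "continuous_on (cbox l h) W" "continuous_on (cbox l h) c" "continuous_on (cbox l h) e"
      "continuous_on (cbox l h) b0" "continuous_on (cbox l h) b1" "continuous_on (cbox l h) b2"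
    and d: "0 < d" and W: "\<And>u. u \<in> cbox l h \<Longrightarrow> 0 < W u"
    and pos: "\<And>s u. \<bar>s\<bar> < d \<Longrightarrow> u \<in> cbox l h \<Longrightarrow> 0 < c u - s\<^sup>2 * e u"
    and f: "f = (\<lambda>s u. sqrt (W u * ((c u - s\<^sup>2 * e u)\<^sup>2 + (s * (b0 u + s * b1 u + s\<^sup>2 * b2 u))\<^sup>2)))"
  obtains F' where "\<And>s. \<bar>s\<bar> < d \<Longrightarrow> ((\<lambda>s. integral (cbox l h) (f s)) has_real_derivative F' s) (at s)"
    "(F' has_real_derivative integral (cbox l h) (\<lambda>u. sqrt (W u) * ((b0 u)\<^sup>2 / c u - 2 * e u))) (at 0)"
proof -
  define p k k1 where "p s u = c u - s\<^sup>2 * e u" and "k s u = s * (b0 u + s * b1 u + s\<^sup>2 * b2 u)"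
    and "k1 s u = b0 u + 2 * s * b1 u + 3 * s\<^sup>2 * b2 u" for s u
  define R where "R s u = W u * ((p s u)\<^sup>2 + (k s u)\<^sup>2)" for s u
  define R1 where "R1 s u = W u * (2 * p s u * (- 2 * s * e u) + 2 * k s u * k1 s u)" for s u
  define R2 where "R2 s u = W u * (2 * (- 2 * s * e u)\<^sup>2 + 2 * p s u * (- 2 * e u) + 2 * (k1 s u)\<^sup>2
      + 2 * k s u * (2 * b1 u + 6 * s * b2 u))" for s u
  define f1 where "f1 s u = R1 s u * inverse (sqrt (R s u)) / 2" for s u
  define f2 where "f2 s u = (R2 s u * inverse (sqrt (R s u))
        - R1 s u * (inverse (sqrt (R s u)) * (R1 s u * inverse (sqrt (R s u)) / 2) * inverse (sqrt (R s u)))) / 2" for s u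
  have f_eq: "f = (\<lambda>s u. sqrt (R s u))"
    by (simp add: f R_def p_def k_def)
  define U where "U = {- d<..<d}"
  have U: "open U" "convex U" "0 \<in> U" and U_iff: "s \<in> U \<longleftrightarrow> \<bar>s\<bar> < d" for s
    using d by (auto simp: U_def)
  have Rpos: "0 < R s u" if "s \<in> U" "u \<in> cbox l h" for s u
  proof -
    have "0 < p s u" using pos that by (simp add: U_iff p_def)
    then have "0 < (p s u)\<^sup>2 + (k s u)\<^sup>2" by (simp add: add_pos_nonneg)
    then show ?thesis using W that by (simp add: R_def)
  qed
  have dp: "DERIV (\<lambda>s. p s u) s :> - 2 * s * e u" for s u
    unfolding p_def by (auto intro!: derivative_eq_intros)
  have dk: "DERIV (\<lambda>s. k s u) s :> k1 s u" for s u
    unfolding k_def k1_def by (auto intro!: derivative_eq_intros simp: power2_eq_square algebra_simps)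
  have dk1: "DERIV (\<lambda>s. k1 s u) s :> 2 * b1 u + 6 * s * b2 u" for s u
    unfolding k1_def by (auto intro!: derivative_eq_intros)
  have dR: "DERIV (\<lambda>s. R s u) s :> R1 s u" for s u
    unfolding R_def R1_def by (auto intro!: derivative_eq_intros dp dk simp: power2_eq_square algebra_simps)
  have dR1: "DERIV (\<lambda>s. R1 s u) s :> R2 s u" for s u
    unfolding R1_def R2_def
    by (auto intro!: derivative_eq_intros dp dk dk1 simp: power2_eq_square algebra_simps)
  have df: "DERIV (\<lambda>s. f s u) s :> f1 s u" "DERIV (\<lambda>s. f1 s u) s :> f2 s u"
    if "s \<in> U" "u \<in> cbox l h" for s u
    unfolding f_eq f1_def f2_def
    using DERIV_sqrt_twice[of U "\<lambda>s. R s u" "\<lambda>s. R1 s u" "\<lambda>s. R2 s u" s] dR dR1 Rpos that by auto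
  have sn: "continuous_on (U \<times> cbox l h) (\<lambda>x. g (snd x))" if "continuous_on (cbox l h) g" for g :: "'a \<Rightarrow> real"
    by (rule continuous_on_compose2[OF that continuous_on_snd[OF continuous_on_id]]) auto
  note cn = cont[THEN sn]
  have cR: "continuous_on (U \<times> cbox l h) (\<lambda>x. R (fst x) (snd x))"
    "continuous_on (U \<times> cbox l h) (\<lambda>x. R1 (fst x) (snd x))"
    "continuous_on (U \<times> cbox l h) (\<lambda>x. R2 (fst x) (snd x))"
    unfolding R_def R1_def R2_def p_def k_def k1_def
    by (intro continuous_intros cn)+
  have nz: "\<forall>x\<in>U \<times> cbox l h. sqrt (R (fst x) (snd x)) \<noteq> 0"
  proof
    fix x assume "x \<in> U \<times> cbox l h"
    then show "sqrt (R (fst x) (snd x)) \<noteq> 0"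
      using Rpos[of "fst x" "snd x"] by auto
  qed
  have cf: "continuous_on (U \<times> cbox l h) (\<lambda>(s, u). f s u)"
    "continuous_on (U \<times> cbox l h) (\<lambda>(s, u). f1 s u)" "continuous_on (U \<times> cbox l h) (\<lambda>(s, u). f2 s u)"
    unfolding f_eq f1_def f2_def split_beta by (intro continuous_intros cR nz; simp)+
  have slice: "g s integrable_on cbox l h" if "continuous_on (U \<times> cbox l h) (\<lambda>(s, u). g s u)" "s \<in> U"
    for g :: "real \<Rightarrow> 'a \<Rightarrow> real" and s
  proof -
    have "continuous_on (cbox l h) (\<lambda>u. (\<lambda>(s, u). g s u) (s, u))"
      by (rule continuous_on_compose2[OF that(1)]) (use that(2) in \<open>auto intro!: continuous_intros\<close>)
    then show ?thesis by (intro integrable_continuous) simp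
  qed
  have L: "((\<lambda>s. integral (cbox l h) (g s)) has_real_derivative integral (cbox l h) (g' s)) (at s)"
    if "\<And>s u. s \<in> U \<Longrightarrow> u \<in> cbox l h \<Longrightarrow> DERIV (\<lambda>s. g s u) s :> g' s u"
      "continuous_on (U \<times> cbox l h) (\<lambda>(s, u). g s u)" "continuous_on (U \<times> cbox l h) (\<lambda>(s, u). g' s u)" "s \<in> U"
    for g g' :: "real \<Rightarrow> 'a \<Rightarrow> real" and s
  proof -
    have "((\<lambda>s. integral (cbox l h) (g s)) has_field_derivative integral (cbox l h) (g' s)) (at s within U)"
      by (rule leibniz_rule_field_derivative[OF has_field_derivative_at_within[OF that(1)] slice[OF that(2)] that(3,4) U(2)])
    then show ?thesis
      using at_within_open[OF that(4) U(1)] by simp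
  qed
  have zero: "f2 0 u = sqrt (W u) * ((b0 u)\<^sup>2 / c u - 2 * e u)" if "u \<in> cbox l h" for u
  proof -
    have c: "0 < c u" using pos[of 0 u] d that by simp
    define r where "r = sqrt (W u)"
    have r: "0 < r" "W u = r * r"
      using W[OF that] by (simp_all add: r_def)
    have "sqrt (R 0 u) = r * c u"
      using c by (simp add: R_def p_def k_def real_sqrt_mult r_def)
    moreover have "R1 0 u = 0" "R2 0 u = r * r * (2 * (b0 u)\<^sup>2 - 4 * c u * e u)"
      by (simp_all add: R1_def R2_def p_def k_def k1_def r algebra_simps)
    ultimately have "f2 0 u = r * r * (2 * (b0 u)\<^sup>2 - 4 * c u * e u) * inverse (r * c u) / 2"
      by (simp add: f2_def)
    also have "\<dots> = r * ((b0 u)\<^sup>2 / c u - 2 * e u)"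
      using c r(1) by (simp add: field_simps power2_eq_square)
    finally show ?thesis by (simp add: r_def)
  qed
  show ?thesis
  proof (rule that[of "\<lambda>s. integral (cbox l h) (f1 s)"])
    show "((\<lambda>s. integral (cbox l h) (f s)) has_real_derivative integral (cbox l h) (f1 s)) (at s)" if "\<bar>s\<bar> < d" for s
      by (rule L[OF df(1) cf(1,2)]) (use that in \<open>auto simp: U_iff\<close>)
    have "((\<lambda>s. integral (cbox l h) (f1 s)) has_real_derivative integral (cbox l h) (f2 0)) (at 0)"
      by (rule L[OF df(2) cf(2,3) U(3)])
    moreover have "integral (cbox l h) (f2 0) = integral (cbox l h) (\<lambda>u. sqrt (W u) * ((b0 u)\<^sup>2 / c u - 2 * e u))"
      by (rule integral_cong) (rule zero)
    ultimately show "((\<lambda>s. integral (cbox l h) (f1 s)) has_real_derivative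
        integral (cbox l h) (\<lambda>u. sqrt (W u) * ((b0 u)\<^sup>2 / c u - 2 * e u))) (at 0)"
      by simp
  qed
qed

lemma C2_on_real_deriv:
  fixes G :: "real \<Rightarrow> real"
  assumes "C2_on I G"
  shows "t \<in> I \<Longrightarrow> (G has_real_derivative deriv G t) (at t)" "continuous_on I (deriv G)"
proof -
  show 1: "(G has_real_derivative deriv G t) (at t)" if "t \<in> I" for t
    using C2_on_differentiable[OF assms that] DERIV_deriv_iff_real_differentiable by blast
  have "continuous_on I (\<lambda>t. dif G t 1)"
    by (rule C1_on_continuous[OF C1_on_frechet[OF assms]])
  then show "continuous_on I (deriv G)"
  proof (rule continuous_on_eq)
    fix t assume "t \<in> I"
    have "dif G t = (*) (deriv G t)"
      using frechet_derivative_at[OF 1[OF \<open>t \<in> I\<close>, unfolded has_field_derivative_def]] by simp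
    then show "dif G t 1 = deriv G t" by simp
  qed
qed

text \<open>Only the first normal form of a strip is assumed; the second one is a quarter turn away,
  see \<open>rotated_strip\<close>.\<close>

locale strip =
  fixes I :: "real set" and G :: "real \<Rightarrow> real" and b :: "real^3" and \<theta> :: real and S :: "(real^3) set"
  assumes I: "open I" "is_interval I" and G: "C2_on I G"
    and G'_nonneg: "\<And>t. t \<in> I \<Longrightarrow> 0 \<le> deriv G t"
    and S_image: "heis_iso b \<theta> ` S = {p. p $ 3 \<in> I \<and> p $ 1 = p $ 2 * G (p $ 3)}"
begin

definition D :: "(real^2) set" where "D = {u. u $ 2 \<in> I}"

definition to_model :: "real^3 \<Rightarrow> real^3" where "to_model = heis_iso b \<theta>"

definition from_model :: "real^3 \<Rightarrow> real^3" where
  "from_model = heis_iso (rotation_t (- \<theta>) (- b)) (- \<theta>)"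

definition from_model_linear :: "real^3 \<Rightarrow> real^3" where
  "from_model_linear = iso_linear (rotation_t (- \<theta>) (- b)) (- \<theta>)"

text \<open>Defined on all of space rather than as the inverse of \<open>param\<close>, so that it
  extends functions of the parameters off \<open>S\<close> and can be applied to points of displaced
  strips.\<close>

definition proj :: "real^3 \<Rightarrow> real^2" where "proj p = vector [to_model p $ 2, to_model p $ 3]"

text \<open>The strip moved by \<open>s a (X1 - G X2)\<close>; since \<open>X1 - G X2\<close> has length \<open>sqrt (1 + G\<^sup>2)\<close>, this is the
  variation along the horizontal normal with the function \<open>a sqrt (1 + G\<^sup>2)\<close>.\<close>

definition model :: "(real^2 \<Rightarrow> real) \<Rightarrow> real \<Rightarrow> real^2 \<Rightarrow> real^3" where
  "model a s u = vector [u $ 1 * G (u $ 2) + s * a u, u $ 1 - s * (a u * G (u $ 2)),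
     u $ 2 - s * (a u * u $ 1 * (1 + (G (u $ 2))\<^sup>2)) / 2]"

definition chart :: "(real^2 \<Rightarrow> real) \<Rightarrow> real \<Rightarrow> real^2 \<Rightarrow> real^3" where
  "chart a s u = from_model (model a s u)"

definition param :: "real^2 \<Rightarrow> real^3" where "param = chart (\<lambda>_. 0) 0"

lemma to_from [simp]: "to_model (from_model p) = p" "from_model (to_model p) = p"
  by (simp_all add: to_model_def from_model_def iso_inverse)

lemma mem_S_iff: "p \<in> S \<longleftrightarrow> to_model p $ 3 \<in> I \<and> to_model p $ 1 = to_model p $ 2 * G (to_model p $ 3)"
proof -
  have "p \<in> S \<longleftrightarrow> to_model p \<in> to_model ` S"
    by (metis imageE imageI to_from(2))
  then show ?thesis
    using S_image by (simp add: to_model_def)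
qed

lemma open_D: "open D"
proof -
  have "open ((\<lambda>u::real^2. u $ 2) -` I)"
    by (rule open_vimage[OF I(1)]) (intro continuous_intros)
  then show ?thesis by (simp add: D_def vimage_def)
qed

lemma convex_D: "convex D"
proof -
  have "convex ((\<lambda>u::real^2. u $ 2) -` I)"
    using I(2) is_interval_convex by (intro convex_linear_vimage) (auto intro: linearI)
  then show ?thesis by (simp add: D_def vimage_def)
qed

lemma G_deriv: "t \<in> I \<Longrightarrow> (G has_real_derivative deriv G t) (at t)"
  and continuous_deriv_G: "continuous_on I (deriv G)"
  using C2_on_real_deriv[OF G] by auto

lemma C2_on_G: "C2_on D (\<lambda>u. G (u $ 2))"
  by (rule C2_on_compose[OF G C2_on_nth[OF open_D]]) (auto simp: D_def)

lemma continuous_on_G: "continuous_on D (\<lambda>u. G (u $ 2))"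
  by (rule C2_on_continuous[OF C2_on_G])

lemma continuous_on_G': "continuous_on D (\<lambda>u. deriv G (u $ 2))"
  by (rule continuous_on_compose2[OF continuous_deriv_G]) (auto simp: D_def intro!: continuous_intros)

lemma C2_on_model:
  assumes "C2_on D a"
  shows "C2_on D (model a s)"
  unfolding model_def[abs_def] divide_inverse power2_eq_square
  by (intro C2_on_vector_3 C2_on_add C2_on_diff C2_on_mult C2_on_const C2_on_nth C2_on_G open_D assms)

lemma C2_on_chart:
  assumes "C2_on D a"
  shows "C2_on D (chart a s)"
  unfolding chart_def[abs_def] from_model_def
  by (rule C2_on_compose[OF C2_on_iso[OF open_UNIV] C2_on_model[OF assms]]) simp

lemma proj_chart: "proj (chart a s u) = u - s *\<^sub>R vector [a u * G (u $ 2), a u * u $ 1 * (1 + (G (u $ 2))\<^sup>2) / 2]"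
  by (simp add: proj_def chart_def model_def vec_eq_iff forall_2)

lemma proj_param [simp]: "proj (param u) = u"
  by (simp add: param_def proj_chart)

lemma param_proj: "g \<in> S \<Longrightarrow> param (proj g) = g"
proof -
  assume "g \<in> S"
  then have "model (\<lambda>_. 0) 0 (proj g) = to_model g"
    by (simp add: mem_S_iff model_def proj_def vec_eq_iff forall_3)
  then show ?thesis
    by (simp add: param_def chart_def)
qed

lemma param_in_S: "param u \<in> S \<longleftrightarrow> u \<in> D"
  by (simp add: mem_S_iff param_def chart_def model_def D_def)

lemma proj_in_D: "g \<in> S \<Longrightarrow> proj g \<in> D"
  by (simp add: mem_S_iff proj_def D_def)

lemma param_image: "param ` D = S"
  using param_in_S param_proj proj_in_D by (metis image_iff subsetI subset_antisym)

lemma C2_on_proj: "open U \<Longrightarrow> C2_on U proj"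
  unfolding proj_def[abs_def] to_model_def
  by (intro C2_on_vector_2 C2_on_nth_compose C2_on_iso)

lemma continuous_on_proj: "continuous_on X proj"
  using C2_on_continuous[OF C2_on_proj[OF open_UNIV]] by (rule continuous_on_subset) simp

lemma frechet_model:
  assumes a: "C2_on D a" and u: "u \<in> D"
  defines "y \<equiv> u $ 1" and "g \<equiv> G (u $ 2)" and "g' \<equiv> deriv G (u $ 2)" and "a' \<equiv> dif a u"
  shows "dif (model a s) u h = vector [g * h $ 1 + y * g' * h $ 2 + s * a' h,
     h $ 1 - s * (a' h * g + a u * g' * h $ 2),
     h $ 2 - (s / 2) * (a' h * y * (1 + g\<^sup>2) + a u * (1 + g\<^sup>2) * h $ 1 + 2 * a u * y * g * g' * h $ 2)]"
proof -
  have da: "(a has_derivative a') (at u)"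
    unfolding a'_def by (rule C2_on_frechet_works[OF a u])
  have n: "((\<lambda>u::real^2. u $ i) has_derivative (\<lambda>h. h $ i)) (at u)" for i
    by (rule bounded_linear_imp_has_derivative[OF bounded_linear_vec_nth])
  have "(G has_derivative (\<lambda>h. g' * h)) (at (u $ 2))"
    using G_deriv[of "u $ 2"] u by (simp add: D_def g'_def has_field_derivative_def)
  from has_derivative_compose[OF n[of 2] this]
  have dG: "((\<lambda>u. G (u $ 2)) has_derivative (\<lambda>h. g' * h $ 2)) (at u)"
    by simp
  have "(model a s has_derivative (\<lambda>h. vector [
      (y * (g' * h $ 2) + h $ 1 * g) + s * a' h,
      h $ 1 - s * (a u * (g' * h $ 2) + a' h * g),
      h $ 2 - s * (a u * y * (0 + (g * (g' * h $ 2) + (g' * h $ 2) * g)) + (a u * h $ 1 + a' h * y) * (1 + g * g)) / 2])) (at u)"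
    unfolding model_def[abs_def] power2_eq_square y_def g_def
    by (intro has_derivative_vector_3 has_derivative_add has_derivative_diff has_derivative_mult_right
        has_derivative_divide has_derivative_mult[OF n dG] has_derivative_mult[OF da dG] n dG da has_derivative_const)
      (auto intro!: derivative_eq_intros n dG da)
  then have "dif (model a s) u = (\<lambda>h. vector [
      (y * (g' * h $ 2) + h $ 1 * g) + s * a' h,
      h $ 1 - s * (a u * (g' * h $ 2) + a' h * g),
      h $ 2 - s * (a u * y * (0 + (g * (g' * h $ 2) + (g' * h $ 2) * g)) + (a u * h $ 1 + a' h * y) * (1 + g * g)) / 2])"
    by (rule frechet_derivative_at[symmetric])
  then show ?thesis
    by (simp add: vec_eq_iff forall_3 power2_eq_square algebra_simps add_divide_distrib diff_divide_distrib)
qed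

end

locale strip_variation = strip +
  fixes a :: "real^2 \<Rightarrow> real" and l h :: "real^2"
  assumes a: "C2_on D a" and box: "cbox l h \<subseteq> D" and a_outside: "\<And>u. u \<notin> cbox l h \<Longrightarrow> a u = 0"
begin

text \<open>\<open>Wt\<close>, \<open>ct\<close>, \<open>et\<close>, \<open>b0\<close>, \<open>b1\<close>, \<open>b2\<close> are the coefficients of the horizontal area of \<open>chart a s\<close>, the
  square root of a polynomial in \<open>s\<close>.\<close>

definition a1 :: "real^2 \<Rightarrow> real" where "a1 u = dif a u (axis 1 1)"
definition a2 :: "real^2 \<Rightarrow> real" where "a2 u = dif a u (axis 2 1)"
definition Wt :: "real^2 \<Rightarrow> real" where "Wt u = 1 + (G (u $ 2))\<^sup>2"
definition ct :: "real^2 \<Rightarrow> real" where "ct u = 1 + deriv G (u $ 2) * (u $ 1)\<^sup>2 / 2"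
definition et :: "real^2 \<Rightarrow> real" where "et u = (a u)\<^sup>2 * deriv G (u $ 2) / 2"
definition b0 :: "real^2 \<Rightarrow> real" where "b0 u = a1 u * ct u + a u * u $ 1 * deriv G (u $ 2)"
definition b1 :: "real^2 \<Rightarrow> real" where "b1 u = a u * (Wt u * a2 u + a u * G (u $ 2) * deriv G (u $ 2)) - a1 u * (a u * u $ 1 * G (u $ 2) * deriv G (u $ 2))"
definition b2 :: "real^2 \<Rightarrow> real" where "b2 u = a1 u * et u"

definition density_at :: "real \<Rightarrow> real^2 \<Rightarrow> real" where
  "density_at s u = sqrt (Wt u * ((ct u - s\<^sup>2 * et u)\<^sup>2 + (s * (b0 u + s * b1 u + s\<^sup>2 * b2 u))\<^sup>2))"

text \<open>Isometry invariance moves the computation to the model. There the values of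
  \<open>a\<close>, \<open>G\<close> and their derivatives at \<open>u\<close> behave as independent
  numbers, and \<open>strip_normal_identity\<close> finishes.\<close>

lemma hnorm_chart:
  assumes "u \<in> D"
  shows "hnorm (chart a s) u = density_at s u"
proof -
  let ?x = "u $ 1 * G (u $ 2) + s * a u" and ?z = "u $ 1 - s * a u * G (u $ 2)"
  let ?g = "deriv G (u $ 2)"
  have f: "dif (model a s) u (axis 1 1)
      = vector [G (u $ 2) + s * a1 u, 1 - s * a1 u * G (u $ 2), - (s / 2) * (a1 u * u $ 1 * Wt u + a u * Wt u)]"
    "dif (model a s) u (axis 2 1)
      = vector [u $ 1 * ?g + s * a2 u, - s * (a2 u * G (u $ 2) + a u * ?g),
          1 - (s / 2) * (a2 u * u $ 1 * Wt u + 2 * a u * u $ 1 * G (u $ 2) * ?g)]"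
    unfolding frechet_model[OF a assms] by (simp_all add: axis_def a1_def a2_def Wt_def vec_eq_iff forall_3)
  have m: "model a s u = vector [?x, ?z, u $ 2 - s * (a u * u $ 1 * Wt u) / 2]"
    by (simp add: model_def Wt_def mult.assoc)
  define A where "A = (1 - s * a1 u * G (u $ 2)) * (1 - (s / 2) * (a2 u * u $ 1 * Wt u + 2 * a u * u $ 1 * G (u $ 2) * ?g))
        - (- (s / 2) * (a1 u * u $ 1 * Wt u + a u * Wt u)) * (- s * (a2 u * G (u $ 2) + a u * ?g))"
  define B where "B = (- (s / 2) * (a1 u * u $ 1 * Wt u + a u * Wt u)) * (u $ 1 * ?g + s * a2 u)
        - (G (u $ 2) + s * a1 u) * (1 - (s / 2) * (a2 u * u $ 1 * Wt u + 2 * a u * u $ 1 * G (u $ 2) * ?g))"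
  define C where "C = (G (u $ 2) + s * a1 u) * (- s * (a2 u * G (u $ 2) + a u * ?g))
        - (1 - s * a1 u * G (u $ 2)) * (u $ 1 * ?g + s * a2 u)"
  have "normal (model a s) u = vector [A, B, C]"
    unfolding normal_def f cross3_def vector_3 A_def B_def C_def by (simp only: mult.commute)
  then have "normal (model a s) u \<bullet> X1 (model a s u) = A - ?z / 2 * C"
    "normal (model a s) u \<bullet> X2 (model a s u) = B + ?x / 2 * C"
    by (simp_all add: X1_def X2_def m inner_vec_def sum_3)
  moreover have "(A - ?z / 2 * C)\<^sup>2 + (B + ?x / 2 * C)\<^sup>2
    = Wt u * ((1 + ?g * (u $ 1)\<^sup>2 / 2 - s\<^sup>2 * ((a u)\<^sup>2 * ?g / 2))\<^sup>2
        + (s * (a1 u * (1 + (u $ 1)\<^sup>2 * ?g / 2 - s * a u * u $ 1 * G (u $ 2) * ?g + s\<^sup>2 * (a u)\<^sup>2 * ?g / 2)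
          + a u * u $ 1 * ?g + s * a u * (Wt u * a2 u + a u * G (u $ 2) * ?g)))\<^sup>2)"
    unfolding A_def B_def C_def Wt_def by (rule strip_normal_identity)
  moreover have "a1 u * (1 + (u $ 1)\<^sup>2 * ?g / 2 - s * a u * u $ 1 * G (u $ 2) * ?g + s\<^sup>2 * (a u)\<^sup>2 * ?g / 2)
          + a u * u $ 1 * ?g + s * a u * (Wt u * a2 u + a u * G (u $ 2) * ?g) = b0 u + s * b1 u + s\<^sup>2 * b2 u"
    by (simp add: ct_def et_def b0_def b1_def b2_def algebra_simps)
  ultimately have "(normal (model a s) u \<bullet> X1 (model a s u))\<^sup>2 + (normal (model a s) u \<bullet> X2 (model a s u))\<^sup>2
    = Wt u * ((ct u - s\<^sup>2 * et u)\<^sup>2 + (s * (b0 u + s * b1 u + s\<^sup>2 * b2 u))\<^sup>2)"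
    by (simp only: ct_def et_def)
  then have "hnorm (model a s) u = density_at s u"
    by (simp add: hnorm_def density_at_def)
  moreover have "hnorm (chart a s) u = hnorm (model a s) u"
    unfolding chart_def[abs_def] from_model_def
    by (rule hnorm_iso[OF C2_on_differentiable[OF C2_on_model[OF a] assms]])
  ultimately show ?thesis by simp
qed

end

lemma compact_imp_integrable_on:
  fixes f :: "'a::euclidean_space \<Rightarrow> real"
  assumes "compact K" "continuous_on K f"
  shows "f integrable_on K"
  using set_borel_integral_eq_integral(1)[of K f] borel_integrable_compact[OF assms]
  by (simp add: set_integrable_def)

section \<open>The variation field and test functions on the strip itself\<close>

context strip
begin

text \<open>\<open>frame1\<close> and \<open>frame2\<close> are the coefficients of the model
  direction \<open>X1 - G X2\<close> in the horizontal frame at a point of \<open>S\<close>, after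
  the rotation by \<open>- \<theta>\<close>.\<close>

definition frame1 :: "real^2 \<Rightarrow> real" where "frame1 u = cos \<theta> - G (u $ 2) * sin \<theta>"
definition frame2 :: "real^2 \<Rightarrow> real" where "frame2 u = - sin \<theta> - G (u $ 2) * cos \<theta>"

lemma frame_norm: "(frame1 u)\<^sup>2 + (frame2 u)\<^sup>2 = 1 + (G (u $ 2))\<^sup>2"
  using cos_sin_sum[of 1 \<theta>] cos_sin_sum[of "(G (u $ 2))\<^sup>2" \<theta>]
  by (simp add: frame1_def frame2_def power2_eq_square algebra_simps)

lemma C2_on_frame: "C2_on D frame1" "C2_on D frame2"
  unfolding frame1_def[abs_def] frame2_def[abs_def]
  by (intro C2_on_diff C2_on_mult C2_on_const C2_on_G open_D)+

text \<open>In the model the last component of \<open>X1 - G X2\<close> on the strip is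
  \<open>- y (1 + G^2) / 2\<close>, as in \<open>model\<close>; the inverse isometry is affine and
  transports the whole displacement.\<close>

lemma displaced_model: "g \<in> S \<Longrightarrow>
  g + (s * a (proj g)) *\<^sub>R (frame1 (proj g) *\<^sub>R X1 g + frame2 (proj g) *\<^sub>R X2 g) = chart a s (proj g)"
proof -
  assume g: "g \<in> S"
  define u m where "u = proj g" and "m = to_model g"
  have g_eq: "g = from_model m"
    by (simp add: m_def)
  have m: "m = model (\<lambda>_. 0) 0 u"
  proof -
    have "to_model (param (proj g)) = model (\<lambda>_. 0) 0 (proj g)"
      by (simp add: param_def chart_def)
    then show ?thesis
      unfolding param_proj[OF g] m_def u_def .
  qed
  have "model a s u = m + (s * a u) *\<^sub>R (X1 m - G (u $ 2) *\<^sub>R X2 m)"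
    unfolding m by (simp add: model_def X1_def X2_def vec_eq_iff forall_3 power2_eq_square algebra_simps add_divide_distrib diff_divide_distrib)
  then have "chart a s u = from_model m + from_model_linear ((s * a u) *\<^sub>R (X1 m - G (u $ 2) *\<^sub>R X2 m))"
    by (simp add: chart_def from_model_def from_model_linear_def iso_add)
  also have "\<dots> = g + (s * a u) *\<^sub>R (from_model_linear (X1 m) - G (u $ 2) *\<^sub>R from_model_linear (X2 m))"
    unfolding g_eq[symmetric] from_model_linear_def
    by (simp add: linear_scale[OF linear_iso_linear] linear_diff[OF linear_iso_linear])
  also have "from_model_linear (X1 m) - G (u $ 2) *\<^sub>R from_model_linear (X2 m) = frame1 u *\<^sub>R X1 g + frame2 u *\<^sub>R X2 g"
    unfolding from_model_linear_def iso_linear_X1 iso_linear_X2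
    by (simp add: g_eq from_model_def frame1_def frame2_def algebra_simps)
  finally show ?thesis by (simp add: u_def)
qed

text \<open>Composition with \<open>proj\<close> is the required C2 extension to an open set, and
  the image of the box under \<open>param\<close> is the required compact set.\<close>

lemma C2_0_I:
  assumes f: "C2_on D f" "cbox l h \<subseteq> D" "\<And>u. u \<notin> cbox l h \<Longrightarrow> f u = 0"
  shows "(\<lambda>g. if g \<in> S then f (proj g) else 0) \<in> C2_0 S"
proof -
  define U where "U = proj -` D"
  have U: "open U"
    unfolding U_def by (rule open_vimage[OF open_D continuous_on_proj])
  have "C2_on U (\<lambda>g. f (proj g))"
    by (rule C2_on_compose[OF f(1) C2_on_proj[OF U]]) (auto simp: U_def)
  moreover have "S \<subseteq> U"
    using proj_in_D by (auto simp: U_def)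
  moreover have "compact (param ` cbox l h)"
  proof (rule compact_continuous_image)
    show "continuous_on (cbox l h) param"
      unfolding param_def
      by (rule continuous_on_subset[OF C2_on_continuous[OF C2_on_chart[OF C2_on_const[OF open_D]]] f(2)])
  qed simp
  moreover have "param ` cbox l h \<subseteq> S"
    using f(2) param_image by blast
  moreover have "f (proj g) = 0" if g: "g \<in> S - param ` cbox l h" for g
  proof (rule f(3))
    show "proj g \<notin> cbox l h"
    proof
      assume "proj g \<in> cbox l h"
      then have "param (proj g) \<in> param ` cbox l h" by (rule imageI)
      then show False using g param_proj by simp
    qed
  qed
  ultimately show ?thesis
    unfolding C2_0_def mem_Collect_eq
  proof (intro conjI allI impI ballI)
    fix g assume "C2_on U (\<lambda>g. f (proj g))" "S \<subseteq> U" "g \<in> S"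
    then show "\<exists>U F. g \<in> U \<and> C2_on U F \<and> (\<forall>x\<in>S \<inter> U. (if x \<in> S then f (proj x) else 0) = F x)"
      by (intro exI[of _ U] exI[of _ "\<lambda>g. f (proj g)"]) auto
  next
    assume "compact (param ` cbox l h)" "param ` cbox l h \<subseteq> S"
      "\<And>g. g \<in> S - param ` cbox l h \<Longrightarrow> f (proj g) = 0"
    then show "\<exists>K. compact K \<and> K \<subseteq> S \<and> (\<forall>g\<in>S - K. (if g \<in> S then f (proj g) else 0) = 0)"
      by (intro exI[of _ "param ` cbox l h"]) auto
  qed auto
qed

end

section \<open>Displaced strips as embedded surfaces, and the second variation formula\<close>

context strip_variation
begin

definition field :: "real^3 \<Rightarrow> real^3" where
  "field g = (if g \<in> S then a (proj g) *\<^sub>R (frame1 (proj g) *\<^sub>R X1 g + frame2 (proj g) *\<^sub>R X2 g) else 0)"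

lemma displace_field: "g \<in> S \<Longrightarrow> displace field s g = chart a s (proj g)"
  using displaced_model[of g s a] by (simp add: displace_def field_def)

lemma displace_field_param: "u \<in> D \<Longrightarrow> displace field s (param u) = chart a s u"
  using displace_field[of "param u" s] param_in_S by simp

lemma field_variation: "field \<in> variation_fields S"
proof -
  define f1 f2 where "f1 g = (if g \<in> S then a (proj g) * frame1 (proj g) else 0)"
    and "f2 g = (if g \<in> S then a (proj g) * frame2 (proj g) else 0)" for g
  define f3 :: "real^3 \<Rightarrow> real" where "f3 g = (if g \<in> S then (\<lambda>_. 0) (proj g) else 0)" for g
  have "f1 \<in> C2_0 S" "f2 \<in> C2_0 S" "f3 \<in> C2_0 S"
    unfolding f1_def[abs_def] f2_def[abs_def] f3_def[abs_def]
    using C2_0_I[OF C2_on_mult[OF a C2_on_frame(1)] box] C2_0_I[OF C2_on_mult[OF a C2_on_frame(2)] box]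
      C2_0_I[OF C2_on_const[OF open_D] box, of 0] a_outside by simp_all
  moreover have "field = (\<lambda>g. f1 g *\<^sub>R X1 g + f2 g *\<^sub>R X2 g + f3 g *\<^sub>R T g)"
    by (auto simp: field_def f1_def f2_def f3_def fun_eq_iff algebra_simps)
  ultimately show ?thesis
    unfolding variation_fields_def by blast
qed

lemma continuous_on_coeffs:
  "continuous_on D a" "continuous_on D a1" "continuous_on D a2" "continuous_on D Wt"
  "continuous_on D ct" "continuous_on D et" "continuous_on D b0" "continuous_on D b1" "continuous_on D b2"
proof -
  show 1: "continuous_on D a" by (rule C2_on_continuous[OF a])
  show 2: "continuous_on D a1" "continuous_on D a2"
    unfolding a1_def[abs_def] a2_def[abs_def] by (intro C1_on_continuous C1_on_frechet a)+
  show 3: "continuous_on D Wt" "continuous_on D ct" "continuous_on D et"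
    unfolding Wt_def[abs_def] ct_def[abs_def] et_def[abs_def]
    by (intro continuous_intros continuous_on_G continuous_on_G' 1; simp)+
  show "continuous_on D b0" "continuous_on D b1" "continuous_on D b2"
    unfolding b0_def[abs_def] b1_def[abs_def] b2_def[abs_def]
    by (intro continuous_intros continuous_on_G continuous_on_G' 1 2 3)+
qed

lemma continuous_on_density: "continuous_on D (density_at s)"
  unfolding density_at_def[abs_def] by (intro continuous_intros continuous_on_coeffs)

lemma ct_ge_1: "u \<in> D \<Longrightarrow> 1 \<le> ct u"
  using G'_nonneg by (simp add: ct_def D_def)

lemma Wt_pos: "0 < Wt u"
  unfolding Wt_def by (simp add: add_pos_nonneg)

text \<open>Vanishing of \<open>a\<close> near the point, not merely at it, is required: the partial
  derivative \<open>a1\<close> enters \<open>b0\<close>.\<close>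

lemma density_const:
  assumes "open N" "u \<in> N" "\<And>v. v \<in> N \<Longrightarrow> a v = 0"
  shows "density_at s u = density_at 0 u"
proof -
  have "(a has_derivative (\<lambda>_. 0)) (at u)"
    by (rule has_derivative_transform_within_open[OF has_derivative_const[of 0] assms(1,2)]) (simp add: assms(3))
  from frechet_derivative_at[OF this, symmetric] assms(2,3) show ?thesis
    by (simp add: density_at_def et_def b0_def b1_def b2_def a1_def)
qed

text \<open>The drift of the parameters: seen through \<open>proj\<close>, the displaced chart is
  the identity minus \<open>s\<close> times this compactly supported map.\<close>

definition disp :: "real^2 \<Rightarrow> real^2" where
  "disp u = vector [a u * G (u $ 2), a u * u $ 1 * (1 + (G (u $ 2))\<^sup>2) / 2]"

lemma proj_chart_disp: "proj (chart a s u) = u - s *\<^sub>R disp u"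
  by (simp add: proj_chart disp_def)

text \<open>The derivative is bounded on the compact box and zero off it, where \<open>disp\<close>
  vanishes locally; convexity of \<open>D\<close> turns the bound into a Lipschitz estimate.\<close>

lemma disp_lipschitz: obtains L where "0 \<le> L" "\<And>u v. u \<in> D \<Longrightarrow> v \<in> D \<Longrightarrow> norm (disp u - disp v) \<le> L * norm (u - v)"
proof -
  have "C2_on D disp"
    unfolding disp_def[abs_def] divide_inverse power2_eq_square
    by (intro C2_on_vector_2 C2_on_add C2_on_mult C2_on_const C2_on_nth C2_on_G open_D a)
  then obtain f' where f': "\<And>x. x \<in> D \<Longrightarrow> (disp has_derivative blinfun_apply (f' x)) (at x)" "C1_on D f'"
    unfolding C2_on_iff by blast
  have "compact (f' ` cbox l h)"
    by (intro compact_continuous_image continuous_on_subset[OF C1_on_continuous[OF f'(2)] box]) simp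
  then have "bounded (f' ` cbox l h)" by (rule compact_imp_bounded)
  then obtain L where L: "0 < L" "\<And>u. u \<in> cbox l h \<Longrightarrow> norm (f' u) \<le> L"
    unfolding bounded_pos by blast
  have "norm (f' u) \<le> L" if "u \<in> D" for u
  proof (cases "u \<in> cbox l h")
    case False
    have "open (D - cbox l h)" using open_D by (intro open_Diff) auto
    then have "(disp has_derivative (\<lambda>_. 0)) (at u)"
      by (rule has_derivative_transform_within_open[OF has_derivative_const[of 0]])
        (use that False in \<open>auto simp: disp_def a_outside vec_eq_iff forall_2\<close>)
    from has_derivative_unique[OF f'(1)[OF that] this] have "f' u = 0"
      by (intro blinfun_eqI) simp
    then show ?thesis using L by simp
  qed (use L in auto)
  then have "norm (disp u - disp v) \<le> L * norm (u - v)" if "u \<in> D" "v \<in> D" for u v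
    using that by (intro differentiable_bound[OF convex_D has_derivative_at_withinI[OF f'(1)]])
      (auto simp: norm_blinfun.rep_eq)
  then show ?thesis
    using L(1) by (intro that[of L]) auto
qed

text \<open>The first condition keeps the horizontal density positive, so the displaced chart is an
  immersion. The second makes it injective with continuous inverse. Together they give a global
  chart of the displaced strip.\<close>

definition admissible :: "real \<Rightarrow> bool" where
  "admissible s \<longleftrightarrow> (\<forall>u\<in>D. 0 < ct u - s\<^sup>2 * et u) \<and>
     (\<forall>u\<in>D. \<forall>v\<in>D. norm (u - v) \<le> 2 * norm (proj (chart a s u) - proj (chart a s v)))"

lemma admissible_small: obtains d where "0 < d" "\<And>s. \<bar>s\<bar> < d \<Longrightarrow> admissible s"
proof -
  obtain L where L: "0 \<le> L" "\<And>u v. u \<in> D \<Longrightarrow> v \<in> D \<Longrightarrow> norm (disp u - disp v) \<le> L * norm (u - v)"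
    by (rule disp_lipschitz) (rule that)
  have "compact (et ` cbox l h)"
    by (intro compact_continuous_image continuous_on_subset[OF continuous_on_coeffs(6) box]) simp
  then have "bounded (et ` cbox l h)" by (rule compact_imp_bounded)
  then obtain M where M: "0 < M" "\<And>u. u \<in> cbox l h \<Longrightarrow> \<bar>et u\<bar> \<le> M"
    unfolding bounded_pos by auto
  \<comment> \<open>The entries ensure in turn \<open>s^2 <= |s|\<close>,
    \<open>|s| M < 1 <= ct\<close> on the box, and \<open>|s| L <= 1/2\<close>, so that the drift
    absorbs at most half of \<open>norm (u - v)\<close>.\<close>
  define d where "d = min 1 (min (1 / M) (1 / (2 * (L + 1))))"
  have "0 < d" using M(1) L(1) by (simp add: d_def)
  moreover have "admissible s" if s: "\<bar>s\<bar> < d" for s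
    unfolding admissible_def
  proof (intro conjI ballI)
    have s1: "\<bar>s\<bar> < 1" "\<bar>s\<bar> < 1 / M" "\<bar>s\<bar> < 1 / (2 * (L + 1))"
      using s by (simp_all add: d_def)
    fix u assume u: "u \<in> D"
    show "0 < ct u - s\<^sup>2 * et u"
    proof (cases "u \<in> cbox l h")
      case True
      have le: "s\<^sup>2 \<le> \<bar>s\<bar>"
        using mult_left_mono[of "\<bar>s\<bar>" 1 "\<bar>s\<bar>"] s1 by (simp add: power2_eq_square)
      have "s\<^sup>2 * et u \<le> s\<^sup>2 * M"
        using M(2)[OF True] by (intro mult_left_mono) auto
      also have "\<dots> \<le> \<bar>s\<bar> * M"
        by (rule mult_right_mono[OF le]) (use M(1) in simp)
      also have "\<dots> < 1"
        using s1 M(1) by (simp add: pos_less_divide_eq)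
      finally show ?thesis using ct_ge_1[OF u] by simp
    next
      case False
      then show ?thesis using ct_ge_1[OF u] by (simp add: et_def a_outside)
    qed
    fix v assume v: "v \<in> D"
    have "proj (chart a s u) - proj (chart a s v) = (u - v) - s *\<^sub>R (disp u - disp v)"
      by (simp add: proj_chart_disp scaleR_diff_right)
    then have "norm (u - v) \<le> norm (proj (chart a s u) - proj (chart a s v)) + \<bar>s\<bar> * norm (disp u - disp v)"
      using norm_triangle_ineq[of "proj (chart a s u) - proj (chart a s v)" "s *\<^sub>R (disp u - disp v)"] by simp
    moreover have "\<bar>s\<bar> * norm (disp u - disp v) \<le> norm (u - v) / 2"
    proof -
      have "\<bar>s\<bar> * (L + 1) \<le> 1 / 2"
        using s1 L(1) by (simp add: pos_less_divide_eq algebra_simps)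
      then have sL: "\<bar>s\<bar> * L \<le> 1 / 2"
        by (simp add: algebra_simps)
      have "\<bar>s\<bar> * norm (disp u - disp v) \<le> \<bar>s\<bar> * (L * norm (u - v))"
        by (intro mult_left_mono L(2) u v) simp
      also have "\<dots> \<le> 1 / 2 * norm (u - v)"
        unfolding mult.assoc[symmetric] by (intro mult_right_mono sL) simp
      finally show ?thesis by simp
    qed
    ultimately show "norm (u - v) \<le> 2 * norm (proj (chart a s u) - proj (chart a s v))"
      by simp
  qed
  ultimately show ?thesis using that by blast
qed

lemma density_pos:
  assumes "admissible s" "u \<in> D"
  shows "0 < density_at s u"
proof -
  have "0 < ct u - s\<^sup>2 * et u" using assms by (simp add: admissible_def)
  then show ?thesis
    by (simp add: density_at_def Wt_pos add_pos_nonneg)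
qed

text \<open>The lower bound in \<open>admissible\<close> gives injectivity; with continuity of
  \<open>proj\<close> it also gives continuity of the inverse.\<close>

lemma chart_homeomorphism:
  assumes "admissible s"
  obtains H where "homeomorphism D (chart a s ` D) (chart a s) H"
proof
  have le: "norm (u - v) \<le> 2 * norm (proj (chart a s u) - proj (chart a s v))" if "u \<in> D" "v \<in> D" for u v
    using assms that by (simp add: admissible_def)
  have inj: "inj_on (chart a s) D"
  proof (rule inj_onI)
    fix u v assume "u \<in> D" "v \<in> D" "chart a s u = chart a s v"
    then show "u = v" using le[of u v] by simp
  qed
  let ?H = "the_inv_into D (chart a s)"
  have inv: "?H (chart a s u) = u" if "u \<in> D" for u
    by (rule the_inv_into_f_f[OF inj that])
  show "homeomorphism D (chart a s ` D) (chart a s) ?H"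
  proof (rule homeomorphismI)
    show "continuous_on D (chart a s)"
      by (rule C2_on_continuous[OF C2_on_chart[OF a]])
    show "continuous_on (chart a s ` D) ?H"
      unfolding continuous_on_iff
    proof (intro ballI allI impI)
      fix x e assume x: "x \<in> chart a s ` D" and e: "0 < (e::real)"
      obtain \<delta> where \<delta>: "0 < \<delta>" "\<And>y. dist y x < \<delta> \<Longrightarrow> dist (proj y) (proj x) < e / 2"
        using continuous_on_proj[of UNIV, unfolded continuous_on_iff, rule_format, of x "e / 2"] e by auto
      have "dist (?H y) (?H x) < e" if y: "y \<in> chart a s ` D" "dist y x < \<delta>" for y
      proof -
        obtain u v where "u \<in> D" "v \<in> D" "x = chart a s u" "y = chart a s v"
          using x y(1) by blast
        then show ?thesis
          using le[of v u] \<delta>(2)[OF y(2)] by (simp add: inv dist_norm)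
      qed
      then show "\<exists>d>0. \<forall>x'\<in>chart a s ` D. dist x' x < d \<longrightarrow> dist (?H x') (?H x) < e"
        using \<delta>(1) by blast
    qed
  qed (auto simp: inv)
qed

text \<open>A vanishing normal would have vanishing horizontal part, against positivity of the
  density.\<close>

lemma local_param_chart:
  assumes "admissible s"
  shows "local_param (chart a s ` D) D (chart a s)"
proof -
  have "area_element (chart a s) u \<noteq> 0" if "u \<in> D" for u
  proof
    assume "area_element (chart a s) u = 0"
    then have "normal (chart a s) u = 0" by (simp add: area_element_eq_norm)
    then have "hnorm (chart a s) u = 0" by (simp add: hnorm_def)
    then show False using density_pos[OF assms that] by (simp add: hnorm_chart[OF that])
  qed
  then show ?thesis
    unfolding local_param_def
  proof (intro conjI ballI)
    obtain H where "homeomorphism D (chart a s ` D) (chart a s) H"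
      by (rule chart_homeomorphism[OF assms]) (rule that)
    then show "\<exists>H. homeomorphism D (chart a s ` D) (chart a s) H" by (intro exI[of _ H])
  qed (simp_all add: open_D C2_on_chart[OF a])
qed

lemma perimeter_chart:
  assumes s: "admissible s" and K: "compact K" "K \<subseteq> D"
  shows "measure (H_perimeter_measure (chart a s ` D)) (chart a s ` K) = integral K (density_at s)"
proof -
  obtain H where H: "homeomorphism D (chart a s ` D) (chart a s) H"
    by (rule chart_homeomorphism[OF s])
  have "measure (H_perimeter_measure (chart a s ` D)) (chart a s ` K) = integral K (hnorm (chart a s))"
    by (rule H_perimeter_measure_image[OF local_param_chart[OF s] refl H K])
  also have "\<dots> = integral K (density_at s)"
    by (rule integral_cong) (use K(2) in \<open>auto simp: hnorm_chart\<close>)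
  finally show ?thesis .
qed

text \<open>\<open>K\<close> is an arbitrary compact set containing the support, while the formula
  lives on the box. The density depends on \<open>s\<close> only at parameters belonging to both, so
  the two perimeter integrals differ by a constant in \<open>s\<close>.\<close>

theorem second_variation:
  "has_second_variation S field (integral (cbox l h) (\<lambda>u. sqrt (Wt u) * ((b0 u)\<^sup>2 / ct u - 2 * et u)))" (is "has_second_variation S field ?v")
  unfolding has_second_variation_def Let_def
proof (intro conjI allI impI field_variation)
  fix K assume K: "compact K" "K \<subseteq> S" and supp: "\<forall>g\<in>S - K. field g = 0"
  let ?P = "\<lambda>s. measure (H_perimeter_measure (displace field s ` S)) (displace field s ` K)"
  obtain d where d: "0 < d" "\<And>s. \<bar>s\<bar> < d \<Longrightarrow> admissible s"
    by (rule admissible_small) (rule that)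
  note cb = continuous_on_coeffs[THEN continuous_on_subset, OF box]
  obtain F' where F': "\<And>s. \<bar>s\<bar> < d \<Longrightarrow> ((\<lambda>s. integral (cbox l h) (density_at s)) has_real_derivative F' s) (at s)"
    "(F' has_real_derivative ?v) (at 0)"
  proof (rule second_derivative_integral[OF cb(4-9) d(1) Wt_pos])
    show "0 < ct u - s\<^sup>2 * et u" if "\<bar>s\<bar> < d" "u \<in> cbox l h" for s u
      using d(2)[OF that(1)] that(2) box by (auto simp: admissible_def)
    show "density_at = (\<lambda>s u. sqrt (Wt u * ((ct u - s\<^sup>2 * et u)\<^sup>2 + (s * (b0 u + s * b1 u + s\<^sup>2 * b2 u))\<^sup>2)))"
      by (intro ext) (simp add: density_at_def)
  qed (rule that)
  define K' where "K' = proj ` K"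
  have K': "compact K'" "K' \<subseteq> D" "K = param ` K'"
  proof -
    show "compact K'"
      unfolding K'_def by (rule compact_continuous_image[OF continuous_on_proj K(1)])
    show "K' \<subseteq> D"
      using K(2) proj_in_D by (auto simp: K'_def)
    have "param (proj g) = g" if "g \<in> K" for g
      using param_proj K(2) that by auto
    then show "K = param ` K'"
      by (simp add: K'_def image_image)
  qed
  \<comment> \<open>The field can vanish only where \<open>a\<close> does: the frame coefficients
    have squared length \<open>1 + G^2\<close> and the first two components of the field display
    them.\<close>
  have a_off: "a u = 0" if "u \<in> D - K'" for u
  proof -
    have "param u \<notin> K"
    proof
      assume "param u \<in> K"
      then have "proj (param u) \<in> K'" unfolding K'_def by (rule imageI)
      then show False using that by simp
    qed
    then have "param u \<in> S - K"
      using that param_in_S by simp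
    then have "field (param u) = 0" using supp by blast
    then have z: "a u *\<^sub>R (frame1 u *\<^sub>R X1 (param u) + frame2 u *\<^sub>R X2 (param u)) = 0"
      using that param_in_S by (simp add: field_def)
    have "a u * frame1 u = 0" "a u * frame2 u = 0"
      using arg_cong[OF z, of "\<lambda>v. v $ 1"] arg_cong[OF z, of "\<lambda>v. v $ 2"] by (simp_all add: X1_def X2_def)
    moreover have "frame1 u \<noteq> 0 \<or> frame2 u \<noteq> 0"
      using frame_norm[of u] Wt_pos[of u] by (auto simp: Wt_def)
    ultimately show ?thesis by auto
  qed
  \<comment> \<open>Both complements are open in \<open>D\<close> and \<open>a\<close> vanishes on
    each, which is the neighbourhood that \<open>density_const\<close> asks for.\<close>
  have const: "density_at s u = density_at 0 u" if "u \<in> D" "u \<notin> K' \<or> u \<notin> cbox l h" for s u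
  proof (cases "u \<in> K'")
    case True
    have "open (D - cbox l h)" using open_D by (intro open_Diff) auto
    then show ?thesis using that True by (intro density_const[of "D - cbox l h"]) (auto simp: a_outside)
  next
    case False
    have "open (D - K')" using open_D K'(1) by (intro open_Diff compact_imp_closed)
    then show ?thesis using that False a_off by (intro density_const[of "D - K'"]) auto
  qed
  have P: "?P s
      = integral K' (density_at 0) - integral (cbox l h) (density_at 0) + integral (cbox l h) (density_at s)"
    if s: "\<bar>s\<bar> < d" for s
  proof -
    have im: "displace field s ` (param ` X) = chart a s ` X" if "X \<subseteq> D" for X
      unfolding image_image by (rule image_cong[OF refl displace_field_param]) (use that in auto)
    have "displace field s ` S = chart a s ` D"
      using im[OF order_refl] by (simp only: param_image)
    moreover have "displace field s ` K = chart a s ` K'"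
      using im[OF K'(2)] by (simp only: K'(3)[symmetric])
    ultimately have "?P s = integral K' (density_at s)"
      using perimeter_chart[OF d(2)[OF s] K'(1,2)] by simp
    moreover have int: "density_at r integrable_on K'" "density_at r integrable_on cbox l h" for r
      using K' box by (auto intro!: compact_imp_integrable_on continuous_on_subset[OF continuous_on_density])
    have "integral K' (\<lambda>u. density_at s u - density_at 0 u) = integral (cbox l h) (\<lambda>u. density_at s u - density_at 0 u)"
    proof -
      have "(\<lambda>u. if u \<in> K' then density_at s u - density_at 0 u else 0)
          = (\<lambda>u. if u \<in> cbox l h then density_at s u - density_at 0 u else 0)"
      proof
        fix u
        show "(if u \<in> K' then density_at s u - density_at 0 u else 0)
          = (if u \<in> cbox l h then density_at s u - density_at 0 u else 0)"
          using const[of u s] K'(2) box by (cases "u \<in> K'"; cases "u \<in> cbox l h") auto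
      qed
      then show ?thesis
        unfolding integral_restrict_UNIV[symmetric, of K'] integral_restrict_UNIV[symmetric, of "cbox l h"] by simp
    qed
    then have "integral K' (density_at s) - integral K' (density_at 0)
        = integral (cbox l h) (density_at s) - integral (cbox l h) (density_at 0)"
      by (simp add: integral_diff int)
    ultimately show ?thesis by simp
  qed
  show "\<exists>P'. (\<forall>\<^sub>F s in nhds 0. (?P
        has_real_derivative P' s) (at s)) \<and>
      (P' has_real_derivative ?v) (at 0)"
  proof (intro exI[of _ F'] conjI F'(2))
    have "(?P
        has_real_derivative F' s) (at s)" if s: "s \<in> {- d<..<d}" for s
    proof (rule has_field_derivative_transform_within_open[OF _ _ s])
      show "((\<lambda>s. integral K' (density_at 0) - integral (cbox l h) (density_at 0) + integral (cbox l h) (density_at s))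
          has_real_derivative F' s) (at s)"
        using F'(1)[of s] s by (auto intro!: derivative_eq_intros)
    qed (auto simp: P)
    then show "\<forall>\<^sub>F s in nhds 0. (?P
        has_real_derivative F' s) (at s)"
      using d(1) by (intro eventually_nhds[THEN iffD2] exI[of _ "{- d<..<d}"]) auto
  qed
qed

end

section \<open>A cutoff with negative second variation\<close>

text \<open>Only \<open>z = 0\<close> needs an argument: there the difference quotient is bounded by
  \<open>|h|^(n+1)\<close>.\<close>

lemma DERIV_max_power:
  "DERIV (\<lambda>z::real. (max 0 z) ^ Suc (Suc n)) z :> real (Suc (Suc n)) * (max 0 z) ^ Suc n"
proof -
  consider "z < 0" | "z = 0" | "0 < z" by linarith
  then show ?thesis
  proof cases
    case 1
    have "DERIV (\<lambda>z::real. 0) z :> 0" by simp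
    then have "DERIV (\<lambda>z::real. (max 0 z) ^ Suc (Suc n)) z :> 0"
      by (rule has_field_derivative_transform_within_open[where S = "{..<0}"]) (use 1 in auto)
    then show ?thesis using 1 by simp
  next
    case 2
    have "((\<lambda>h::real. h ^ Suc n) \<longlongrightarrow> 0 ^ Suc n) (at 0)"
      by (intro tendsto_intros)
    then have "((\<lambda>h::real. \<bar>h ^ Suc n\<bar>) \<longlongrightarrow> 0) (at 0)"
      using tendsto_rabs_zero by force
    moreover have "\<forall>\<^sub>F h in at 0. norm ((max 0 (0 + h)) ^ Suc (Suc n) / h) \<le> \<bar>h ^ Suc n\<bar>" for h :: real
    proof (rule always_eventually, rule allI)
      fix h :: real
      show "norm ((max 0 (0 + h)) ^ Suc (Suc n) / h) \<le> \<bar>h ^ Suc n\<bar>"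
        by (cases "0 < h") (auto simp: max_def)
    qed
    ultimately have "((\<lambda>h::real. (max 0 (0 + h)) ^ Suc (Suc n) / h) \<longlongrightarrow> 0) (at 0)"
      by (rule Lim_null_comparison[rotated])
    then show ?thesis using 2 by (simp add: DERIV_def)
  next
    case 3
    have "DERIV (\<lambda>z::real. z ^ Suc (Suc n)) z :> real (Suc (Suc n)) * z ^ Suc n"
      using DERIV_pow[of "Suc (Suc n)" z] by simp
    then have "DERIV (\<lambda>z::real. (max 0 z) ^ Suc (Suc n)) z :> real (Suc (Suc n)) * z ^ Suc n"
      by (rule has_field_derivative_transform_within_open[where S = "{0<..}"]) (use 3 in auto)
    then show ?thesis using 3 by simp
  qed
qed

text \<open>Three is the least integer exponent for which the truncated power is of class C2 across
  the endpoints.\<close>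

definition bump :: "real \<Rightarrow> real" where "bump x = (max 0 (1 - x\<^sup>2)) ^ 3"

definition bump' :: "real \<Rightarrow> real" where "bump' x = - 6 * x * (max 0 (1 - x\<^sup>2))\<^sup>2"

lemma DERIV_bump: "DERIV bump x :> bump' x"
proof -
  have "DERIV (\<lambda>x::real. 1 - x\<^sup>2) x :> - 2 * x"
    by (auto intro!: derivative_eq_intros)
  from DERIV_chain2[OF DERIV_max_power[of 1 "1 - x\<^sup>2"] this] show ?thesis
    by (simp add: bump_def[abs_def] bump'_def power3_eq_cube power2_eq_square algebra_simps numeral_3_eq_3)
qed

lemma C2_on_bump: "C2_on UNIV bump"
proof -
  have "C2_on UNIV (\<lambda>z::real. (max 0 z) ^ 3)"
    using DERIV_max_power[of 1] DERIV_cmult[OF DERIV_max_power[of 0], of 3]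
    by (intro C2_on_real[where f' = "\<lambda>z. 3 * (max 0 z)\<^sup>2" and f'' = "\<lambda>z. 6 * max 0 z"])
      (auto simp: numeral_3_eq_3 power2_eq_square mult.assoc intro!: continuous_intros)
  moreover have "C2_on UNIV (\<lambda>x::real. 1 - x\<^sup>2)"
    unfolding power2_eq_square
    by (intro C2_on_diff C2_on_mult C2_on_const C2_on_bounded_linear bounded_linear_ident open_UNIV)
  ultimately show ?thesis
    unfolding bump_def[abs_def] by (rule C2_on_compose) simp
qed

text \<open>The derivative bound is linear in \<open>|x|\<close> on purpose: the factor
  \<open>y^2\<close> it yields later is absorbed by the growth of \<open>c0\<close>. The value
  \<open>27 / 64\<close> is \<open>(1 - 1/4)^3\<close>.\<close>

lemma bump_bounds:
  "0 \<le> bump x" "bump x \<le> 1" "\<bar>bump' x\<bar> \<le> 6 * \<bar>x\<bar>" "1 \<le> \<bar>x\<bar> \<Longrightarrow> bump x = 0"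
  "\<bar>x\<bar> \<le> 1 / 2 \<Longrightarrow> 27 / 64 \<le> bump x"
proof -
  have m: "0 \<le> max 0 (1 - x\<^sup>2)" "max 0 (1 - x\<^sup>2) \<le> 1" by auto
  show "0 \<le> bump x" "bump x \<le> 1"
    using m by (auto simp: bump_def intro: power_le_one)
  have "(max 0 (1 - x\<^sup>2))\<^sup>2 \<le> 1"
    using m by (intro power_le_one)
  then show "\<bar>bump' x\<bar> \<le> 6 * \<bar>x\<bar>"
    using mult_left_mono[of "(max 0 (1 - x\<^sup>2))\<^sup>2" 1 "6 * \<bar>x\<bar>"] by (simp add: bump'_def abs_mult)
  show "bump x = 0" if "1 \<le> \<bar>x\<bar>"
    using that abs_le_square_iff[of 1 x] by (simp add: bump_def)
  show "27 / 64 \<le> bump x" if "\<bar>x\<bar> \<le> 1 / 2"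
  proof -
    have "x\<^sup>2 \<le> (1 / 2)\<^sup>2"
      using that abs_le_square_iff[of x "1 / 2"] by simp
    then have "3 / 4 \<le> max 0 (1 - x\<^sup>2)"
      by (simp add: power2_eq_square)
    then have "(3 / 4) ^ 3 \<le> bump x"
      unfolding bump_def by (rule power_mono) simp
    then show ?thesis by (simp add: power3_eq_cube)
  qed
qed

text \<open>With \<open>\<eta> = k / c\<^sub>0\<close> the bracket is the derivative of \<open>k c / c\<^sub>0\<close>, which is close to \<open>k'\<close>
  as \<open>g\<close> is close to \<open>g\<^sub>0\<close>.\<close>

lemma cutoff_energy_bound:
  fixes y g g0 R k k' :: real
  assumes g: "0 < g0" "0 \<le> g" "g \<le> 2 * g0" "\<bar>g - g0\<bar> \<le> 1 / R ^ 3" and R: "1 \<le> R" and y: "\<bar>y\<bar> \<le> R"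
    and k: "\<bar>k\<bar> \<le> 1" "\<bar>k'\<bar> \<le> 6 * \<bar>y\<bar> / R\<^sup>2"
  defines "c \<equiv> 1 + g * y\<^sup>2 / 2" and "c0 \<equiv> 1 + g0 * y\<^sup>2 / 2"
  shows "((k' / c0 - k * g0 * y / c0\<^sup>2) * c + k / c0 * y * g)\<^sup>2 / c \<le> (288 / g0 + 2) / R ^ 4"
proof -
  have c: "1 \<le> c" "1 \<le> c0" "c \<le> 2 * c0"
    using g(1-3) mult_right_mono[OF g(3), of "y\<^sup>2"] by (simp_all add: c_def c0_def)
  \<comment> \<open>\<open>A\<close> is the intended derivative and \<open>B\<close> the error of
    freezing \<open>g\<close> at \<open>g0\<close>. In \<open>B\<close> the quadratic terms of
    \<open>g c0 - g0 c\<close> cancel, leaving only \<open>g - g0\<close>.\<close>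
  define A B where "A = k' * c / c0" and "B = k * y * (g - g0) / c0\<^sup>2"
  have "g * c0 - g0 * c = g - g0"
    by (simp add: c_def c0_def algebra_simps)
  then have "k * y * (g * c0 - g0 * c) / c0\<^sup>2 = B"
    by (simp add: B_def)
  moreover have "(k' / c0 - k * g0 * y / c0\<^sup>2) * c + k / c0 * y * g = A + k * y * (g * c0 - g0 * c) / c0\<^sup>2"
    using c by (simp add: A_def field_simps power2_eq_square)
  ultimately have eq: "(k' / c0 - k * g0 * y / c0\<^sup>2) * c + k / c0 * y * g = A + B"
    by simp
  have "A\<^sup>2 / c \<le> 144 / (g0 * R ^ 4)"
  proof -
    have "A\<^sup>2 / c = k'\<^sup>2 * (c / c0\<^sup>2)"
      using c by (simp add: A_def power2_eq_square field_simps)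
    also have "\<dots> \<le> (6 * \<bar>y\<bar> / R\<^sup>2)\<^sup>2 * (2 / c0)"
    proof (rule mult_mono)
      show "k'\<^sup>2 \<le> (6 * \<bar>y\<bar> / R\<^sup>2)\<^sup>2"
        using power_mono[OF k(2) abs_ge_zero, of 2] by simp
      show "c / c0\<^sup>2 \<le> 2 / c0"
        using c by (simp add: field_simps power2_eq_square)
    qed (use c in auto)
    also have "\<dots> = 36 * (2 * (y\<^sup>2 / c0)) / R ^ 4"
      using R by (simp add: power_divide power_mult_distrib power4_eq_xxxx power2_eq_square)
    also have "\<dots> \<le> 36 * (2 * (2 / g0)) / R ^ 4"
    proof -
      \<comment> \<open>Here the slope bound proportional to \<open>|y|\<close> pays off:
        \<open>y^2 / c0\<close> is bounded independently of \<open>R\<close>.\<close>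
      have "y\<^sup>2 / c0 \<le> 2 / g0"
        using c g(1) by (simp add: c0_def field_simps)
      then show ?thesis
        using R by (intro divide_right_mono) auto
    qed
    finally show ?thesis by simp
  qed
  moreover have "B\<^sup>2 / c \<le> 1 / R ^ 4"
  proof -
    have "B\<^sup>2 / c \<le> B\<^sup>2"
      using c divide_left_mono[of 1 c "B\<^sup>2"] by simp
    also have "\<bar>B\<bar> \<le> R * (1 / R ^ 3)"
    proof -
      have "\<bar>B\<bar> = \<bar>k\<bar> * \<bar>y\<bar> * \<bar>g - g0\<bar> / c0\<^sup>2"
        by (simp add: B_def abs_mult)
      also have "\<dots> \<le> \<bar>k\<bar> * \<bar>y\<bar> * \<bar>g - g0\<bar>"
      proof -
        have "1 \<le> c0\<^sup>2" using c by simp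
        then show ?thesis
          using c(2) divide_left_mono[of 1 "c0\<^sup>2" "\<bar>k\<bar> * \<bar>y\<bar> * \<bar>g - g0\<bar>"] by auto
      qed
      also have "\<dots> \<le> 1 * R * (1 / R ^ 3)"
        using k(1) y g(4) R by (intro mult_mono) auto
      finally show ?thesis by simp
    qed
    then have "B\<^sup>2 \<le> (R * (1 / R ^ 3))\<^sup>2"
      using power_mono[OF _ abs_ge_zero, of B _ 2] by fastforce
    also have "\<dots> = 1 / R ^ 4"
      using R by (simp add: power2_eq_square power3_eq_cube power4_eq_xxxx field_simps)
    finally show ?thesis .
  qed
  moreover have "(A + B)\<^sup>2 / c \<le> 2 * (A\<^sup>2 / c) + 2 * (B\<^sup>2 / c)"
  proof -
    have "(A + B)\<^sup>2 \<le> 2 * A\<^sup>2 + 2 * B\<^sup>2"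
      using sum_squares_bound[of A B] by (simp add: power2_sum)
    then show ?thesis
      using c divide_right_mono[of "(A + B)\<^sup>2" "2 * A\<^sup>2 + 2 * B\<^sup>2" c] by (simp add: add_divide_distrib)
  qed
  ultimately show ?thesis
    unfolding eq by (simp add: add_divide_distrib)
qed

lemma content_cbox_2:
  fixes p q :: "real^2"
  assumes "p $ 1 \<le> q $ 1" "p $ 2 \<le> q $ 2"
  shows "measure lborel (cbox p q) = (q $ 1 - p $ 1) * (q $ 2 - p $ 2)"
proof -
  have "cbox p q \<noteq> {}"
    using assms by (simp add: interval_ne_empty_cart forall_2)
  then show ?thesis
    by (simp add: content_cbox_cart UNIV_2)
qed

lemma mem_cbox_centred:
  fixes u :: "real^2"
  shows "u \<in> cbox (vector [- r, t - e]) (vector [r, t + e]) \<longleftrightarrow> \<bar>u $ 1\<bar> \<le> r \<and> \<bar>u $ 2 - t\<bar> \<le> e"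
  by (auto simp: mem_box_cart forall_2 abs_le_iff)

text \<open>Bounding the integrand by a step function spares Fubini's theorem on \<open>real^2\<close>.\<close>

lemma integral_two_boxes_neg:
  fixes f :: "real^2 \<Rightarrow> real"
  assumes f: "f integrable_on cbox l h" and sub: "cbox l' h' \<subseteq> cbox l h"
    and ub: "\<And>u. u \<in> cbox l h \<Longrightarrow> f u \<le> C" "\<And>u. u \<in> cbox l' h' \<Longrightarrow> f u \<le> C - \<delta>"
    and neg: "C * measure lborel (cbox l h) < \<delta> * measure lborel (cbox l' h')"
  shows "integral (cbox l h) f < 0"
proof -
  have "((\<lambda>u. if u \<in> cbox l' h' then \<delta> else 0) has_integral measure lborel (cbox l' h') * \<delta>) (cbox l h)"
    using has_integral_const[of \<delta> l' h'] by (simp add: has_integral_restrict[OF sub])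
  from has_integral_diff[OF has_integral_const[of C l h] this]
  have int: "((\<lambda>u. C - (if u \<in> cbox l' h' then \<delta> else 0)) has_integral
      measure lborel (cbox l h) * C - measure lborel (cbox l' h') * \<delta>) (cbox l h)"
    by simp
  have "integral (cbox l h) f \<le> measure lborel (cbox l h) * C - measure lborel (cbox l' h') * \<delta>"
    by (rule has_integral_le[OF integrable_integral[OF f] int]) (use ub in auto)
  then show ?thesis
    using neg by (simp add: mult.commute)
qed

section \<open>Choice of the test function\<close>

context strip
begin

lemma product_variation:
  assumes p: "C2_on UNIV p" "\<And>y. DERIV p y :> p' y" and q: "C2_on I q"
  shows "C2_on D (\<lambda>u. p (u $ 1) * q (u $ 2))"
    and "u \<in> D \<Longrightarrow> dif (\<lambda>u. p (u $ 1) * q (u $ 2)) u (axis 1 1) = p' (u $ 1) * q (u $ 2)"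
proof -
  show "C2_on D (\<lambda>u. p (u $ 1) * q (u $ 2))"
    by (intro C2_on_mult C2_on_compose[OF p(1) C2_on_nth] C2_on_compose[OF q C2_on_nth] open_D)
      (auto simp: D_def)
  assume u: "u \<in> D"
  have n: "((\<lambda>u::real^2. u $ i) has_derivative (\<lambda>h. h $ i)) (at u)" for i
    by (rule bounded_linear_imp_has_derivative[OF bounded_linear_vec_nth])
  have dp: "((\<lambda>u. p (u $ 1)) has_derivative (\<lambda>h. p' (u $ 1) * h $ 1)) (at u)"
    using has_derivative_compose[OF n[of 1], of p "(*) (p' (u $ 1))"] p(2)[of "u $ 1"]
    by (simp add: has_field_derivative_def)
  have dq: "((\<lambda>u. q (u $ 2)) has_derivative (\<lambda>h. deriv q (u $ 2) * h $ 2)) (at u)"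
    using has_derivative_compose[OF n[of 2], of q "(*) (deriv q (u $ 2))"] C2_on_real_deriv(1)[OF q, of "u $ 2"] u
    by (simp add: has_field_derivative_def D_def)
  show "dif (\<lambda>u. p (u $ 1) * q (u $ 2)) u (axis 1 1) = p' (u $ 1) * q (u $ 2)"
    unfolding frechet_derivative_at[OF has_derivative_mult[OF dp dq], symmetric] by (simp add: axis_def)
qed

text \<open>The order of the choices matters: \<open>\<omega>\<close> bounds \<open>w\<close> on a
  fixed interval, \<open>R\<close> depends only on \<open>g0\<close> and \<open>\<omega>\<close>,
  and the height \<open>e\<close> is shrunk last, according to \<open>R\<close>. This is not
  circular because both box areas are proportional to \<open>e\<close>.\<close>

lemma negative_variation:
  assumes t0: "t0 \<in> I" "0 < deriv G t0"
  obtains a l h v u where "C2_on D a" "cbox l h \<subseteq> D" "\<And>u. u \<notin> cbox l h \<Longrightarrow> a u = 0" "u \<in> D" "a u \<noteq> 0" "v < 0"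
    "has_second_variation S (\<lambda>g. if g \<in> S then a (proj g) *\<^sub>R (frame1 (proj g) *\<^sub>R X1 g + frame2 (proj g) *\<^sub>R X2 g) else 0) v"
proof -
  define g0 where "g0 = deriv G t0"
  have g0: "0 < g0" using t0 by (simp add: g0_def)
  obtain e0 where e0: "0 < e0" "cball t0 e0 \<subseteq> I"
    using I(1) t0(1) open_contains_cball by blast
  define w where "w t = sqrt (1 + (G t)\<^sup>2)" for t
  have w: "1 \<le> w t" "0 < w t" "w t \<noteq> 0" for t
  proof -
    show "1 \<le> w t" by (simp add: w_def)
    then show "0 < w t" "w t \<noteq> 0" by linarith+
  qed
  have wC: "C2_on I w"
    unfolding w_def[abs_def] power2_eq_square
    by (intro C2_on_sqrt C2_on_add C2_on_mult C2_on_const G I(1)) (simp add: add_pos_nonneg)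
  have "compact (w ` cball t0 e0)"
    by (intro compact_continuous_image continuous_on_subset[OF C2_on_continuous[OF wC] e0(2)]) simp
  then have "bounded (w ` cball t0 e0)" by (rule compact_imp_bounded)
  then obtain \<omega> where \<omega>: "0 < \<omega>" "\<And>t. t \<in> cball t0 e0 \<Longrightarrow> \<bar>w t\<bar> \<le> \<omega>"
    unfolding bounded_pos by auto
  define \<kappa> m K1 where "\<kappa> = ((27 / 64) / (1 + g0 / 2))\<^sup>2 * (g0 / 2)" and "m = (27 / 64)\<^sup>2 / \<omega>" and "K1 = 288 / g0 + 2"
  have pos: "0 < \<kappa>" "0 < m" "0 < K1"
    using g0 \<omega>(1) by (auto simp: \<kappa>_def m_def K1_def intro!: mult_pos_pos add_pos_pos divide_pos_pos)
  \<comment> \<open>\<open>2 <= R\<close> puts \<open>|y| <= 1\<close> into the range where the bump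
    is at least \<open>27 / 64\<close>; the other entry gives \<open>2 K1 < m \<kappa> R^3\<close>
    by way of \<open>R <= R^3\<close>.\<close>
  define R where "R = max 2 (2 * K1 / (m * \<kappa>) + 1)"
  have R: "2 \<le> R" "2 * K1 < m * \<kappa> * R ^ 3"
  proof -
    show R2: "2 \<le> R" by (simp add: R_def)
    have "2 * K1 / (m * \<kappa>) < R" by (simp add: R_def)
    also have "R \<le> R ^ 3"
      using R2 power_increasing[of 1 3 R] by simp
    finally show "2 * K1 < m * \<kappa> * R ^ 3"
      using pos by (simp add: pos_divide_less_eq mult.commute)
  qed
  \<comment> \<open>\<open>1 / R ^ 3\<close> compensates the factor \<open>|y| <= R\<close> in the
    freezing error, which then has the order of the main term; \<open>g0 / 2\<close> keeps
    \<open>deriv G\<close> comparable to \<open>g0\<close>.\<close>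
  define \<tau> where "\<tau> = min (1 / R ^ 3) (g0 / 2)"
  have \<tau>: "0 < \<tau>" using R g0 by (simp add: \<tau>_def)
  obtain \<delta> where \<delta>: "0 < \<delta>" "\<And>t. t \<in> I \<Longrightarrow> dist t t0 < \<delta> \<Longrightarrow> dist (deriv G t) (deriv G t0) < \<tau>"
    using continuous_deriv_G[unfolded continuous_on_iff, rule_format, OF t0(1) \<tau>] by auto
  define e where "e = min e0 (\<delta> / 2)"
  have e: "0 < e" "e \<le> e0" "e < \<delta>"
    using e0(1) \<delta>(1) by (auto simp: e_def)
  have near: "t \<in> I" "w t \<le> \<omega>" "\<bar>deriv G t - g0\<bar> \<le> 1 / R ^ 3" "\<bar>deriv G t - g0\<bar> \<le> g0 / 2"
    if "\<bar>t - t0\<bar> \<le> e" for t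
  proof -
    have "t \<in> cball t0 e0" using that e(2) by (simp add: dist_real_def abs_minus_commute)
    then show "t \<in> I" "w t \<le> \<omega>" using e0(2) \<omega>(2)[of t] by auto
    then have "\<bar>deriv G t - g0\<bar> < \<tau>"
      using \<delta>(2)[of t] that e(3) by (simp add: dist_real_def g0_def)
    then show "\<bar>deriv G t - g0\<bar> \<le> 1 / R ^ 3" "\<bar>deriv G t - g0\<bar> \<le> g0 / 2"
      by (simp_all add: \<tau>_def)
  qed
  define c0 where "c0 y = 1 + g0 * y\<^sup>2 / 2" for y :: real
  have c0: "1 \<le> c0 y" "0 < c0 y" "c0 y \<noteq> 0" for y
  proof -
    show "1 \<le> c0 y" using g0 by (simp add: c0_def)
    then show "0 < c0 y" "c0 y \<noteq> 0" by linarith+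
  qed
  define p where "p y = bump (y / R) / c0 y" for y
  define p' where "p' y = (bump' (y / R) / R) / c0 y - bump (y / R) * g0 * y / (c0 y)\<^sup>2" for y
  \<comment> \<open>With the division by \<open>w\<close> the weight \<open>w q^2\<close> is at most
    1, and the function multiplying the unit normal is a product of bumps over
    \<open>c0\<close>.\<close>
  define q where "q t = bump ((t - t0) / e) / w t" for t
  have aff: "C2_on V (\<lambda>y::real. (y - z) / r)" if "open V" for V z r
    unfolding divide_inverse
    by (intro C2_on_mult C2_on_diff C2_on_const C2_on_bounded_linear bounded_linear_ident that)
  have pC: "C2_on UNIV p"
  proof -
    have "C2_on UNIV (\<lambda>y. bump (y / R))"
      by (rule C2_on_compose[OF C2_on_bump]) (use aff[OF open_UNIV, of 0 R] in auto)
    moreover have "C2_on UNIV c0"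
      unfolding c0_def[abs_def] divide_inverse power2_eq_square
      by (intro C2_on_add C2_on_mult C2_on_const C2_on_bounded_linear bounded_linear_ident open_UNIV)
    ultimately show ?thesis
      unfolding p_def[abs_def] using c0 by (intro C2_on_divide)
  qed
  have p': "DERIV p y :> p' y" for y
  proof -
    have "DERIV (\<lambda>y. y / R) y :> 1 / R" using R(1) by (auto intro!: derivative_eq_intros)
    from DERIV_chain2[OF DERIV_bump this]
    have "DERIV (\<lambda>y. bump (y / R)) y :> bump' (y / R) / R" by simp
    moreover have "DERIV c0 y :> g0 * y"
      unfolding c0_def[abs_def] by (auto intro!: derivative_eq_intros)
    ultimately have "DERIV p y :> (bump' (y / R) / R * c0 y - bump (y / R) * (g0 * y)) / (c0 y * c0 y)"
      unfolding p_def[abs_def] by (rule DERIV_divide) (rule c0(3))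
    then show ?thesis
      using c0(3)[of y] by (simp add: p'_def power2_eq_square diff_divide_distrib mult.assoc)
  qed
  have qC: "C2_on I q"
    unfolding q_def[abs_def]
    by (intro C2_on_divide C2_on_compose[OF C2_on_bump aff] wC w I(1)) simp
  define a where "a u = p (u $ 1) * q (u $ 2)" for u :: "real^2"
  define l h where "l = (vector [- R, t0 - e] :: real^2)" and "h = (vector [R, t0 + e] :: real^2)"
  have mem: "u \<in> cbox l h \<longleftrightarrow> \<bar>u $ 1\<bar> \<le> R \<and> \<bar>u $ 2 - t0\<bar> \<le> e" for u
    unfolding l_def h_def by (rule mem_cbox_centred)
  note prod = product_variation[OF pC p' qC]
  have aC: "C2_on D a"
    unfolding a_def[abs_def] by (rule prod(1))
  have box: "cbox l h \<subseteq> D"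
    using near(1) by (auto simp: mem D_def)
  have outside: "a u = 0" if "u \<notin> cbox l h" for u
  proof -
    have "1 \<le> \<bar>u $ 1 / R\<bar> \<or> 1 \<le> \<bar>(u $ 2 - t0) / e\<bar>"
      using that R(1) e(1) by (auto simp: mem)
    then show ?thesis
      using bump_bounds(4) by (auto simp: a_def p_def q_def)
  qed
  interpret strip_variation I G b \<theta> S a l h
    by unfold_locales (use aC box outside in auto)
  define f where "f u = sqrt (Wt u) * ((b0 u)\<^sup>2 / ct u - 2 * et u)" for u
  define k where "k u = (p' (u $ 1) * ct u + p (u $ 1) * u $ 1 * deriv G (u $ 2))\<^sup>2 / ct u" for u
  define \<psi> where "\<psi> t = w t * (q t)\<^sup>2" for t
  have f_eq: "f u = \<psi> (u $ 2) * (k u - (p (u $ 1))\<^sup>2 * deriv G (u $ 2))" if "u \<in> D" for u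
  proof -
    have "a1 u = p' (u $ 1) * q (u $ 2)"
      unfolding a1_def unfolding a_def[abs_def] by (rule prod(2)[OF that])
    moreover define Z where "Z = p' (u $ 1) * ct u + p (u $ 1) * u $ 1 * deriv G (u $ 2)"
    ultimately have b: "b0 u = q (u $ 2) * Z"
      by (simp add: b0_def a_def algebra_simps)
    have k: "k u = Z\<^sup>2 / ct u"
      by (simp add: k_def Z_def)
    have "sqrt (Wt u) = w (u $ 2)" by (simp add: Wt_def w_def)
    then show ?thesis
      unfolding f_def b k by (simp add: \<psi>_def et_def a_def power_mult_distrib algebra_simps)
  qed
  have \<psi>_eq: "\<psi> t = (bump ((t - t0) / e))\<^sup>2 / w t" for t
    using w(3)[of t] by (simp add: \<psi>_def q_def power2_eq_square)
  have \<psi>: "0 \<le> \<psi> t" "\<psi> t \<le> 1" for t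
  proof -
    show "0 \<le> \<psi> t" using w(2)[of t] by (simp add: \<psi>_eq)
    have "(bump ((t - t0) / e))\<^sup>2 \<le> 1"
      using bump_bounds(1,2) by (intro power_le_one)
    then show "\<psi> t \<le> 1" using w(1,2)[of t] by (simp add: \<psi>_eq divide_le_eq)
  qed
  have k: "0 \<le> k u" "k u \<le> K1 / R ^ 4" if u: "u \<in> cbox l h" for u
  proof -
    have uD: "u \<in> D" using u box by auto
    show "0 \<le> k u" using ct_ge_1[OF uD] by (simp add: k_def)
    note n = near[of "u $ 2"]
    have "\<bar>bump' (u $ 1 / R) / R\<bar> \<le> 6 * \<bar>u $ 1\<bar> / R\<^sup>2"
      using bump_bounds(3)[of "u $ 1 / R"] R(1) by (simp add: field_simps power2_eq_square)
    moreover have "deriv G (u $ 2) \<le> 2 * g0"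
    proof -
      have "\<bar>deriv G (u $ 2) - g0\<bar> \<le> g0 / 2" by (rule n(4)) (use u in \<open>simp add: mem\<close>)
      then show ?thesis using g0 by linarith
    qed
    ultimately show "k u \<le> K1 / R ^ 4"
      unfolding k_def p'_def p_def ct_def c0_def K1_def
      using u n g0 R(1) G'_nonneg[of "u $ 2"] bump_bounds(1,2)[of "u $ 1 / R"]
      by (intro cutoff_energy_bound) (auto simp: mem)
  qed
  define l' h' where "l' = (vector [- 1, t0 - e / 2] :: real^2)" and "h' = (vector [1, t0 + e / 2] :: real^2)"
  have mem': "u \<in> cbox l' h' \<longleftrightarrow> \<bar>u $ 1\<bar> \<le> 1 \<and> \<bar>u $ 2 - t0\<bar> \<le> e / 2" for u
    unfolding l'_def h'_def by (rule mem_cbox_centred)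
  have sub: "cbox l' h' \<subseteq> cbox l h"
    using R(1) e(1) by (auto simp: mem mem')
  have ub: "f u \<le> K1 / R ^ 4 - \<psi> (u $ 2) * ((p (u $ 1))\<^sup>2 * deriv G (u $ 2))" if u: "u \<in> cbox l h" for u
  proof -
    have "\<psi> (u $ 2) * k u \<le> 1 * (K1 / R ^ 4)"
      using \<psi> k[OF u] by (intro mult_mono) auto
    then show ?thesis
      using f_eq[of u] u box by (auto simp: algebra_simps)
  qed
  have int_neg: "integral (cbox l h) f < 0"
  proof (rule integral_two_boxes_neg[OF _ sub])
    show "f integrable_on cbox l h"
    proof (rule integrable_continuous)
      note cb = continuous_on_coeffs[THEN continuous_on_subset, OF box]
      have "\<forall>u\<in>cbox l h. ct u \<noteq> 0"
        using ct_ge_1 box by (auto simp: subset_iff) (metis not_one_le_zero)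
      then show "continuous_on (cbox l h) f"
        unfolding f_def[abs_def] by (intro continuous_intros cb)
    qed
    show "f u \<le> K1 / R ^ 4" if u: "u \<in> cbox l h" for u
    proof -
      have "0 \<le> \<psi> (u $ 2) * ((p (u $ 1))\<^sup>2 * deriv G (u $ 2))"
        using \<psi>(1) G'_nonneg near(1) u by (auto simp: mem)
      then show ?thesis using ub[OF u] by linarith
    qed
    show "f u \<le> K1 / R ^ 4 - m * \<kappa>" if u: "u \<in> cbox l' h'" for u
    proof -
      have u': "u \<in> cbox l h" using u sub by auto
      have n: "\<bar>u $ 2 - t0\<bar> \<le> e" using u' by (simp add: mem)
      have "m \<le> \<psi> (u $ 2)"
      proof -
        have "27 / 64 \<le> bump ((u $ 2 - t0) / e)"
          using u e(1) by (intro bump_bounds(5)) (simp add: mem' field_simps)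
        then have "(27 / 64)\<^sup>2 \<le> (bump ((u $ 2 - t0) / e))\<^sup>2"
          by (intro power_mono) auto
        then show ?thesis
          unfolding m_def \<psi>_eq using w(2) near(2)[OF n] by (intro frac_le) auto
      qed
      moreover have "\<kappa> \<le> (p (u $ 1))\<^sup>2 * deriv G (u $ 2)"
        unfolding \<kappa>_def
      proof (rule mult_mono)
        have "\<bar>u $ 1 / R\<bar> \<le> 1 / 2"
          using u R(1) by (simp add: mem' field_simps)
        then have "27 / 64 \<le> bump (u $ 1 / R)"
          by (rule bump_bounds(5))
        moreover have "c0 (u $ 1) \<le> 1 + g0 / 2"
          using u g0 abs_le_square_iff[of "u $ 1" 1] by (simp add: c0_def mem')
        ultimately have "(27 / 64) / (1 + g0 / 2) \<le> p (u $ 1)"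
          unfolding p_def using c0(2) by (intro frac_le) auto
        then show "((27 / 64) / (1 + g0 / 2))\<^sup>2 \<le> (p (u $ 1))\<^sup>2"
          using g0 by (intro power_mono) auto
        show "g0 / 2 \<le> deriv G (u $ 2)"
          using near(4)[OF n] by linarith
      qed (use g0 in auto)
      ultimately have "m * \<kappa> \<le> \<psi> (u $ 2) * ((p (u $ 1))\<^sup>2 * deriv G (u $ 2))"
        using pos \<psi>(1) by (intro mult_mono) auto
      then show ?thesis using ub[OF u'] by linarith
    qed
    have vol: "measure lborel (cbox l h) = 4 * R * e" "measure lborel (cbox l' h') = 2 * e"
      using R(1) e(1) by (simp_all add: content_cbox_2 l_def h_def l'_def h'_def)
    \<comment> \<open>The areas are \<open>4 R e\<close> and \<open>2 e\<close>: the height cancels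
      and what remains is the inequality that fixed \<open>R\<close>.\<close>
    have "K1 / R ^ 4 * measure lborel (cbox l h) = 2 * e * (2 * K1 / R ^ 3)"
      unfolding vol using R(1) by (simp add: power3_eq_cube power4_eq_xxxx mult_ac)
    also have "\<dots> < 2 * e * (m * \<kappa>)"
      using R e(1) by (intro mult_strict_left_mono) (simp_all add: pos_divide_less_eq)
    finally show "K1 / R ^ 4 * measure lborel (cbox l h) < m * \<kappa> * measure lborel (cbox l' h')"
      by (simp add: vol mult_ac)
  qed
  have "field = (\<lambda>g. if g \<in> S then a (proj g) *\<^sub>R (frame1 (proj g) *\<^sub>R X1 g + frame2 (proj g) *\<^sub>R X2 g) else 0)"
    by (simp add: field_def fun_eq_iff)
  moreover have "(vector [0, t0] :: real^2) \<in> D" "a (vector [0, t0]) \<noteq> 0"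
    using t0(1) c0(3)[of 0] w(3)[of t0] by (simp_all add: D_def a_def p_def q_def bump_def)
  ultimately show ?thesis
    using that[OF aC box outside _ _ int_neg] second_variation unfolding f_def[abs_def] by simp
qed

end

section \<open>Minimality and the horizontal Gauss map\<close>

lemma C1_on_lie:
  assumes \<phi>: "C2_on U \<phi>" and Y: "C1_on U Y"
  shows "C1_on U (lie Y \<phi>)"
proof -
  have "C1_on U (\<lambda>x. \<Sum>i\<in>UNIV. (Y x $ i) * dif \<phi> x (axis i 1))"
    by (intro C1_on_sum C1_on_mult C1_on_nth_compose[OF Y] C1_on_frechet[OF \<phi>] C2_on_open[OF \<phi>] finite)
  then show ?thesis
  proof (rule C1_on_cong)
    fix x assume "x \<in> U"
    then have "\<phi> differentiable (at x)" by (rule C2_on_differentiable[OF \<phi>])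
    then show "(\<Sum>i\<in>UNIV. (Y x $ i) * dif \<phi> x (axis i 1)) = lie Y \<phi> x"
      by (simp add: lie_eq_gradient inner_vec_def gradient_def mult.commute)
  qed
qed

lemma C1_on_frame_fields: "open U \<Longrightarrow> C1_on U X1" "open U \<Longrightarrow> C1_on U X2"
  unfolding X1_def[abs_def] X2_def[abs_def] divide_inverse
  by (intro C1_on_vector_3 C1_on_const C1_on_minus C1_on_mult C2_on_imp_C1_on[OF C2_on_nth]; simp)+

text \<open>Off \<open>S\<close> the horizontal gradient of a defining function may vanish, so
  regularity is claimed only on the open set where it does not. The normalization holds on that open
  set, hence can be differentiated in all directions.\<close>

lemma C1_on_bars:
  assumes \<phi>: "C2_on U \<phi>" and V: "V = {x \<in> U. W \<phi> x \<noteq> 0}"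
  shows "C1_on V (pbar \<phi>)" "C1_on V (qbar \<phi>)" "\<And>x. x \<in> V \<Longrightarrow> (pbar \<phi> x)\<^sup>2 + (qbar \<phi> x)\<^sup>2 = 1"
proof -
  define p q where "p = lie X1 \<phi>" and "q = lie X2 \<phi>"
  have U: "open U" by (rule C2_on_open[OF \<phi>])
  have pq: "C1_on U p" "C1_on U q"
    unfolding p_def q_def by (intro C1_on_lie[OF \<phi>] C1_on_frame_fields U)+
  define N where "N x = (p x)\<^sup>2 + (q x)\<^sup>2" for x
  have W_eq: "W \<phi> x = sqrt (N x)" for x
    by (simp add: W_def N_def p_def q_def)
  have NC: "C1_on U N"
    unfolding N_def[abs_def] power2_eq_square by (intro C1_on_add C1_on_mult pq)
  have N: "0 < N x" if "x \<in> V" for x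
    using that unfolding V W_eq by (simp add: N_def less_le sum_power2_ge_zero)
  have V_eq: "V = U \<inter> N -` {0<..}"
    unfolding V W_eq by (auto simp: N_def less_le sum_power2_ge_zero)
  have oV: "open V"
    unfolding V_eq by (rule continuous_open_preimage[OF C1_on_continuous[OF NC] U]) simp
  have VU: "V \<subseteq> U" by (auto simp: V)
  have "C2_on {0<..} (\<lambda>z::real. sqrt z)"
    by (rule C2_on_sqrt[OF C2_on_bounded_linear[OF bounded_linear_ident]]) auto
  then have WC: "C1_on V (W \<phi>)"
    unfolding W_eq[abs_def] using N
    by (intro C1_on_compose[OF C2_on_imp_C1_on C1_on_subset[OF NC oV VU]]) auto
  have nz: "W \<phi> x \<noteq> 0" if "x \<in> V" for x using that by (simp add: V)
  show "C1_on V (pbar \<phi>)" "C1_on V (qbar \<phi>)"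
    unfolding pbar_def[abs_def] qbar_def[abs_def] p_def[symmetric] q_def[symmetric]
    by (intro C1_on_divide C1_on_subset[OF pq(1) oV VU] C1_on_subset[OF pq(2) oV VU] WC nz; assumption)+
  show "(pbar \<phi> x)\<^sup>2 + (qbar \<phi> x)\<^sup>2 = 1" if "x \<in> V" for x
    using N[OF that] unfolding pbar_def qbar_def W_eq p_def[symmetric] q_def[symmetric]
    by (simp add: power_divide add_divide_distrib[symmetric]) (simp add: N_def)
qed

lemma param_tangent:
  assumes D: "C2_on D \<Psi>" "\<Psi> ` D \<subseteq> S" and u: "u \<in> D"
  shows "dif \<Psi> u v \<in> tangent_space S (\<Psi> u)"
proof -
  define \<gamma> where "\<gamma> r = u + r *\<^sub>R v" for r :: real
  have "open (\<gamma> -` D)"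
    unfolding \<gamma>_def[abs_def] by (intro open_vimage C2_on_open[OF D(1)] continuous_intros)
  moreover have "0 \<in> \<gamma> -` D" using u by (simp add: \<gamma>_def)
  ultimately obtain e where e: "0 < e" "ball 0 e \<subseteq> \<gamma> -` D"
    unfolding open_contains_ball by blast
  have "(\<gamma> has_derivative (\<lambda>r. r *\<^sub>R v)) (at 0)"
    unfolding \<gamma>_def[abs_def] by (auto intro!: derivative_eq_intros)
  moreover have "(\<Psi> has_derivative dif \<Psi> u) (at (\<gamma> 0))"
    using C2_on_frechet_works[OF D(1) u] by (simp add: \<gamma>_def)
  ultimately have "((\<lambda>r. \<Psi> (\<gamma> r)) has_derivative (\<lambda>r. dif \<Psi> u (r *\<^sub>R v))) (at 0)"
    by (rule has_derivative_compose)
  then have "((\<lambda>r. \<Psi> (\<gamma> r)) has_vector_derivative dif \<Psi> u v) (at 0)"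
    unfolding has_vector_derivative_def
    using linear_scale[OF linear_frechet_derivative[OF C2_on_differentiable[OF D(1) u]]] by simp
  moreover have "(\<lambda>r. \<Psi> (\<gamma> r)) ` {- e<..<e} \<subseteq> S"
  proof
    fix x assume "x \<in> (\<lambda>r. \<Psi> (\<gamma> r)) ` {- e<..<e}"
    then obtain r where x: "x = \<Psi> (\<gamma> r)" and "r \<in> ball 0 e"
      by (auto simp: dist_real_def abs_less_iff)
    then have "\<gamma> r \<in> D" using e(2) by blast
    then show "x \<in> S" using D(2) x by blast
  qed
  ultimately show ?thesis
    unfolding tangent_space_def using e(1)
    by (intro CollectI exI[of _ "\<lambda>r. \<Psi> (\<gamma> r)"] exI[of _ e]) (simp add: \<gamma>_def)
qed

text \<open>At a characteristic point both partials of the chart lie in the horizontal plane, so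
  their cross product is a multiple of \<open>cross3 (X1 g) (X2 g)\<close> and pairs to zero with
  the frame.\<close>

lemma not_characteristic:
  assumes D: "C2_on D \<Psi>" "\<Psi> ` D \<subseteq> S" and u: "u \<in> D" and h: "hnorm \<Psi> u \<noteq> 0"
  shows "\<Psi> u \<notin> char_locus S"
proof
  assume "\<Psi> u \<in> char_locus S"
  then have T: "tangent_space S (\<Psi> u) = span {X1 (\<Psi> u), X2 (\<Psi> u)}"
    by (simp add: char_locus_def)
  have "\<exists>\<alpha> \<beta>. dif \<Psi> u v = \<alpha> *\<^sub>R X1 (\<Psi> u) + \<beta> *\<^sub>R X2 (\<Psi> u)" for v
  proof -
    have "dif \<Psi> u v \<in> span {X1 (\<Psi> u), X2 (\<Psi> u)}"
      using param_tangent[OF D u, of v] T by simp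
    then obtain \<alpha> \<beta> where "dif \<Psi> u v - \<alpha> *\<^sub>R X1 (\<Psi> u) = \<beta> *\<^sub>R X2 (\<Psi> u)"
      unfolding span_insert[of "X1 (\<Psi> u)"] by (auto simp: span_singleton)
    then have "dif \<Psi> u v = \<alpha> *\<^sub>R X1 (\<Psi> u) + \<beta> *\<^sub>R X2 (\<Psi> u)"
      by (simp add: algebra_simps)
    then show ?thesis by blast
  qed
  then obtain \<alpha> \<beta> \<gamma> \<delta> where "dif \<Psi> u (axis 1 1) = \<alpha> *\<^sub>R X1 (\<Psi> u) + \<beta> *\<^sub>R X2 (\<Psi> u)"
    "dif \<Psi> u (axis 2 1) = \<gamma> *\<^sub>R X1 (\<Psi> u) + \<delta> *\<^sub>R X2 (\<Psi> u)"
    by metis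
  then have "normal \<Psi> u \<bullet> X1 (\<Psi> u) = 0" "normal \<Psi> u \<bullet> X2 (\<Psi> u) = 0"
    unfolding normal_def
    by (simp_all add: cross_add_left cross_add_right cross_mult_left cross_mult_right dot_cross_self inner_add_left)
  then show False using h by (simp add: hnorm_def)
qed

section \<open>Horizontal normal and minimality of the strip\<close>

context strip
begin

lemma local_param_param: "local_param S D param" and hnorm_param: "u \<in> D \<Longrightarrow> 0 < hnorm param u"
proof -
  \<comment> \<open>The undisplaced strip is obtained as the trivial variation: zero function, empty
    box \<open>cbox 1 0\<close>, parameter \<open>0\<close>.\<close>
  interpret strip_variation I G b \<theta> S "\<lambda>_. 0" 1 0
  proof unfold_locales
    have "cbox (1 :: real^2) 0 = {}"
      by (simp add: interval_eq_empty_cart)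
    then show "cbox (1 :: real^2) 0 \<subseteq> D" by simp
  qed (simp_all add: C2_on_const open_D)
  obtain d where "0 < d" "\<And>s. \<bar>s\<bar> < d \<Longrightarrow> admissible s"
    by (rule admissible_small) (rule that)
  then have adm: "admissible 0" by simp
  show "local_param S D param"
    using local_param_chart[OF adm] by (simp add: param_image flip: param_def)
  show "0 < hnorm param u" if "u \<in> D"
    using density_pos[OF adm that] hnorm_chart[OF that, of 0] by (simp add: param_def)
qed

lemmas param_facts = local_paramD[OF local_param_param]

definition width :: "real^2 \<Rightarrow> real" where "width u = sqrt (1 + (G (u $ 2))\<^sup>2)"

lemma width: "1 \<le> width u" "width u \<noteq> 0" "(width u)\<^sup>2 = 1 + (G (u $ 2))\<^sup>2"
proof -
  show "1 \<le> width u" by (simp add: width_def)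
  then show "width u \<noteq> 0" by linarith
  show "(width u)\<^sup>2 = 1 + (G (u $ 2))\<^sup>2" by (simp add: width_def)
qed

lemma C2_on_width: "C2_on D width"
  unfolding width_def[abs_def] power2_eq_square
  by (intro C2_on_sqrt C2_on_add C2_on_mult C2_on_const C2_on_G open_D) (simp add: add_pos_nonneg)

definition gauss :: "real^3 \<Rightarrow> real^3" where
  "gauss g = (frame1 (proj g) / width (proj g)) *\<^sub>R X1 g + (frame2 (proj g) / width (proj g)) *\<^sub>R X2 g"

definition defining :: "real^3 \<Rightarrow> real" where
  "defining p = to_model p $ 1 - to_model p $ 2 * G (to_model p $ 3)"

definition nbhd :: "(real^3) set" where "nbhd = {p. to_model p $ 3 \<in> I}"

lemma defining_derivative:
  assumes "p \<in> nbhd"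
  shows "(defining has_derivative (\<lambda>h. iso_linear b \<theta> h $ 1
      - (to_model p $ 2 * (deriv G (to_model p $ 3) * iso_linear b \<theta> h $ 3)
        + iso_linear b \<theta> h $ 2 * G (to_model p $ 3)))) (at p)"
proof -
  have c: "((\<lambda>p. to_model p $ i) has_derivative (\<lambda>h. iso_linear b \<theta> h $ i)) (at p)" for i
    unfolding to_model_def by (rule bounded_linear.has_derivative[OF bounded_linear_vec_nth has_derivative_iso])
  have "((\<lambda>p. G (to_model p $ 3)) has_derivative (\<lambda>h. deriv G (to_model p $ 3) * iso_linear b \<theta> h $ 3)) (at p)"
    using has_derivative_compose[OF c[of 3], of G "(*) (deriv G (to_model p $ 3))"] G_deriv[of "to_model p $ 3"] assms
    by (simp add: nbhd_def has_field_derivative_def)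
  from has_derivative_diff[OF c[of 1] has_derivative_mult[OF c[of 2] this]]
  show ?thesis by (simp add: defining_def[abs_def])
qed

text \<open>\<open>A\<close> and \<open>B\<close> are the derivatives of \<open>x - y G(t)\<close>
  along \<open>X1\<close> and \<open>X2\<close> in the model; the rotation mixes them.\<close>

lemma defining_frame:
  assumes "p \<in> nbhd"
  defines "m \<equiv> to_model p"
  defines "A \<equiv> 1 + (m $ 2)\<^sup>2 * deriv G (m $ 3) / 2"
    and "B \<equiv> - G (m $ 3) - m $ 2 * m $ 1 * deriv G (m $ 3) / 2"
  shows "lie X1 defining p = cos \<theta> * A + sin \<theta> * B" "lie X2 defining p = - sin \<theta> * A + cos \<theta> * B"
  unfolding lie_def frechet_derivative_at[OF defining_derivative[OF assms(1)], symmetric]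
    iso_linear_X1 iso_linear_X2 to_model_def[symmetric] m_def[symmetric] A_def B_def
  by (simp_all add: X1_def X2_def power2_eq_square algebra_simps add_divide_distrib diff_divide_distrib)

lemma C2_on_defining: "C2_on nbhd defining"
proof -
  have U: "open nbhd"
  proof -
    have "open ((\<lambda>p. to_model p $ 3) -` I)"
      unfolding to_model_def
      by (intro open_vimage I(1) C2_on_continuous C2_on_nth_compose C2_on_iso open_UNIV)
    then show ?thesis by (simp add: nbhd_def vimage_def)
  qed
  have c: "C2_on nbhd (\<lambda>p. to_model p $ i)" for i
    unfolding to_model_def by (intro C2_on_nth_compose C2_on_iso U)
  show ?thesis
    unfolding defining_def[abs_def]
    by (intro C2_on_diff C2_on_mult C2_on_compose[OF G] c) (auto simp: nbhd_def)
qed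

lemma local_defining_defining: "local_defining S nbhd defining"
  unfolding local_defining_def
proof (intro conjI ballI C2_on_open[OF C2_on_defining] C2_on_defining)
  fix p assume p: "p \<in> nbhd"
  show "gradient defining p \<noteq> 0"
  proof
    assume "gradient defining p = 0"
    then have "lie X1 defining p = 0" "lie X2 defining p = 0"
      using lie_eq_gradient[OF C2_on_differentiable[OF C2_on_defining p]] by simp_all
    \<comment> \<open>Undoing the rotation isolates \<open>A\<close>, which is at least 1 because
      \<open>deriv G\<close> is nonnegative.\<close>
    then have "cos \<theta> * lie X1 defining p - sin \<theta> * lie X2 defining p = 0" by simp
    then have "1 + (to_model p $ 2)\<^sup>2 * deriv G (to_model p $ 3) / 2 = 0"
      unfolding defining_frame[OF p]
      using cos_sin_sum[of "1 + (to_model p $ 2)\<^sup>2 * deriv G (to_model p $ 3) / 2" \<theta>]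
      by (simp add: algebra_simps)
    moreover have "0 \<le> (to_model p $ 2)\<^sup>2 * deriv G (to_model p $ 3)"
      using G'_nonneg p by (simp add: nbhd_def)
    ultimately show False by simp
  qed
next
  show "S \<inter> nbhd = {x \<in> nbhd. defining x = 0}"
    by (auto simp: mem_S_iff nbhd_def defining_def)
qed

lemma S_subset_nbhd: "S \<subseteq> nbhd"
  by (auto simp: mem_S_iff nbhd_def)

text \<open>On the strip \<open>x = y G\<close> turns \<open>B\<close> into \<open>- G A\<close>.
  The positive factor \<open>A\<close> drops out on normalizing, so the horizontal normal depends on
  \<open>t\<close> alone and is constant along the rulings.\<close>

lemma defining_bars:
  assumes g: "g \<in> S"
  shows "pbar defining g = frame1 (proj g) / width (proj g)" "qbar defining g = frame2 (proj g) / width (proj g)"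
proof -
  define m where "m = to_model g"
  define A where "A = 1 + (m $ 2)\<^sup>2 * deriv G (m $ 3) / 2"
  have p: "g \<in> nbhd" using g S_subset_nbhd by auto
  have m: "m $ 1 = m $ 2 * G (m $ 3)" "m $ 3 \<in> I"
    using g by (simp_all add: mem_S_iff m_def)
  have A: "0 < A"
    using G'_nonneg[OF m(2)] by (simp add: A_def add_pos_nonneg)
  have B: "- G (m $ 3) - m $ 2 * m $ 1 * deriv G (m $ 3) / 2 = - G (m $ 3) * A"
    by (simp add: m(1) A_def power2_eq_square algebra_simps)
  have pj: "proj g $ 2 = m $ 3" by (simp add: proj_def m_def)
  have l: "lie X1 defining g = A * frame1 (proj g)" "lie X2 defining g = A * frame2 (proj g)"
    unfolding defining_frame[OF p] m_def[symmetric] A_def[symmetric] B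
    by (simp_all add: frame1_def frame2_def pj algebra_simps)
  have "W defining g = sqrt (A\<^sup>2 * ((frame1 (proj g))\<^sup>2 + (frame2 (proj g))\<^sup>2))"
    by (simp add: W_def l power_mult_distrib distrib_left)
  also have "\<dots> = A * width (proj g)"
    unfolding frame_norm using A by (simp add: real_sqrt_mult width_def)
  finally have W: "W defining g = A * width (proj g)" .
  show "pbar defining g = frame1 (proj g) / width (proj g)" "qbar defining g = frame2 (proj g) / width (proj g)"
    using A by (simp_all add: pbar_def qbar_def l W)
qed

lemma no_char_locus: "char_locus S = {}"
proof -
  have "g \<notin> char_locus S" for g
  proof
    assume g: "g \<in> char_locus S"
    then have "g \<in> S" by (simp add: char_locus_def)
    then have "proj g \<in> D" "param (proj g) = g" by (simp_all add: proj_in_D param_proj)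
    then show False
      using not_characteristic[OF param_facts(2,4), of "proj g"] hnorm_param[of "proj g"] g by simp
  qed
  then show ?thesis by blast
qed

lemma gauss_is_gauss_map: "horizontal_gauss_map S gauss"
  unfolding horizontal_gauss_map_def
proof (intro conjI no_char_locus ballI)
  fix g assume "g \<in> S"
  then show "\<exists>U \<phi>. g \<in> U \<and> local_defining S U \<phi> \<and> (\<forall>x\<in>S \<inter> U. gauss x = pbar \<phi> x *\<^sub>R X1 x + qbar \<phi> x *\<^sub>R X2 x)"
    using S_subset_nbhd local_defining_defining defining_bars
    by (intro exI[of _ nbhd] exI[of _ defining]) (auto simp: gauss_def)
qed

text \<open>The gradients of \<open>\<phi>\<close> and of \<open>defining\<close> are both multiples
  of the normal of \<open>param\<close>; the two signs combine into \<open>\<sigma>\<close>, which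
  at this stage may vary from point to point.\<close>

lemma local_defining_bars:
  assumes \<phi>: "local_defining S U \<phi>" and g: "g \<in> S" "g \<in> U"
  obtains \<sigma> where "\<sigma> = 1 \<or> \<sigma> = -1" "W \<phi> g \<noteq> 0"
    "pbar \<phi> g = \<sigma> * (frame1 (proj g) / width (proj g))" "qbar \<phi> g = \<sigma> * (frame2 (proj g) / width (proj g))"
proof -
  let ?u = "proj g"
  have u: "?u \<in> D" "param ?u = g" using g(1) by (simp_all add: proj_in_D param_proj)
  have g': "g \<in> nbhd" using g(1) S_subset_nbhd by auto
  note n = param_facts(6)[OF u(1)]
  obtain \<kappa> where \<kappa>: "\<kappa> \<noteq> 0" "gradient \<phi> g = \<kappa> *\<^sub>R normal param ?u"
    using gradient_parallel_normal[OF \<phi> param_facts(2,4) u(1) _ n] g(2) u(2) by auto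
  obtain \<kappa>' where \<kappa>': "\<kappa>' \<noteq> 0" "gradient defining g = \<kappa>' *\<^sub>R normal param ?u"
    using gradient_parallel_normal[OF local_defining_defining param_facts(2,4) u(1) _ n] g' u(2) by auto
  note s = gradient_scaled[OF local_defining_differentiable[OF \<phi> g(2)] \<kappa>(2)]
  note s' = gradient_scaled[OF local_defining_differentiable[OF local_defining_defining g'] \<kappa>'(2)]
  have sg: "sgn \<kappa>' * sgn \<kappa>' = 1" using \<kappa>'(1) by (simp add: sgn_if)
  show ?thesis
  proof (rule that[of "sgn \<kappa> * sgn \<kappa>'"])
    show "sgn \<kappa> * sgn \<kappa>' = 1 \<or> sgn \<kappa> * sgn \<kappa>' = -1"
      using \<kappa>(1) \<kappa>'(1) by (auto simp: sgn_if)
    show "W \<phi> g \<noteq> 0"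
      unfolding s(1) using \<kappa>(1) hnorm_param[OF u(1), unfolded hnorm_def u(2)]
      by (metis abs_eq_0 less_irrefl mult_eq_0_iff)
    show "pbar \<phi> g = sgn \<kappa> * sgn \<kappa>' * (frame1 ?u / width ?u)"
      using s(2)[OF \<kappa>(1)] s'(2)[OF \<kappa>'(1)] sg unfolding defining_bars[OF g(1)]
      by (simp only: mult.assoc) (simp only: mult.assoc[symmetric] sg mult_1)
    show "qbar \<phi> g = sgn \<kappa> * sgn \<kappa>' * (frame2 ?u / width ?u)"
      using s(3)[OF \<kappa>(1)] s'(3)[OF \<kappa>'(1)] sg unfolding defining_bars[OF g(1)]
      by (simp only: mult.assoc) (simp only: mult.assoc[symmetric] sg mult_1)
  qed
qed

text \<open>Along the rulings the unit normal is constant up to sign, and it is of unit length in all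
  directions; together this makes its divergence vanish.\<close>

lemma mean_curvature_zero:
  assumes \<phi>: "local_defining S U \<phi>" and g: "g \<in> S" "g \<in> U"
  shows "H_mean_curvature \<phi> g = 0"
proof -
  let ?u = "proj g"
  define V where "V = {x \<in> U. W \<phi> x \<noteq> 0}"
  have \<phi>C: "C2_on U \<phi>" using \<phi> by (simp add: local_defining_def)
  note bars = C1_on_bars[OF \<phi>C V_def]
  have SV: "S \<inter> U \<subseteq> V"
  proof
    fix x assume x: "x \<in> S \<inter> U"
    then show "x \<in> V"
      using local_defining_bars[OF \<phi>, of x] by (auto simp: V_def)
  qed
  then have gV: "g \<in> V" using g by auto
  have oV: "open V" by (rule C1_on_open[OF bars(1)])
  have u: "?u \<in> D" "param ?u = g" using g(1) by (simp_all add: proj_in_D param_proj)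
  define P' Q' where "P' = dif (pbar \<phi>) g" and "Q' = dif (qbar \<phi>) g"
  have P': "(pbar \<phi> has_derivative P') (at g)" and Q': "(qbar \<phi> has_derivative Q') (at g)"
    unfolding P'_def Q'_def
    using C1_on_differentiable[OF bars(1) gV] C1_on_differentiable[OF bars(2) gV] frechet_derivative_works by blast+
  have lin: "linear P'" "linear Q'"
    using P' Q' has_derivative_linear by blast+
  \<comment> \<open>Derivative of \<open>pbar^2 + qbar^2 = 1\<close>, valid in every direction
    because the identity holds on an open set.\<close>
  have unit: "pbar \<phi> g * P' v + qbar \<phi> g * Q' v = 0" for v
  proof -
    have "((\<lambda>x. pbar \<phi> x * pbar \<phi> x + qbar \<phi> x * qbar \<phi> x) has_derivative
        (\<lambda>v. (pbar \<phi> g * P' v + P' v * pbar \<phi> g) + (qbar \<phi> g * Q' v + Q' v * qbar \<phi> g))) (at g)"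
      by (intro has_derivative_add has_derivative_mult P' Q')
    moreover have "((\<lambda>x. pbar \<phi> x * pbar \<phi> x + qbar \<phi> x * qbar \<phi> x) has_derivative (\<lambda>v. 0)) (at g)"
      by (rule has_derivative_transform_within_open[OF has_derivative_const[of 1] oV gV])
        (use bars(3) in \<open>simp add: power2_eq_square\<close>)
    ultimately have "(\<lambda>v. (pbar \<phi> g * P' v + P' v * pbar \<phi> g) + (qbar \<phi> g * Q' v + Q' v * qbar \<phi> g)) = (\<lambda>v. 0)"
      by (rule has_derivative_unique)
    from fun_cong[OF this, of v] show ?thesis by (simp add: mult.commute)
  qed
  \<comment> \<open>The ruling direction at \<open>g\<close>: it is horizontal and orthogonal to the
    horizontal normal.\<close>
  define z where "z = dif param ?u (axis 1 1)"
  have z: "z = - frame2 ?u *\<^sub>R X1 g + frame1 ?u *\<^sub>R X2 g"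
  proof -
    have "z = from_model_linear (dif (model (\<lambda>_. 0) 0) ?u (axis 1 1))"
      unfolding z_def param_def chart_def[abs_def] from_model_def from_model_linear_def
      by (rule frechet_iso_compose[OF C2_on_differentiable[OF C2_on_model[OF C2_on_const[OF open_D]] u(1)]])
    also have "dif (model (\<lambda>_. 0) 0) ?u (axis 1 1) = G (?u $ 2) *\<^sub>R X1 (to_model g) + X2 (to_model g)"
      unfolding frechet_model[OF C2_on_const[OF open_D] u(1)]
      using g(1) by (simp add: vec_eq_iff forall_3 axis_def X1_def X2_def mem_S_iff proj_def)
    also have "from_model_linear \<dots> = G (?u $ 2) *\<^sub>R (cos \<theta> *\<^sub>R X1 g - sin \<theta> *\<^sub>R X2 g) + (sin \<theta> *\<^sub>R X1 g + cos \<theta> *\<^sub>R X2 g)"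
      unfolding from_model_linear_def linear_add[OF linear_iso_linear] linear_scale[OF linear_iso_linear]
        iso_linear_X1 iso_linear_X2 from_model_def[symmetric] by simp
    finally show ?thesis
      by (simp add: frame1_def frame2_def algebra_simps)
  qed
  define \<gamma> where "\<gamma> r = param (?u + r *\<^sub>R axis 1 1)" for r :: real
  have \<gamma>D: "?u + r *\<^sub>R axis 1 1 \<in> D" for r
    using u(1) by (simp add: D_def axis_def)
  have \<gamma>S: "\<gamma> r \<in> S" for r
    unfolding \<gamma>_def using \<gamma>D param_in_S by simp
  have \<gamma>': "(\<gamma> has_derivative (\<lambda>r. r *\<^sub>R z)) (at 0)"
  proof -
    have "((\<lambda>r. ?u + r *\<^sub>R axis 1 1) has_derivative (\<lambda>r. r *\<^sub>R axis 1 1)) (at 0)"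
      by (auto intro!: derivative_eq_intros)
    moreover have "(param has_derivative dif param ?u) (at (?u + 0 *\<^sub>R axis 1 1))"
      using C2_on_frechet_works[OF param_facts(2) u(1)] by simp
    ultimately have "((\<lambda>r. param (?u + r *\<^sub>R axis 1 1)) has_derivative
        (\<lambda>r. dif param ?u (r *\<^sub>R axis 1 1))) (at 0)"
      by (rule has_derivative_compose)
    then show ?thesis
      unfolding \<gamma>_def[abs_def] z_def
      using linear_scale[OF linear_frechet_derivative[OF C2_on_differentiable[OF param_facts(2) u(1)]]] by simp
  qed
  have \<gamma>0: "\<gamma> 0 = g" by (simp add: \<gamma>_def u(2))
  have "continuous_on UNIV \<gamma>"
    unfolding \<gamma>_def[abs_def]
    by (rule continuous_on_compose2[OF param_facts(3)]) (use \<gamma>D in \<open>auto intro!: continuous_intros\<close>)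
  then have N: "open (\<gamma> -` U)" "0 \<in> \<gamma> -` U"
    using C2_on_open[OF \<phi>C] g(2) \<gamma>0 by (auto intro: open_vimage)
  \<comment> \<open>Only squares are known to be constant along the ruling, as the sign might jump.
    A zero value at \<open>g\<close> makes the function vanish along the whole ruling inside
    \<open>U\<close>; otherwise differentiating the square suffices.\<close>
  have ruling: "f' z = 0"
    if f: "(f has_derivative f') (at g)" and sq: "\<And>r. \<gamma> r \<in> U \<Longrightarrow> (f (\<gamma> r))\<^sup>2 = k" for f :: "real^3 \<Rightarrow> real" and f' k
  proof -
    have d: "((\<lambda>r. f (\<gamma> r)) has_derivative (\<lambda>r. f' (r *\<^sub>R z))) (at 0)"
      using has_derivative_compose[OF \<gamma>'] f \<gamma>0 by simp
    show ?thesis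
    proof (cases "f g = 0")
      case True
      then have "k = 0" using sq[of 0] g(2) \<gamma>0 by simp
      then have "((\<lambda>r. f (\<gamma> r)) has_derivative (\<lambda>_. 0)) (at 0)"
        by (intro has_derivative_transform_within_open[OF has_derivative_const[of 0] N]) (use sq in auto)
      from fun_cong[OF has_derivative_unique[OF d this], of 1] show ?thesis by simp
    next
      case False
      have "((\<lambda>r. f (\<gamma> r) * f (\<gamma> r)) has_derivative (\<lambda>r. f (\<gamma> 0) * f' (r *\<^sub>R z) + f' (r *\<^sub>R z) * f (\<gamma> 0))) (at 0)"
        by (rule has_derivative_mult[OF d d])
      moreover have "((\<lambda>r. f (\<gamma> r) * f (\<gamma> r)) has_derivative (\<lambda>_. 0)) (at 0)"
        by (intro has_derivative_transform_within_open[OF has_derivative_const[of k] N])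
          (use sq in \<open>auto simp: power2_eq_square\<close>)
      ultimately have "(\<lambda>r. f (\<gamma> 0) * f' (r *\<^sub>R z) + f' (r *\<^sub>R z) * f (\<gamma> 0)) = (\<lambda>_. 0)"
        by (rule has_derivative_unique)
      from fun_cong[OF this, of 1] show ?thesis using False \<gamma>0 by simp
    qed
  qed
  have along: "frame1 (proj (\<gamma> r)) = frame1 ?u" "frame2 (proj (\<gamma> r)) = frame2 ?u" "width (proj (\<gamma> r)) = width ?u" for r
    by (simp_all add: \<gamma>_def frame1_def frame2_def width_def axis_def)
  have "(pbar \<phi> (\<gamma> r))\<^sup>2 = (frame1 ?u / width ?u)\<^sup>2" "(qbar \<phi> (\<gamma> r))\<^sup>2 = (frame2 ?u / width ?u)\<^sup>2" if "\<gamma> r \<in> U" for r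
    using local_defining_bars[OF \<phi> \<gamma>S that] unfolding along by (metis mult_1 mult_minus1 power2_minus)+
  then have "P' z = 0" "Q' z = 0"
    using ruling[OF P'] ruling[OF Q'] by blast+
  then have Z: "frame1 ?u * P' (X2 g) = frame2 ?u * P' (X1 g)" "frame1 ?u * Q' (X2 g) = frame2 ?u * Q' (X1 g)"
    unfolding z by (simp_all add: linear_add[OF lin(1)] linear_scale[OF lin(1)] linear_add[OF lin(2)] linear_scale[OF lin(2)]
        linear_diff[OF lin(1)] linear_diff[OF lin(2)])
  obtain \<sigma> where \<sigma>: "\<sigma> = 1 \<or> \<sigma> = -1" "pbar \<phi> g = \<sigma> * (frame1 ?u / width ?u)" "qbar \<phi> g = \<sigma> * (frame2 ?u / width ?u)"
    using local_defining_bars[OF \<phi> g] by blast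
  have F: "frame1 ?u * P' v + frame2 ?u * Q' v = 0" for v
    using unit[of v] \<sigma>(1) width(2)[of ?u] unfolding \<sigma>(2,3) by (auto simp: field_simps)
  define f1 f2 p1 p2 q1 q2 where "f1 = frame1 ?u" and "f2 = frame2 ?u" and "p1 = P' (X1 g)" and "p2 = P' (X2 g)"
    and "q1 = Q' (X1 g)" and "q2 = Q' (X2 g)"
  have E: "f1 * p2 = f2 * p1" "f1 * q2 = f2 * q1" "f1 * p1 + f2 * q1 = 0" "f1 * p2 + f2 * q2 = 0"
    unfolding f1_def f2_def p1_def p2_def q1_def q2_def by (rule Z F)+
  \<comment> \<open>The matrix of \<open>P'\<close>, \<open>Q'\<close> in the horizontal frame kills
    \<open>(-f2, f1)\<close> from the right and is killed by \<open>(f1, f2)\<close> from the left.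
    It is thus a multiple of the outer product of these two vectors, whose trace is zero; the trace
    is the mean curvature.\<close>
  have "(f1\<^sup>2 + f2\<^sup>2) * (p1 + q2) = 0"
  proof -
    have "(f1\<^sup>2 + f2\<^sup>2) * (p1 + q2) = f1 * (f1 * p1 + f2 * q1) + f2 * (f1 * p2 + f2 * q2)
      + f1 * (f1 * q2 - f2 * q1) - f2 * (f1 * p2 - f2 * p1)"
      by (simp add: power2_eq_square algebra_simps)
    then show ?thesis
      unfolding E(3,4) by (simp add: E(1,2))
  qed
  moreover have "f1\<^sup>2 + f2\<^sup>2 \<noteq> 0"
    unfolding f1_def f2_def frame_norm using width(2,3)[of ?u] by (metis zero_eq_power2)
  ultimately have "p1 + q2 = 0" by auto
  then show ?thesis
    by (simp add: H_mean_curvature_def lie_def p1_def q2_def P'_def Q'_def)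
qed

lemma H_minimal_strip: "H_minimal S"
  unfolding H_minimal_def C2_surface_def
  using no_char_locus local_defining_defining S_subset_nbhd mean_curvature_zero by blast

end

section \<open>Instability\<close>

lemma C2_0_scale:
  assumes "f \<in> C2_0 S"
  shows "(\<lambda>g. r * f g) \<in> C2_0 S"
  unfolding C2_0_def mem_Collect_eq
proof (intro conjI ballI)
  show "\<forall>g. g \<notin> S \<longrightarrow> r * f g = 0"
    using assms by (simp add: C2_0_def)
  obtain K where "compact K" "K \<subseteq> S" "\<forall>g\<in>S - K. f g = 0"
    using assms by (auto simp: C2_0_def)
  then show "\<exists>K. compact K \<and> K \<subseteq> S \<and> (\<forall>g\<in>S - K. r * f g = 0)"
    by (intro exI[of _ K]) simp
  fix g assume "g \<in> S"
  then obtain U F where F: "g \<in> U" "C2_on U F" "\<forall>x\<in>S \<inter> U. f x = F x"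
    using assms unfolding C2_0_def by blast
  have "C2_on U (\<lambda>x. r * F x)"
    by (intro C2_on_mult C2_on_const C2_on_open[OF F(2)] F(2))
  then show "\<exists>U F. g \<in> U \<and> C2_on U F \<and> (\<forall>x\<in>S \<inter> U. r * f x = F x)"
    using F by (intro exI[of _ U] exI[of _ "\<lambda>x. r * F x"]) simp
qed

text \<open>Scaling the variation field rescales the parameter of the variation.\<close>

lemma has_second_variation_scale:
  assumes Y: "has_second_variation S Y v" and r: "r \<noteq> 0"
  shows "has_second_variation S (\<lambda>g. r *\<^sub>R Y g) (r\<^sup>2 * v)"
  unfolding has_second_variation_def Let_def
proof (intro conjI allI impI)
  have "Y \<in> variation_fields S"
    using Y by (simp add: has_second_variation_def)
  then obtain a b k where "a \<in> C2_0 S" "b \<in> C2_0 S" "k \<in> C2_0 S"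
    "Y = (\<lambda>g. a g *\<^sub>R X1 g + b g *\<^sub>R X2 g + k g *\<^sub>R T g)"
    unfolding variation_fields_def by blast
  then show "(\<lambda>g. r *\<^sub>R Y g) \<in> variation_fields S"
    unfolding variation_fields_def
    by (intro CollectI exI[of _ "\<lambda>g. r * a g"] exI[of _ "\<lambda>g. r * b g"] exI[of _ "\<lambda>g. r * k g"])
      (simp add: C2_0_scale scaleR_add_right)
  fix K assume K: "compact K" "K \<subseteq> S" "\<forall>g\<in>S - K. r *\<^sub>R Y g = 0"
  define P where "P s = measure (H_perimeter_measure (displace Y s ` S)) (displace Y s ` K)" for s
  have "\<forall>g\<in>S - K. Y g = 0" using K(3) r by simp
  then have "\<exists>P'. (\<forall>\<^sub>F s in nhds 0. (P has_real_derivative P' s) (at s)) \<and> (P' has_real_derivative v) (at 0)"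
    unfolding P_def[abs_def]
    by (rule Y[unfolded has_second_variation_def Let_def, THEN conjunct2, THEN spec, THEN mp, THEN mp, THEN mp,
          OF K(1,2)])
  then obtain P' where P': "\<forall>\<^sub>F s in nhds 0. (P has_real_derivative P' s) (at s)"
    "(P' has_real_derivative v) (at 0)"
    by blast
  have disp: "displace (\<lambda>g. r *\<^sub>R Y g) s = displace Y (r * s)" for s
    by (simp add: displace_def fun_eq_iff mult.commute)
  have lin: "((\<lambda>s. r * s) has_real_derivative r) (at s)" for s
    by (auto intro!: derivative_eq_intros)
  have "((\<lambda>s. r * s) \<longlongrightarrow> r * 0) (nhds 0)"
    by (intro tendsto_mult tendsto_const filterlim_ident)
  then have lim: "filterlim (\<lambda>s. r * s) (nhds 0) (nhds 0)"
    by simp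
  from lim have "\<forall>\<^sub>F s in nhds 0. (P has_real_derivative P' (r * s)) (at (r * s))"
    by (rule eventually_compose_filterlim[OF P'(1)])
  then have 1: "\<forall>\<^sub>F s in nhds 0. ((\<lambda>s. P (r * s)) has_real_derivative r * P' (r * s)) (at s)"
  proof (rule eventually_mono)
    fix s assume "(P has_real_derivative P' (r * s)) (at (r * s))"
    from DERIV_chain2[OF this lin] show "((\<lambda>s. P (r * s)) has_real_derivative r * P' (r * s)) (at s)"
      by (simp add: mult.commute)
  qed
  have 2: "((\<lambda>s. r * P' (r * s)) has_real_derivative r\<^sup>2 * v) (at 0)"
    using DERIV_cmult[OF DERIV_chain2[of P' v "\<lambda>s. r * s" 0 r UNIV], of r] P'(2) lin
    by (simp add: power2_eq_square mult_ac)
  show "\<exists>P'. (\<forall>\<^sub>F s in nhds 0. ((\<lambda>s. measure (H_perimeter_measure (displace (\<lambda>g. r *\<^sub>R Y g) s ` S))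
        (displace (\<lambda>g. r *\<^sub>R Y g) s ` K)) has_real_derivative P' s) (at s)) \<and>
      (P' has_real_derivative r\<^sup>2 * v) (at 0)"
    unfolding disp P_def[symmetric] by (intro exI[of _ "\<lambda>s. r * P' (r * s)"] conjI 1 2)
qed

section \<open>Orientation, and the continuum of test functions\<close>

context strip
begin

text \<open>The sign is recovered as the frame inner product of \<open>\<nu>\<close> and
  \<open>gauss\<close>, which makes it continuous on \<open>S\<close>. As the image of the convex
  set \<open>D\<close>, the strip is connected, so a continuous function with values 1 and -1 is
  constant.\<close>

lemma gauss_unique_up_to_sign:
  assumes \<nu>: "horizontal_gauss_map S \<nu>"
  obtains \<sigma> where "\<sigma> = 1 \<or> \<sigma> = (-1::real)" "\<And>g. g \<in> S \<Longrightarrow> \<nu> g = \<sigma> *\<^sub>R gauss g"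
proof -
  define \<sigma> where "\<sigma> g = \<nu> g $ 1 * gauss g $ 1 + \<nu> g $ 2 * gauss g $ 2" for g
  have gauss_c: "gauss g $ 1 = frame1 (proj g) / width (proj g)" "gauss g $ 2 = frame2 (proj g) / width (proj g)" for g
    by (simp_all add: gauss_def X1_def X2_def)
  have unit: "gauss g $ 1 * gauss g $ 1 + gauss g $ 2 * gauss g $ 2 = 1" for g
  proof -
    have "gauss g $ 1 * gauss g $ 1 + gauss g $ 2 * gauss g $ 2
        = ((frame1 (proj g))\<^sup>2 + (frame2 (proj g))\<^sup>2) / (width (proj g))\<^sup>2"
      by (simp add: gauss_c power2_eq_square add_divide_distrib)
    then show ?thesis
      unfolding frame_norm width(3)[symmetric] using width(2)[of "proj g"] by simp
  qed
  have loc: "(\<sigma> g = 1 \<or> \<sigma> g = -1) \<and> \<nu> g = \<sigma> g *\<^sub>R gauss g" and cont: "continuous (at g within S) \<sigma>" if g: "g \<in> S" for g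
  proof -
    obtain U \<phi> where U: "g \<in> U" "local_defining S U \<phi>"
      "\<And>x. x \<in> S \<inter> U \<Longrightarrow> \<nu> x = pbar \<phi> x *\<^sub>R X1 x + qbar \<phi> x *\<^sub>R X2 x"
      using \<nu> g unfolding horizontal_gauss_map_def by blast
    have \<phi>C: "C2_on U \<phi>" using U(2) by (simp add: local_defining_def)
    have oU: "open U" by (rule C2_on_open[OF \<phi>C])
    obtain \<rho> where \<rho>: "\<rho> = 1 \<or> \<rho> = -1" "pbar \<phi> g = \<rho> * (frame1 (proj g) / width (proj g))"
      "qbar \<phi> g = \<rho> * (frame2 (proj g) / width (proj g))"
      using local_defining_bars[OF U(2) g U(1)] by blast
    have \<nu>g: "\<nu> g = \<rho> *\<^sub>R gauss g"
      using U(3)[of g] g U(1) by (simp add: \<rho> gauss_def scaleR_add_right)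
    then have "\<sigma> g = \<rho> * (gauss g $ 1 * gauss g $ 1 + gauss g $ 2 * gauss g $ 2)"
      by (simp add: \<sigma>_def algebra_simps)
    then show "(\<sigma> g = 1 \<or> \<sigma> g = -1) \<and> \<nu> g = \<sigma> g *\<^sub>R gauss g"
      using \<rho>(1) \<nu>g by (simp add: unit)
    define V where "V = {x \<in> U. W \<phi> x \<noteq> 0}"
    note bars = C1_on_bars[OF \<phi>C V_def]
    have SV: "S \<inter> U \<subseteq> V"
    proof
      fix x assume x: "x \<in> S \<inter> U"
      then show "x \<in> V"
        using local_defining_bars[OF U(2), of x] by (auto simp: V_def)
    qed
    have pD: "proj x \<in> D" if "x \<in> S \<inter> U" for x
      using that proj_in_D by blast
    have "continuous_on (S \<inter> U) (\<lambda>x. pbar \<phi> x * (frame1 (proj x) / width (proj x)) + qbar \<phi> x * (frame2 (proj x) / width (proj x)))"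
      by (intro continuous_intros continuous_on_subset[OF C1_on_continuous[OF bars(1)] SV]
          continuous_on_subset[OF C1_on_continuous[OF bars(2)] SV]
          continuous_on_compose2[OF C2_on_continuous[OF C2_on_frame(1)] continuous_on_proj]
          continuous_on_compose2[OF C2_on_continuous[OF C2_on_frame(2)] continuous_on_proj]
          continuous_on_compose2[OF C2_on_continuous[OF C2_on_width] continuous_on_proj])
        (use pD width(2) in auto)
    then have "continuous_on (S \<inter> U) \<sigma>"
      by (rule continuous_on_eq) (simp add: \<sigma>_def U(3) gauss_c X1_def X2_def)
    then have "continuous (at g within S \<inter> U) \<sigma>"
      using g U(1) by (simp add: continuous_on_eq_continuous_within)
    moreover have "at g within S \<inter> U = at g within S"
      by (rule at_within_nhd[OF U(1) oU]) auto
    ultimately show "continuous (at g within S) \<sigma>"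
      by simp
  qed
  have "continuous_on S \<sigma>"
    using cont by (simp add: continuous_on_eq_continuous_within)
  moreover have "connected S"
    unfolding param_image[symmetric]
    by (rule connected_continuous_image[OF param_facts(3) convex_connected[OF convex_D]])
  ultimately have "connected (\<sigma> ` S)"
    by (rule connected_continuous_image)
  moreover have fin: "\<sigma> ` S \<subseteq> {1, -1}" using loc by auto
  then have "finite (\<sigma> ` S)" by (rule finite_subset) simp
  ultimately have "\<sigma> ` S = {} \<or> (\<exists>c. \<sigma> ` S = {c})"
    using connected_finite_iff_sing by blast
  then obtain c where c: "c = 1 \<or> c = -1" "\<And>g. g \<in> S \<Longrightarrow> \<sigma> g = c"
    using fin by blast
  show ?thesis
    by (rule that[OF c(1)]) (use loc c(2) in auto)
qed

text \<open>For an arbitrary Gauss map the global sign joins the scaling factor, and only the square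
  of that factor reaches the second variation.\<close>

lemma unstable_continuum:
  assumes t0: "t0 \<in> I" "0 < deriv G t0"
  shows "unstable S \<and> (\<exists>\<nu>. horizontal_gauss_map S \<nu>) \<and>
    (\<forall>\<nu>. horizontal_gauss_map S \<nu> \<longrightarrow>
      (\<exists>\<H>. \<H> \<approx> (UNIV :: real set) \<and> \<H> \<subseteq> C2_0 S \<and>
        (\<forall>h\<in>\<H>. \<exists>v<0. has_second_variation S (\<lambda>g. h g *\<^sub>R \<nu> g) v)))"
proof -
  obtain a l h v u where a: "C2_on D a" "cbox l h \<subseteq> D" "\<And>u. u \<notin> cbox l h \<Longrightarrow> a u = 0"
    and u: "u \<in> D" "a u \<noteq> 0" and v: "v < 0"
    and var: "has_second_variation S
      (\<lambda>g. if g \<in> S then a (proj g) *\<^sub>R (frame1 (proj g) *\<^sub>R X1 g + frame2 (proj g) *\<^sub>R X2 g) else 0) v"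
    by (rule negative_variation[OF t0]) (rule that)
  define k where "k g = (if g \<in> S then a (proj g) * width (proj g) else 0)" for g
  have kC: "k \<in> C2_0 S"
    unfolding k_def[abs_def] using C2_0_I[OF C2_on_mult[OF a(1) C2_on_width] a(2)] a(3) by simp
  have k_nz: "k (param u) \<noteq> 0"
    using u width(2)[of u] param_in_S by (simp add: k_def)
  have "(if g \<in> S then a (proj g) *\<^sub>R (frame1 (proj g) *\<^sub>R X1 g + frame2 (proj g) *\<^sub>R X2 g) else 0) = k g *\<^sub>R gauss g" for g
    using width(2)[of "proj g"] by (simp add: k_def gauss_def scaleR_add_right)
  then have var_k: "has_second_variation S (\<lambda>g. k g *\<^sub>R gauss g) v"
    using var by simp
  have "unstable S"
    unfolding unstable_def
    by (intro conjI H_minimal_strip exI[of _ "\<lambda>g. k g *\<^sub>R gauss g"] exI[of _ v] var_k v)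
  moreover have "\<exists>\<nu>. horizontal_gauss_map S \<nu>"
    by (rule exI[of _ gauss]) (rule gauss_is_gauss_map)
  moreover have "\<exists>\<H>. \<H> \<approx> (UNIV :: real set) \<and> \<H> \<subseteq> C2_0 S \<and>
        (\<forall>h\<in>\<H>. \<exists>v<0. has_second_variation S (\<lambda>g. h g *\<^sub>R \<nu> g) v)"
    if \<nu>: "horizontal_gauss_map S \<nu>" for \<nu>
  proof -
    obtain \<sigma> where \<sigma>: "\<sigma> = 1 \<or> \<sigma> = (-1::real)" "\<And>g. g \<in> S \<Longrightarrow> \<nu> g = \<sigma> *\<^sub>R gauss g"
      by (rule gauss_unique_up_to_sign[OF \<nu>]) (rule that)
    \<comment> \<open>\<open>exp\<close> makes all real scalings nonzero and distinct; they are told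
      apart at the point \<open>param u\<close>, where \<open>k\<close> does not vanish.\<close>
    define F where "F r = (\<lambda>g. exp r * k g)" for r :: real
    have "inj F"
    proof (rule injI)
      fix r r' assume "F r = F r'"
      from fun_cong[OF this, of "param u"] show "r = r'"
        using k_nz by (simp add: F_def)
    qed
    then have "range F \<approx> (UNIV :: real set)"
      by (rule inj_on_image_eqpoll_self)
    moreover have "range F \<subseteq> C2_0 S"
      using C2_0_scale[OF kC] by (auto simp: F_def)
    moreover have "\<exists>v'<0. has_second_variation S (\<lambda>g. F r g *\<^sub>R \<nu> g) v'" for r
    proof (intro exI conjI)
      \<comment> \<open>Off \<open>S\<close> nothing is known about \<open>\<nu>\<close>, but
        \<open>k\<close> is zero there.\<close>
      have eq: "F r g *\<^sub>R \<nu> g = (exp r * \<sigma>) *\<^sub>R (k g *\<^sub>R gauss g)" for g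
        using \<sigma>(2)[of g] by (cases "g \<in> S") (simp_all add: F_def k_def)
      have nz: "exp r * \<sigma> \<noteq> 0" using \<sigma>(1) by auto
      show "has_second_variation S (\<lambda>g. F r g *\<^sub>R \<nu> g) ((exp r * \<sigma>)\<^sup>2 * v)"
        unfolding eq by (rule has_second_variation_scale[OF var_k nz])
      show "(exp r * \<sigma>)\<^sup>2 * v < 0"
        using nz v by (simp add: mult_pos_neg)
    qed
    ultimately show ?thesis
      by (intro exI[of _ "range F"]) auto
  qed
  ultimately show ?thesis
    by (intro conjI allI impI)
qed

end

lemma rotation_t_compose: "rotation_t \<alpha> (rotation_t \<beta> p) = rotation_t (\<alpha> + \<beta>) p"
  by (simp add: rotation_t_def cos_add sin_add vec_eq_iff forall_3 algebra_simps)

text \<open>The quarter turn \<open>(x, y) -> (y, -x)\<close> exchanges the two normal forms with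
  the same \<open>G\<close>, so the sign condition on \<open>deriv G\<close> is kept.\<close>

lemma rotated_strip:
  assumes "heis_iso b \<theta> ` S = {p. p $ 3 \<in> I \<and> p $ 2 = - p $ 1 * G (p $ 3)}"
  shows "heis_iso (rotation_t (- (pi / 2)) b) (- (pi / 2) + \<theta>) ` S = {p. p $ 3 \<in> I \<and> p $ 1 = p $ 2 * G (p $ 3)}"
proof -
  have rot: "rotation_t (- (pi / 2)) p = vector [p $ 2, - p $ 1, p $ 3]" for p
    by (simp add: rotation_t_def vec_eq_iff forall_3)
  have "heis_iso (rotation_t (- (pi / 2)) b) (- (pi / 2) + \<theta>) p = rotation_t (- (pi / 2)) (heis_iso b \<theta> p)" for p :: "real^3"
    by (simp only: heis_iso_def rotation_t_heis_mult rotation_t_compose)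
  then have "heis_iso (rotation_t (- (pi / 2)) b) (- (pi / 2) + \<theta>) ` S
      = rotation_t (- (pi / 2)) ` (heis_iso b \<theta> ` S)"
    by (simp add: image_image)
  also have "\<dots> = {p. p $ 3 \<in> I \<and> p $ 1 = p $ 2 * G (p $ 3)}"
    unfolding assms
  proof (intro equalityI subsetI)
    fix p :: "real^3" assume "p \<in> {p. p $ 3 \<in> I \<and> p $ 1 = p $ 2 * G (p $ 3)}"
    then show "p \<in> rotation_t (- (pi / 2)) ` {p. p $ 3 \<in> I \<and> p $ 2 = - p $ 1 * G (p $ 3)}"
      by (intro image_eqI[of _ _ "vector [- p $ 2, p $ 1, p $ 3]"]) (auto simp: rot vec_eq_iff forall_3)
  qed (auto simp: rot)
  finally show ?thesis .
qed

theorem theorem1p6: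
  fixes S :: "(real^3) set"
  assumes "strict_graphical_strip S"
  shows "unstable S \<and>
    (\<exists>\<nu>. horizontal_gauss_map S \<nu>) \<and>
    (\<forall>\<nu>. horizontal_gauss_map S \<nu> \<longrightarrow>
      (\<exists>\<H>. \<H> \<approx> (UNIV :: real set) \<and> \<H> \<subseteq> C2_0 S \<and>
        (\<forall>h\<in>\<H>. \<exists>v<0. has_second_variation S (\<lambda>g. h g *\<^sub>R \<nu> g) v)))"
proof -
  obtain I G J where strip: "graphical_strip_with I G S"
    and J: "J \<noteq> {}" "J \<subseteq> I" "\<forall>t\<in>J. deriv G t > 0"
    using assms unfolding strict_graphical_strip_def by blast
  obtain t0 where t0: "t0 \<in> I" "0 < deriv G t0"
    using J by blast
  have base: "open I" "is_interval I" "C2_on I G" "\<And>t. t \<in> I \<Longrightarrow> 0 \<le> deriv G t"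
    using strip by (auto simp: graphical_strip_with_def)
  have "\<exists>b \<theta>. heis_iso b \<theta> ` S = {p. p $ 3 \<in> I \<and> p $ 1 = p $ 2 * G (p $ 3)} \<or>
      heis_iso b \<theta> ` S = {p. p $ 3 \<in> I \<and> p $ 2 = - p $ 1 * G (p $ 3)}"
    using strip by (simp add: graphical_strip_with_def heis_iso_def[abs_def])
  then obtain b \<theta> where "heis_iso b \<theta> ` S = {p. p $ 3 \<in> I \<and> p $ 1 = p $ 2 * G (p $ 3)} \<or>
      heis_iso b \<theta> ` S = {p. p $ 3 \<in> I \<and> p $ 2 = - p $ 1 * G (p $ 3)}"
    by (elim exE)
  then show ?thesis
  proof
    assume "heis_iso b \<theta> ` S = {p. p $ 3 \<in> I \<and> p $ 1 = p $ 2 * G (p $ 3)}"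
    then have "strip I G b \<theta> S"
      by (intro strip.intro base)
    then show ?thesis
      by (rule strip.unstable_continuum[OF _ t0])
  next
    assume "heis_iso b \<theta> ` S = {p. p $ 3 \<in> I \<and> p $ 2 = - p $ 1 * G (p $ 3)}"
    then have "strip I G (rotation_t (- (pi / 2)) b) (- (pi / 2) + \<theta>) S"
      by (intro strip.intro base rotated_strip)
    then show ?thesis
      by (rule strip.unstable_continuum[OF _ t0])
  qed
qed

end
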